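(* Let $R=K[x_1,\ldots,x_n]$ be a polynomial ring over a field $K$, let $I\subset R$ be a squarefree monomial ideal, and let $f=x_{i_1}\cdots x_{i_k}$ be a squarefree monomial of $R$ of degree $k$. Then the following conditions are equivalent, and each of them holds. (i) $\operatorname{depth}(R/(f,I))\geq\operatorname{depth}(R/I)-1$. (ii) $\operatorname{depth}(R/I)\leq\operatorname{depth}(R/(I\colon f))$. (iii) $\operatorname{depth}(R/(x_{i_1},\ldots,x_{i_k},I))\geq\operatorname{depth}(R/I)-k$. (iv) $\operatorname{reg}(R/I)\geq\operatorname{reg}(R/(I\colon f))$. (v) $\operatorname{reg}(R/(f,I))\leq\operatorname{reg}(R/I)+k-1$.
   Context: $(I\colon f)=\{g\in R\mid gf\in I\}$. The equivalence of conditions (i)--(v) is meant for the conditions regarded as statements about all squarefree monomial ideals $I$ and all squarefree monomials $f$. Depth is with respect to the graded maximal ideal $(x_1,\ldots,x_n)$, $\operatorname{reg}$ is Castelnuovo--Mumford regularity, and $\operatorname{depth}(0)=\infty$, $\operatorname{reg}(0)=-\infty$. *)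

theory Defs
  imports
    "HOL-Library.Poly_Mapping"
    "HOL-Library.Extended_Real"
    "Jordan_Normal_Form.Matrix"
begin

section \<open>Ideals of a polynomial ring\<close>

text \<open>The variables of \<open>K[x\<^sub>1,\<dots>,x\<^sub>n]\<close> are indexed by a finite type \<open>'n\<close>, so \<open>n = CARD('n)\<close>.
  A polynomial maps exponent vectors to coefficients; its product is convolution.\<close>

type_synonym ('n, 'k) mpoly = "('n \<Rightarrow>\<^sub>0 nat) \<Rightarrow>\<^sub>0 'k"

definition Var :: "'n \<Rightarrow> ('n, 'k::field) mpoly" where
  "Var i = Poly_Mapping.single (Poly_Mapping.single i 1) 1"

abbreviation ideal_of :: "'a::comm_ring_1 set \<Rightarrow> 'a set" where
  "ideal_of \<equiv> Modules.module.span (*)"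

definition sqfree_monomial :: "'n set \<Rightarrow> ('n::finite, 'k::field) mpoly" where
  "sqfree_monomial S = (\<Prod>i\<in>S. Var i)"

definition sqfree_monomial_ideal :: "('n::finite, 'k::field) mpoly set \<Rightarrow> bool" where
  "sqfree_monomial_ideal I \<longleftrightarrow> (\<exists>\<S>. I = ideal_of (sqfree_monomial ` \<S>))"

definition colon :: "'a::comm_ring_1 set \<Rightarrow> 'a \<Rightarrow> 'a set" where
  "colon I f = {g. g * f \<in> I}"

definition max_ideal :: "('n::finite, 'k::field) mpoly set" where
  "max_ideal = ideal_of (range Var)"


section \<open>Depth\<close>

text \<open>\<open>regular_sequence J gs\<close>: the list \<open>gs\<close> is a regular sequence on the module \<open>R/J\<close>, i.e.
  \<open>(gs)(R/J) \<noteq> R/J\<close> and each \<open>gs ! i\<close> is a nonzerodivisor on \<open>R/(J, gs ! 0, \<dots>, gs ! (i - 1))\<close>.\<close>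

definition regular_sequence :: "'a::comm_ring_1 set \<Rightarrow> 'a list \<Rightarrow> bool" where
  "regular_sequence J gs \<longleftrightarrow>
     ideal_of (J \<union> set gs) \<noteq> UNIV \<and>
     (\<forall>i<length gs. \<forall>h. gs ! i * h \<in> ideal_of (J \<union> set (take i gs)) \<longrightarrow>
        h \<in> ideal_of (J \<union> set (take i gs)))"

text \<open>\<open>depth_quot J\<close> is the depth of \<open>R/J\<close> with respect to the graded maximal ideal.\<close>

definition depth_quot :: "('n::finite, 'k::field) mpoly set \<Rightarrow> ereal" where
  "depth_quot J =
     (if J = UNIV then \<infinity>
      else Sup {ereal (real (length gs)) | gs. set gs \<subseteq> max_ideal \<and> regular_sequence J gs})"


section \<open>Castelnuovo-Mumford regularity\<close>

text \<open>The zero polynomial is homogeneous of every degree. The degree condition is written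
  additively so that an entry of negative degree \<open>b - a\<close> is forced to vanish.\<close>

definition homogeneous_shift :: "nat \<Rightarrow> nat \<Rightarrow> ('n::finite, 'k::field) mpoly \<Rightarrow> bool" where
  "homogeneous_shift a b p \<longleftrightarrow>
     (\<forall>t \<in> Poly_Mapping.keys p. a + (\<Sum>i\<in>UNIV. Poly_Mapping.lookup t i) = b)"

definition mat_ker :: "'a::comm_ring_1 mat \<Rightarrow> 'a vec set" where
  "mat_ker A = {v \<in> carrier_vec (dim_col A). A *\<^sub>v v = 0\<^sub>v (dim_row A)}"

definition mat_im :: "'a::comm_ring_1 mat \<Rightarrow> 'a vec set" where
  "mat_im A = (\<lambda>v. A *\<^sub>v v) ` carrier_vec (dim_col A)"

text \<open>A graded free resolution
  \<open>\<dots> \<rightarrow> F\<^sub>2 \<rightarrow> F\<^sub>1 \<rightarrow> F\<^sub>0 = R \<rightarrow> R/J \<rightarrow> 0\<close>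
  with \<open>F\<^sub>i = \<Oplus>\<^sub>c R(-(a i ! c))\<close>; the list \<open>a i\<close> holds the degrees of the basis of \<open>F\<^sub>i\<close>, and the
  matrix \<open>d i\<close> is the degree-0 map \<open>F\<^sub>i\<^sub>+\<^sub>1 \<rightarrow> F\<^sub>i\<close>.\<close>

definition graded_free_resolution ::
    "('n::finite, 'k::field) mpoly set \<Rightarrow> (nat \<Rightarrow> nat list) \<Rightarrow> (nat \<Rightarrow> ('n, 'k) mpoly mat) \<Rightarrow> bool" where
  "graded_free_resolution J a d \<longleftrightarrow>
     a 0 = [0] \<and>
     (\<forall>i. d i \<in> carrier_mat (length (a i)) (length (a (Suc i)))) \<and>
     (\<forall>i. \<forall>r<length (a i). \<forall>c<length (a (Suc i)).
        homogeneous_shift (a i ! r) (a (Suc i) ! c) (d i $$ (r, c))) \<and>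
     (\<lambda>v. v $ 0) ` mat_im (d 0) = J \<and>
     (\<forall>i. mat_ker (d i) = mat_im (d (Suc i)))"

text \<open>Minimality is \<open>d(F\<^sub>i\<^sub>+\<^sub>1) \<subseteq> \<mm> F\<^sub>i\<close>, i.e. all matrix entries lie in the graded maximal ideal.\<close>

definition minimal_graded_free_resolution ::
    "('n::finite, 'k::field) mpoly set \<Rightarrow> (nat \<Rightarrow> nat list) \<Rightarrow> (nat \<Rightarrow> ('n, 'k) mpoly mat) \<Rightarrow> bool" where
  "minimal_graded_free_resolution J a d \<longleftrightarrow>
     graded_free_resolution J a d \<and>
     (\<forall>i. \<forall>r<length (a i). \<forall>c<length (a (Suc i)). d i $$ (r, c) \<in> max_ideal)"

text \<open>\<open>reg_quot J\<close> is the regularity of \<open>R/J\<close> for a homogeneous ideal \<open>J\<close>: the largest \<open>j - i\<close> such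
  that \<open>R(-j)\<close> is a summand of \<open>F\<^sub>i\<close> in the minimal graded free resolution of \<open>R/J\<close>. This resolution
  is unique up to isomorphism, so all pairs \<open>(a, d)\<close> below yield the same numbers.\<close>

definition reg_quot :: "('n::finite, 'k::field) mpoly set \<Rightarrow> ereal" where
  "reg_quot J =
     (if J = UNIV then -\<infinity>
      else Sup {ereal (real j - real i) | i j.
                  \<exists>a d. minimal_graded_free_resolution J a d \<and> j \<in> set (a i)})"

end

theory Submission
  imports Defs "HOL-Library.Function_Algebras"
begin

text \<open>
  Each of the five inequalities is proved outright, so their equivalence is a formality.

  Two of them carry the rest: passing from \<open>I\<close> to \<open>I : f\<close> neither lowers the depth nor raises
  the regularity. Given this, the statements about \<open>(f, I)\<close> come from the exact sequence
  \<open>0 \<rightarrow> R/(I : f)(-k) \<rightarrow> R/I \<rightarrow> R/(f, I) \<rightarrow> 0\<close>: the depth of the cokernel drops by at most one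
  (\<open>depth_ge_cokernel\<close>), and the mapping cone of the left map resolves the cokernel
  (\<open>cone_resolution\<close>). The statement about \<open>(x\<^sub>i\<^sub>1, \<dots>, x\<^sub>i\<^sub>k, I)\<close> is the one about \<open>(f, I)\<close> used
  \<open>k\<close> times with \<open>f\<close> a variable.

  Depth of \<open>I : f\<close> (\<open>depth_ge_colon\<close>). Let \<open>\<phi>\<close> be the ring map \<open>x\<^sub>i \<mapsto> x\<^sub>i\<^sup>2\<close>. Viewed through \<open>\<phi>\<close>,
  the module \<open>R/I\<close> splits according to the parities of the exponents, and, because \<open>I\<close> is a
  squarefree monomial ideal, the summand whose parities are those of \<open>f = x\<^sub>S\<close> is a copy of
  \<open>R/(I : f)\<close>. So a regular sequence on \<open>R/I\<close> with entries \<open>\<phi>(p\<^sub>1), \<dots>, \<phi>(p\<^sub>d)\<close> yields the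
  regular sequence \<open>p\<^sub>1, \<dots>, p\<^sub>d\<close> on \<open>R/(I : f)\<close>. That a regular sequence of any length in the maximal
  ideal can be exchanged for one of the same length in the image of \<open>\<phi>\<close> is the classical
  invariance of the length of maximal regular sequences over a Noetherian ring, here obtained from
  prime avoidance over a set closed under sums and products (\<open>common_nonzerodivisor\<close>,
  \<open>depth_ge_adjoin\<close>, \<open>depth_ge_subset\<close>); no homological algebra enters. Noetherianity is Hilbert's
  basis theorem (\<open>wf_ascending_ideals_mpoly\<close>).

  Regularity of \<open>I : f\<close> (\<open>reg_quot_colon\<close>). A squarefree monomial ideal has a minimal free
  resolution that is graded by subsets of the variables; all entries of its differentials are then
  scalars times monomials, and exactness becomes exactness of complexes of \<open>K\<close>-vector
  spaces, one for each subset \<open>W\<close> of the variables. Setting the variables in \<open>S\<close> to \<open>1\<close>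
  keeps the scalars and replaces each basis degree \<open>A\<close> by \<open>A - S\<close>; the strand of the new complex
  at \<open>W\<close> is the old strand at \<open>W \<union> S\<close>, so the result is again exact and resolves \<open>I : f\<close>
  (\<open>dehomogenized_resolution\<close>). Degrees have only dropped. The new resolution need not be
  minimal, but a minimal one uses only degrees that occur in it, by the usual argument
  with chain maps that are homotopic to the identity (\<open>minimal_resolution_degrees_subset\<close>).
  The two complexes fit together: the multiplication map \<open>R/(I : f)(-k) \<rightarrow> R/I\<close> lifts to the chain map
  whose scalars form identity matrices, so the cone has an explicit description too.
\<close>

section \<open>Ideals\<close>

interpretation ideals: Modules.module "(*) :: 'a::comm_ring_1 \<Rightarrow> 'a \<Rightarrow> 'a"
  by unfold_locales (auto simp: algebra_simps)

\<comment> \<open>As a simp rule it would orient associativity against \<open>algebra_simps\<close>.\<close>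
declare ideals.scale_scale [simp del]

abbreviation is_ideal :: "'a::comm_ring_1 set \<Rightarrow> bool" where
  "is_ideal \<equiv> Modules.module.subspace (*)"

definition adjoin :: "'a::comm_ring_1 set \<Rightarrow> 'a \<Rightarrow> 'a set" where
  "adjoin J a = ideal_of (insert a J)"

lemma mem_adjoin: "is_ideal J \<Longrightarrow> x \<in> adjoin J a \<longleftrightarrow> (\<exists>k. x - k * a \<in> J)"
  unfolding adjoin_def by (metis ideals.span_breakdown_eq ideals.span_eq_iff)

lemma ideal_adjoin [simp]: "is_ideal (adjoin J a)"
  by (simp add: adjoin_def)

lemma adjoin_superset: "J \<subseteq> adjoin J a"
  unfolding adjoin_def by (meson ideals.span_superset insert_subset)

lemma adjoin_generator: "a \<in> adjoin J a"
  by (simp add: adjoin_def ideals.span_base)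

lemma adjoin_span: "adjoin (ideal_of A) b = ideal_of (insert b A)"
proof
  show "adjoin (ideal_of A) b \<subseteq> ideal_of (insert b A)"
    using ideals.span_mono[OF subset_insertI[of A b]] ideals.span_base[of b "insert b A"]
    unfolding adjoin_def by (intro ideals.span_minimal) auto
  show "ideal_of (insert b A) \<subseteq> adjoin (ideal_of A) b"
    using ideals.span_superset[of A] unfolding adjoin_def by (intro ideals.span_mono) auto
qed

lemma adjoin_commute: "adjoin (adjoin J a) b = adjoin (adjoin J b) a"
  using adjoin_span[of "insert a J" b] adjoin_span[of "insert b J" a]
  by (simp add: insert_commute flip: adjoin_def)

lemma ideal_colon: "is_ideal J \<Longrightarrow> is_ideal (colon J f)"
  unfolding ideals.subspace_def colon_def by (auto simp: algebra_simps)

definition nonzerodivisor_mod :: "'a::comm_ring_1 set \<Rightarrow> 'a \<Rightarrow> bool" where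
  "nonzerodivisor_mod J a \<longleftrightarrow> (\<forall>h. a * h \<in> J \<longrightarrow> h \<in> J)"

lemma nonzerodivisor_modD: "nonzerodivisor_mod J a \<Longrightarrow> a * h \<in> J \<Longrightarrow> h \<in> J"
  by (simp add: nonzerodivisor_mod_def)

text \<open>The ascending chain condition on ideals is the well-foundedness of this relation.\<close>

definition ascending_ideals :: "('a::comm_ring_1 set \<times> 'a set) set" where
  "ascending_ideals = {(J', J). is_ideal J \<and> is_ideal J' \<and> J \<subset> J'}"

section \<open>Associated primes and prime avoidance\<close>

definition prime_ideal :: "'a::comm_ring_1 set \<Rightarrow> bool" where
  "prime_ideal P \<longleftrightarrow> is_ideal P \<and> 1 \<notin> P \<and> (\<forall>a b. a * b \<in> P \<longrightarrow> a \<in> P \<or> b \<in> P)"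

definition associated_primes :: "'a::comm_ring_1 set \<Rightarrow> 'a set set" where
  "associated_primes J = {P. prime_ideal P \<and> (\<exists>h. P = colon J h)}"

text \<open>Among the proper colon ideals \<open>J : g\<close> that contain \<open>a\<close>, a maximal one is prime.\<close>

lemma zerodivisor_in_associated_prime:
  fixes J :: "'a::comm_ring_1 set"
  assumes noeth: "wf (ascending_ideals :: ('a set \<times> 'a set) set)"
    and J: "is_ideal J" and h: "a * h \<in> J" "h \<notin> J"
  shows "\<exists>P \<in> associated_primes J. a \<in> P"
proof -
  let ?C = "{colon J g | g. g \<notin> J \<and> a * g \<in> J}"
  have "colon J h \<in> ?C" using h by blast
  then obtain Q where Q: "Q \<in> ?C" and max: "\<And>Q'. (Q', Q) \<in> ascending_ideals \<Longrightarrow> Q' \<notin> ?C"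
    using wfE_min[OF noeth, of "colon J h" ?C] by blast
  from Q obtain g where g: "Q = colon J g" "g \<notin> J" "a * g \<in> J" by blast
  have idQ: "is_ideal Q" using ideal_colon[OF J] g by simp
  have "c \<in> Q \<or> b \<in> Q" if bc: "b * c \<in> Q" for b c
  proof (rule disjCI)
    assume "b \<notin> Q"
    then have nb: "b * g \<notin> J" using g by (simp add: colon_def)
    have "a * (b * g) \<in> J"
      using ideals.subspace_scale[OF J g(3), of b] by (simp add: algebra_simps)
    then have inC: "colon J (b * g) \<in> ?C" using nb by blast
    have "y * (b * g) \<in> J" if "y * g \<in> J" for y
      using ideals.subspace_scale[OF J that, of b] by (simp add: ac_simps)
    then have "Q \<subseteq> colon J (b * g)" unfolding g colon_def by auto
    then have "colon J (b * g) = Q"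
      using max[of "colon J (b * g)"] inC ideal_colon[OF J] idQ
      unfolding ascending_ideals_def by blast
    moreover have "c \<in> colon J (b * g)" using bc unfolding g colon_def by (simp add: algebra_simps)
    ultimately show "c \<in> Q" by simp
  qed
  moreover have "1 \<notin> Q" using g by (simp add: colon_def)
  ultimately have "prime_ideal Q" using idQ unfolding prime_ideal_def by blast
  then show ?thesis using g by (auto simp: associated_primes_def colon_def)
qed

text \<open>Noetherian induction. If \<open>P = J : h\<close> is one associated prime, then every other associated prime
  of \<open>J\<close> is associated to the larger ideal \<open>(J, h)\<close>.\<close>

lemma finite_associated_primes:
  fixes J :: "'a::comm_ring_1 set"
  assumes noeth: "wf (ascending_ideals :: ('a set \<times> 'a set) set)" and "is_ideal J"
  shows "finite (associated_primes J)"
  using noeth assms(2)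
proof (induction J rule: wf_induct_rule)
  case (less J)
  show ?case
  proof (cases "J = UNIV")
    case True
    then have "associated_primes J = {}"
      by (auto simp: associated_primes_def prime_ideal_def colon_def)
    then show ?thesis by simp
  next
    case False
    then have "1 \<notin> J" using ideals.subspace_scale[OF less.prems, of 1] by auto
    then obtain P where P: "P \<in> associated_primes J"
      using zerodivisor_in_associated_prime[OF noeth less.prems, of 0 1] ideals.subspace_0[OF less.prems]
      by auto
    then obtain h where h: "P = colon J h" and prP: "prime_ideal P" by (auto simp: associated_primes_def)
    have "h \<notin> J" using prP h by (auto simp: prime_ideal_def colon_def)
    then have "(adjoin J h, J) \<in> ascending_ideals"
      using less.prems adjoin_superset[of J h] adjoin_generator[of h J]
      unfolding ascending_ideals_def by auto
    then have fin: "finite (associated_primes (adjoin J h))" using less.IH by auto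
    have "Q \<in> insert P (associated_primes (adjoin J h))" if "Q \<in> associated_primes J" for Q
    proof -
      from that obtain g where g: "Q = colon J g" and prQ: "prime_ideal Q"
        by (auto simp: associated_primes_def)
      show ?thesis
      proof (cases "\<exists>r. r \<notin> Q \<and> r * g \<in> adjoin J h")
        case True
        then obtain r where r: "r \<notin> Q" "r * g \<in> adjoin J h" by blast
        then obtain c where c: "r * g - c * h \<in> J" using mem_adjoin[OF less.prems] by blast
        have eq: "y * (r * g) \<in> J \<longleftrightarrow> y * (c * h) \<in> J" for y
        proof -
          have d: "y * (r * g) - y * (c * h) \<in> J"
            using ideals.subspace_scale[OF less.prems c, of y] by (simp add: algebra_simps)
          then show ?thesis
            using ideals.subspace_add[OF less.prems d, of "y * (c * h)"]
              ideals.subspace_diff[OF less.prems _ d, of "y * (r * g)"] by auto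
        qed
        have "y \<in> Q \<longleftrightarrow> y * r \<in> Q" for y
          using prQ r(1) ideals.subspace_scale[of Q y r] unfolding prime_ideal_def
          by (metis mult.commute)
        then have Q1: "y \<in> Q \<longleftrightarrow> y * (r * g) \<in> J" for y
          unfolding g colon_def by (simp add: algebra_simps)
        \<comment> \<open>As \<open>r \<notin> Q\<close>, the annihilator of \<open>r g\<close> modulo \<open>J\<close> is \<open>Q\<close>;
          that of the congruent element \<open>c h\<close> is \<open>P\<close> once \<open>c \<notin> P\<close>.\<close>
        have "c \<notin> P"
        proof
          assume "c \<in> P"
          then have "1 * (c * h) \<in> J" by (simp add: h colon_def)
          then have "1 \<in> Q" using Q1 eq by blast
          then show False using prQ by (simp add: prime_ideal_def)
        qed
        then have "y \<in> P \<longleftrightarrow> y * c \<in> P" for y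
          using prP ideals.subspace_scale[of P y c] unfolding prime_ideal_def
          by (metis mult.commute)
        then have "y \<in> P \<longleftrightarrow> y * (c * h) \<in> J" for y
          unfolding h colon_def by (simp add: algebra_simps)
        then have "P = Q" using Q1 eq by blast
        then show ?thesis by simp
      next
        case False
        have "Q = colon (adjoin J h) g"
          using False adjoin_superset[of J h] unfolding g colon_def by blast
        then show ?thesis using prQ by (auto simp: associated_primes_def)
      qed
    qed
    then have "associated_primes J \<subseteq> insert P (associated_primes (adjoin J h))" by blast
    then show ?thesis using fin finite_subset by blast
  qed
qed

text \<open>Stated for a set closed under sums and products, so that it applies to the image of the maximal ideal
  under the map \<open>x\<^sub>i \<mapsto> x\<^sub>i\<^sup>2\<close>.\<close>

lemma prime_avoidance:
  assumes "finite \<P>" and "U \<noteq> {}"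
    and add: "\<And>x y. x \<in> U \<Longrightarrow> y \<in> U \<Longrightarrow> x + y \<in> U"
    and mult: "\<And>x y. x \<in> U \<Longrightarrow> y \<in> U \<Longrightarrow> x * y \<in> U"
    and "\<And>P. P \<in> \<P> \<Longrightarrow> prime_ideal P" and "\<And>P. P \<in> \<P> \<Longrightarrow> \<not> U \<subseteq> P"
  shows "\<exists>u \<in> U. \<forall>P \<in> \<P>. u \<notin> P"
  using assms(1,5,6)
proof (induction \<P> rule: finite_psubset_induct)
  case (psubset \<P>)
  show ?case
  proof (cases "\<P> = {}")
    case True
    then show ?thesis using \<open>U \<noteq> {}\<close> by auto
  next
    case False
    then obtain P where P: "P \<in> \<P>" by blast
    show ?thesis
    proof (rule ccontr)
      assume neg: "\<not> ?thesis"
      have "\<exists>u\<in>U. u \<in> Q \<and> (\<forall>P \<in> \<P> - {Q}. u \<notin> P)" if "Q \<in> \<P>" for Q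
      proof -
        have "\<exists>u\<in>U. \<forall>P \<in> \<P> - {Q}. u \<notin> P"
          using that by (intro psubset.IH psubset.prems) auto
        then show ?thesis using neg by blast
      qed
      then obtain u where u: "\<And>Q. Q \<in> \<P> \<Longrightarrow> u Q \<in> U \<and> u Q \<in> Q \<and> (\<forall>P \<in> \<P> - {Q}. u Q \<notin> P)"
        by metis
      define R where "R = \<P> - {P}"
      have prodU: "(\<Prod>Q\<in>S. u Q) \<in> U" if "finite S" "S \<noteq> {}" "S \<subseteq> \<P>" for S
        using that by (induction S rule: finite_ne_induct) (auto simp: u mult)
      have prod_in: "(\<Prod>Q\<in>S. u Q) \<in> Q" if "finite S" "Q \<in> S" "S \<subseteq> \<P>" for S Q
      proof -
        have "(\<Prod>Q\<in>S. u Q) = u Q * (\<Prod>Q\<in>S - {Q}. u Q)" using that by (simp add: prod.remove)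
        moreover have "is_ideal Q" using psubset.prems that by (auto simp: prime_ideal_def)
        ultimately show ?thesis using ideals.subspace_scale[of Q "u Q"] u that
          by (metis mult.commute subsetD)
      qed
      have prod_notin: "(\<Prod>Q\<in>S. u Q) \<notin> P" if "finite S" "S \<subseteq> R" for S
        using that
      proof (induction S rule: finite_induct)
        case empty then show ?case using psubset.prems P by (auto simp: prime_ideal_def)
      next
        case (insert Q S)
        have "u Q \<notin> P" using insert.prems u[of Q] P unfolding R_def by auto
        then show ?case using insert psubset.prems(1)[OF P] unfolding prime_ideal_def by auto
      qed
      have finR: "finite R" using psubset.hyps R_def by simp
      show False
      proof (cases "R = {}")
        case True
        then have "\<P> = {P}" using P R_def by blast
        then show False using neg psubset.prems by blast
      next
        case False
        \<comment> \<open>By induction some \<open>u Q\<close> lies in \<open>Q\<close> and in no other prime of the set;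
          this sum escapes all of them.\<close>
        let ?y = "u P + (\<Prod>Q\<in>R. u Q)"
        have "?y \<in> U" using add prodU[OF finR False] u[OF P] R_def by auto
        moreover have "?y \<notin> P"
          using prod_notin[OF finR] u[OF P] psubset.prems(1)[OF P]
          unfolding prime_ideal_def by (metis add_diff_cancel_left' ideals.subspace_diff order_refl)
        moreover have "?y \<notin> Q" if "Q \<in> R" for Q
        proof
          assume "?y \<in> Q"
          moreover have "(\<Prod>Q\<in>R. u Q) \<in> Q" using prod_in[OF finR that] R_def by auto
          moreover have "is_ideal Q" using psubset.prems(1)[of Q] that R_def by (auto simp: prime_ideal_def)
          ultimately have "u P \<in> Q" by (metis add_diff_cancel_right' ideals.subspace_diff)
          then show False using u[OF P] that R_def by auto
        qed
        ultimately show False using neg R_def by blast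
      qed
    qed
  qed
qed

text \<open>A set \<open>U\<close> that kills no nonzero element of any \<open>R/J\<close> lies in no associated prime, so by prime
  avoidance one element of \<open>U\<close> is outside all of them at once.\<close>

lemma common_nonzerodivisor:
  fixes \<J> :: "'a::comm_ring_1 set set"
  assumes noeth: "wf (ascending_ideals :: ('a set \<times> 'a set) set)"
    and "finite \<J>" "\<And>J. J \<in> \<J> \<Longrightarrow> is_ideal J"
    and "U \<noteq> {}"
    and add: "\<And>x y. x \<in> U \<Longrightarrow> y \<in> U \<Longrightarrow> x + y \<in> U"
    and mult: "\<And>x y. x \<in> U \<Longrightarrow> y \<in> U \<Longrightarrow> x * y \<in> U"
    and socle: "\<And>J h. J \<in> \<J> \<Longrightarrow> h \<notin> J \<Longrightarrow> \<exists>u\<in>U. u * h \<notin> J"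
  shows "\<exists>u\<in>U. \<forall>J\<in>\<J>. nonzerodivisor_mod J u"
proof -
  let ?P = "\<Union>(associated_primes ` \<J>)"
  have "\<exists>u\<in>U. \<forall>P\<in>?P. u \<notin> P"
  proof (rule prime_avoidance)
    show "finite ?P" using assms finite_associated_primes[OF noeth] by auto
    show "prime_ideal P" if "P \<in> ?P" for P using that by (auto simp: associated_primes_def)
    show "\<not> U \<subseteq> P" if "P \<in> ?P" for P
    proof -
      from that obtain J h where "J \<in> \<J>" "P = colon J h" "prime_ideal P"
        by (auto simp: associated_primes_def)
      then have "h \<notin> J" by (auto simp: prime_ideal_def colon_def)
      then show ?thesis using socle[OF \<open>J \<in> \<J>\<close>] \<open>P = colon J h\<close> by (auto simp: colon_def)
    qed
  qed (use assms in auto)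
  then obtain u where u: "u \<in> U" "\<And>P. P \<in> ?P \<Longrightarrow> u \<notin> P" by blast
  have "nonzerodivisor_mod J u" if "J \<in> \<J>" for J
    unfolding nonzerodivisor_mod_def
    using zerodivisor_in_associated_prime[OF noeth assms(3)[OF that]] u that by blast
  then show ?thesis using u by blast
qed

section \<open>Depth in a Noetherian ring\<close>

text \<open>There is a regular sequence of length \<open>d\<close> on \<open>R/J\<close> with entries in \<open>U\<close>. Recursion on \<open>d\<close> splits off
  the first entry of the sequence; \<open>R/J\<close> itself may be zero here.\<close>

primrec depth_ge :: "'a::comm_ring_1 set \<Rightarrow> 'a set \<Rightarrow> nat \<Rightarrow> bool" where
  "depth_ge U J 0 \<longleftrightarrow> True"
| "depth_ge U J (Suc d) \<longleftrightarrow> (\<exists>g\<in>U. nonzerodivisor_mod J g \<and> depth_ge U (adjoin J g) d)"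

locale noetherian_with_subset =
  fixes U :: "'a::comm_ring_1 set"
  assumes noeth: "wf (ascending_ideals :: ('a set \<times> 'a set) set)"
    and U_nonempty: "U \<noteq> {}"
    and U_add: "\<And>x y. x \<in> U \<Longrightarrow> y \<in> U \<Longrightarrow> x + y \<in> U"
    and U_mult: "\<And>x y. x \<in> U \<Longrightarrow> y \<in> U \<Longrightarrow> x * y \<in> U"
begin

lemma depth_ge_1_socle: "depth_ge U J (Suc d) \<Longrightarrow> h \<notin> J \<Longrightarrow> \<exists>u\<in>U. u * h \<notin> J"
  by (auto simp: nonzerodivisor_mod_def)

text \<open>The elementary core of the invariance of depth: if \<open>U\<close> kills the class of \<open>h\<close> modulo \<open>(J, a)\<close>, write
  \<open>b h = h' a\<close> modulo \<open>J\<close>; then \<open>U\<close> kills the class of \<open>h'\<close> modulo \<open>(J, b)\<close>.\<close>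

lemma socle_transfer:
  assumes J: "is_ideal J" and a: "nonzerodivisor_mod J a"
    and b: "b \<in> U" "nonzerodivisor_mod J b"
    and h: "h \<notin> adjoin J a" "\<And>u. u \<in> U \<Longrightarrow> u * h \<in> adjoin J a"
  shows "\<exists>h'. h' \<notin> adjoin J b \<and> (\<forall>u\<in>U. u * h' \<in> adjoin J b)"
proof -
  obtain h' where h': "b * h - h' * a \<in> J" using h(2)[OF b(1)] mem_adjoin[OF J] by blast
  have "h' \<notin> adjoin J b"
  proof
    assume "h' \<in> adjoin J b"
    then obtain k where "h' - k * b \<in> J" using mem_adjoin[OF J] by blast
    then have "a * (h' - k * b) \<in> J" by (rule ideals.subspace_scale[OF J])
    then have "(b * h - h' * a) + a * (h' - k * b) \<in> J" using h' ideals.subspace_add[OF J] by blast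
    then have "b * (h - k * a) \<in> J" by (simp add: algebra_simps)
    then have "h - k * a \<in> J" using b(2) nonzerodivisor_modD by blast
    then show False using h(1) mem_adjoin[OF J] by blast
  qed
  moreover have "u * h' \<in> adjoin J b" if u: "u \<in> U" for u
  proof -
    obtain k where k: "u * h - k * a \<in> J" using h(2)[OF u] mem_adjoin[OF J] by blast
    have "b * (u * h - k * a) - u * (b * h - h' * a) \<in> J"
      by (rule ideals.subspace_diff[OF J ideals.subspace_scale[OF J k] ideals.subspace_scale[OF J h']])
    moreover have "b * (u * h - k * a) - u * (b * h - h' * a) = a * (u * h' - k * b)"
      by (simp add: algebra_simps)
    ultimately have "a * (u * h' - k * b) \<in> J" by simp
    then have "u * h' - k * b \<in> J" using a nonzerodivisor_modD by blast
    then show ?thesis using mem_adjoin[OF J] by blast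
  qed
  ultimately show ?thesis by blast
qed

lemma regular_pair_swap:
  assumes J: "is_ideal J" and "nonzerodivisor_mod J c" "nonzerodivisor_mod J g" "nonzerodivisor_mod (adjoin J g) c"
  shows "nonzerodivisor_mod (adjoin J c) g"
  unfolding nonzerodivisor_mod_def
proof (intro allI impI)
  fix u assume "g * u \<in> adjoin J c"
  then obtain w where w: "g * u - w * c \<in> J" using mem_adjoin[OF J] by blast
  have "c * w - u * g \<in> J" using ideals.subspace_neg[OF J w] by (simp add: algebra_simps)
  then have "c * w \<in> adjoin J g" using mem_adjoin[OF J] by blast
  then have "w \<in> adjoin J g" using assms(4) nonzerodivisor_modD by blast
  then obtain w' where w': "w - w' * g \<in> J" using mem_adjoin[OF J] by blast
  have "(g * u - w * c) + c * (w - w' * g) \<in> J"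
    by (rule ideals.subspace_add[OF J w ideals.subspace_scale[OF J w']])
  then have "g * (u - w' * c) \<in> J" by (simp add: algebra_simps)
  then have "u - w' * c \<in> J" using assms(3) nonzerodivisor_modD by blast
  then show "u \<in> adjoin J c" using mem_adjoin[OF J] by blast
qed

text \<open>Every regular element \<open>b\<close> can be taken as the first member of a regular sequence of maximal length.
  If the given sequence starts with \<open>g\<close>, choose \<open>c\<close> regular on \<open>R/J\<close>, \<open>R/(J, g)\<close> and \<open>R/(J, b)\<close>, and
  exchange first \<open>g\<close> for \<open>c\<close>, then \<open>c\<close> for \<open>b\<close>.\<close>

lemma depth_ge_adjoin:
  "is_ideal J \<Longrightarrow> depth_ge U J (Suc d) \<Longrightarrow> b \<in> U \<Longrightarrow> nonzerodivisor_mod J b \<Longrightarrow> depth_ge U (adjoin J b) d"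
proof (induction d arbitrary: J b)
  case (Suc d)
  note J = Suc.prems(1) and b = Suc.prems(3,4)
  from Suc.prems(2) obtain g where g: "g \<in> U" "nonzerodivisor_mod J g" "depth_ge U (adjoin J g) (Suc d)"
    by (auto simp del: depth_ge.simps(2) simp: depth_ge.simps(2)[of U J])
  have socle_b: "\<exists>u\<in>U. u * h \<notin> adjoin J b" if h: "h \<notin> adjoin J b" for h
  proof (rule ccontr)
    assume "\<not> ?thesis"
    then have "u * h \<in> adjoin J b" if "u \<in> U" for u using that by blast
    from socle_transfer[OF J b(2) g(1,2) h this]
    obtain h' where "h' \<notin> adjoin J g" "\<forall>u\<in>U. u * h' \<in> adjoin J g" by blast
    then show False using depth_ge_1_socle[OF g(3)] by blast
  qed
  have "\<exists>c\<in>U. \<forall>L\<in>{J, adjoin J g, adjoin J b}. nonzerodivisor_mod L c"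
  proof (rule common_nonzerodivisor[OF noeth _ _ U_nonempty U_add U_mult])
    show "\<exists>u\<in>U. u * h \<notin> L" if "L \<in> {J, adjoin J g, adjoin J b}" "h \<notin> L" for L h
      using that socle_b depth_ge_1_socle[OF g(3)] depth_ge_1_socle[OF Suc.prems(2)] by blast
  qed (use J in auto)
  then obtain c where c: "c \<in> U" "nonzerodivisor_mod J c" "nonzerodivisor_mod (adjoin J g) c"
    "nonzerodivisor_mod (adjoin J b) c" by blast
  have "depth_ge U (adjoin (adjoin J g) c) d" using Suc.IH[OF _ g(3) c(1,3)] by simp
  then have "depth_ge U (adjoin J c) (Suc d)"
    using g regular_pair_swap[OF J c(2) g(2) c(3)] adjoin_commute[of J c g] by auto
  moreover have "nonzerodivisor_mod (adjoin J c) b" by (rule regular_pair_swap[OF J c(2) b(2) c(4)])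
  ultimately have "depth_ge U (adjoin (adjoin J c) b) d" using Suc.IH[of "adjoin J c" b] b by simp
  then show ?case using c adjoin_commute[of J c b] by auto
qed simp

text \<open>A subset \<open>V\<close> of \<open>U\<close> measures the same depth if it detects the same socles: a quotient with an element
  killed by \<open>V\<close> also has one killed by \<open>U\<close>. For an ideal \<open>U\<close> this happens when \<open>V\<close> contains powers of
  generators of \<open>U\<close>.\<close>

lemma depth_ge_subset:
  assumes V: "V \<subseteq> U" "V \<noteq> {}" "\<And>x y. x \<in> V \<Longrightarrow> y \<in> V \<Longrightarrow> x + y \<in> V"
      "\<And>x y. x \<in> V \<Longrightarrow> y \<in> V \<Longrightarrow> x * y \<in> V"
    and socle: "\<And>J h. is_ideal J \<Longrightarrow> h \<notin> J \<Longrightarrow> (\<And>v. v \<in> V \<Longrightarrow> v * h \<in> J) \<Longrightarrow>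
                 \<exists>h'. h' \<notin> J \<and> (\<forall>u\<in>U. u * h' \<in> J)"
  shows "is_ideal J \<Longrightarrow> depth_ge U J d \<Longrightarrow> depth_ge V J d"
proof (induction d arbitrary: J)
  case (Suc d)
  have "\<exists>c\<in>V. \<forall>L\<in>{J}. nonzerodivisor_mod L c"
  proof (rule common_nonzerodivisor[OF noeth _ _ V(2-4)])
    show "\<exists>u\<in>V. u * h \<notin> L" if "L \<in> {J}" "h \<notin> L" for L h
      using that socle[OF Suc.prems(1), of h] depth_ge_1_socle[OF Suc.prems(2)] by blast
  qed (use Suc.prems in auto)
  then obtain c where c: "c \<in> V" "nonzerodivisor_mod J c" by blast
  then have "depth_ge U (adjoin J c) d" using depth_ge_adjoin Suc.prems V(1) by blast
  then show ?case using c Suc.IH[of "adjoin J c"] by auto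
qed simp

text \<open>The sequence \<open>0 \<rightarrow> R/(J : f) \<rightarrow> R/J \<rightarrow> R/(J, f) \<rightarrow> 0\<close> stays exact modulo an element that is regular on
  its cokernel.\<close>

lemma colon_adjoin:
  assumes J: "is_ideal J" and "nonzerodivisor_mod (adjoin J f) c"
  shows "colon (adjoin J c) f = adjoin (colon J f) c"
proof (rule equalityI; rule subsetI)
  note CJ = ideal_colon[OF J, of f]
  fix g
  {
    assume "g \<in> colon (adjoin J c) f"
    then obtain u where u: "g * f - u * c \<in> J" using mem_adjoin[OF J] by (auto simp: colon_def)
    have "c * u - g * f \<in> J" using ideals.subspace_neg[OF J u] by (simp add: algebra_simps)
    then have "u \<in> adjoin J f" using assms(2) nonzerodivisor_modD mem_adjoin[OF J] by blast
    then obtain w where w: "u - w * f \<in> J" using mem_adjoin[OF J] by blast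
    have "(g * f - u * c) + c * (u - w * f) \<in> J"
      by (rule ideals.subspace_add[OF J u ideals.subspace_scale[OF J w]])
    then have "g - w * c \<in> colon J f" by (simp add: colon_def algebra_simps)
    then show "g \<in> adjoin (colon J f) c" using mem_adjoin[OF CJ] by blast
  }
  {
    assume "g \<in> adjoin (colon J f) c"
    then obtain k where "g - k * c \<in> colon J f" using mem_adjoin[OF CJ] by blast
    then have "g * f - (k * f) * c \<in> J" by (simp add: colon_def algebra_simps)
    then show "g \<in> colon (adjoin J c) f" using mem_adjoin[OF J] by (auto simp: colon_def)
  }
qed

text \<open>The depth lemma for \<open>0 \<rightarrow> R/(J : f) \<rightarrow> R/J \<rightarrow> R/(J, f) \<rightarrow> 0\<close>. An element that is regular on all three
  modules reduces the claim to \<open>R/(J, f)\<close> having no socle when the other two have depth at least two.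
  A socle element \<open>h\<close> of the cokernel would give one on the left: for \<open>a\<close> regular on the first two modules,
  \<open>a h = w f\<close> modulo \<open>J\<close>, and \<open>w\<close> is a nonzero socle element of \<open>R/((J : f), a)\<close>.\<close>

lemma depth_ge_cokernel:
  "is_ideal J \<Longrightarrow> depth_ge U J (Suc d) \<Longrightarrow> depth_ge U (colon J f) (Suc d) \<Longrightarrow> depth_ge U (adjoin J f) d"
proof (induction d arbitrary: J)
  case (Suc d)
  note J = Suc.prems(1)
  note CJ = ideal_colon[OF J, of f]
  have socle_f: "\<exists>u\<in>U. u * h \<notin> adjoin J f" if h: "h \<notin> adjoin J f" for h
  proof (rule ccontr)
    assume "\<not> ?thesis"
    then have Uh: "u * h \<in> adjoin J f" if "u \<in> U" for u using that by blast
    have "\<exists>a\<in>U. \<forall>L\<in>{J, colon J f}. nonzerodivisor_mod L a"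
    proof (rule common_nonzerodivisor[OF noeth _ _ U_nonempty U_add U_mult])
      show "\<exists>u\<in>U. u * h \<notin> L" if "L \<in> {J, colon J f}" "h \<notin> L" for L h
        using that depth_ge_1_socle[OF Suc.prems(2)] depth_ge_1_socle[OF Suc.prems(3)] by blast
    qed (use J CJ in auto)
    then obtain a where a: "a \<in> U" "nonzerodivisor_mod J a" "nonzerodivisor_mod (colon J f) a" by blast
    obtain w where w: "a * h - w * f \<in> J" using Uh[OF a(1)] mem_adjoin[OF J] by blast
    have "w \<notin> adjoin (colon J f) a"
    proof
      assume "w \<in> adjoin (colon J f) a"
      then obtain k where "w - k * a \<in> colon J f" using mem_adjoin[OF CJ] by blast
      then have "(w - k * a) * f \<in> J" by (simp add: colon_def)
      then have "(a * h - w * f) + (w - k * a) * f \<in> J" using w ideals.subspace_add[OF J] by blast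
      then have "a * (h - k * f) \<in> J" by (simp add: algebra_simps)
      then have "h - k * f \<in> J" using a(2) nonzerodivisor_modD by blast
      then show False using h mem_adjoin[OF J] by blast
    qed
    then obtain u where u: "u \<in> U" "u * w \<notin> adjoin (colon J f) a"
      using depth_ge_1_socle[OF depth_ge_adjoin[OF CJ Suc.prems(3) a(1,3)]] by blast
    obtain k where k: "u * h - k * f \<in> J" using Uh[OF u(1)] mem_adjoin[OF J] by blast
    have "a * (u * h - k * f) - u * (a * h - w * f) \<in> J"
      by (rule ideals.subspace_diff[OF J ideals.subspace_scale[OF J k] ideals.subspace_scale[OF J w]])
    then have "(u * w - k * a) \<in> colon J f" by (simp add: colon_def algebra_simps)
    then show False using u(2) mem_adjoin[OF CJ] by blast
  qed
  have "\<exists>c\<in>U. \<forall>L\<in>{J, colon J f, adjoin J f}. nonzerodivisor_mod L c"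
  proof (rule common_nonzerodivisor[OF noeth _ _ U_nonempty U_add U_mult])
    show "\<exists>u\<in>U. u * h \<notin> L" if "L \<in> {J, colon J f, adjoin J f}" "h \<notin> L" for L h
      using that socle_f depth_ge_1_socle[OF Suc.prems(2)] depth_ge_1_socle[OF Suc.prems(3)] by blast
  qed (use J CJ in auto)
  then obtain c where c: "c \<in> U" "nonzerodivisor_mod J c" "nonzerodivisor_mod (colon J f) c"
    "nonzerodivisor_mod (adjoin J f) c" by blast
  have "depth_ge U (adjoin J c) (Suc d)" by (rule depth_ge_adjoin[OF J Suc.prems(2) c(1,2)])
  moreover have "depth_ge U (colon (adjoin J c) f) (Suc d)"
    unfolding colon_adjoin[OF J c(4)] by (rule depth_ge_adjoin[OF CJ Suc.prems(3) c(1,3)])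
  ultimately have "depth_ge U (adjoin (adjoin J c) f) d" using Suc.IH by simp
  then show ?case using c adjoin_commute[of J c f] by auto
qed simp

end

section \<open>Monomials and coefficients\<close>

lemma poly_mapping_expand:
  assumes "finite A" "Poly_Mapping.keys p \<subseteq> A"
  shows "p = (\<Sum>t\<in>A. Poly_Mapping.single t (Poly_Mapping.lookup p t))"
proof (rule poly_mapping_eqI)
  fix k
  have "(\<Sum>t\<in>A. Poly_Mapping.lookup (Poly_Mapping.single t (Poly_Mapping.lookup p t)) k)
      = (\<Sum>t\<in>A. if t = k then Poly_Mapping.lookup p t else 0)"
    by (intro sum.cong) (auto simp: lookup_single when_def)
  also have "\<dots> = Poly_Mapping.lookup p k" using assms by (auto simp: in_keys_iff)
  finally show "Poly_Mapping.lookup p k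
      = Poly_Mapping.lookup (\<Sum>t\<in>A. Poly_Mapping.single t (Poly_Mapping.lookup p t)) k"
    by (simp add: lookup_sum)
qed

lemmas poly_mapping_expand_keys = poly_mapping_expand[OF finite_keys order_refl]

lemma single_times_expand:
  fixes p :: "('n, 'k::field) mpoly"
  shows "Poly_Mapping.single u c * p = (\<Sum>s\<in>Poly_Mapping.keys p. Poly_Mapping.single (u + s) (c * Poly_Mapping.lookup p s))"
  by (subst poly_mapping_expand_keys[of p]) (simp add: sum_distrib_left mult_single)

lemma lookup_single_times:
  fixes p :: "('n, 'k::field) mpoly"
  shows "Poly_Mapping.lookup (Poly_Mapping.single u c * p) (u + t) = c * Poly_Mapping.lookup p t"
proof -
  have "Poly_Mapping.lookup (Poly_Mapping.single u c * p) (u + t)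
      = (\<Sum>s\<in>Poly_Mapping.keys p. if s = t then c * Poly_Mapping.lookup p s else 0)"
    unfolding single_times_expand lookup_sum
    by (intro sum.cong) (auto simp: lookup_single when_def)
  also have "\<dots> = c * Poly_Mapping.lookup p t" by (auto simp: in_keys_iff)
  finally show ?thesis .
qed

lemma keys_single_times:
  fixes p :: "('n, 'k::field) mpoly"
  shows "Poly_Mapping.keys (Poly_Mapping.single u c * p) \<subseteq> (+) u ` Poly_Mapping.keys p"
  using keys_mult[of "Poly_Mapping.single u c" p] by (auto split: if_splits)

lemma lookup_single_times_0:
  fixes p :: "('n, 'k::field) mpoly"
  assumes "\<And>r. t \<noteq> u + r"
  shows "Poly_Mapping.lookup (Poly_Mapping.single u c * p) t = 0"
  using keys_single_times[of u c p] assms by (force simp: in_keys_iff)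

lemma exponent_le_imp_add:
  fixes s t :: "'n \<Rightarrow>\<^sub>0 nat"
  assumes "\<And>i. Poly_Mapping.lookup s i \<le> Poly_Mapping.lookup t i"
  shows "t = s + (t - s)"
  by (rule poly_mapping_eqI) (simp add: assms lookup_add lookup_minus)

lemma keys_add_exponents: "Poly_Mapping.keys (s + t) = Poly_Mapping.keys s \<union> Poly_Mapping.keys (t :: 'n \<Rightarrow>\<^sub>0 nat)"
  by (auto simp: in_keys_iff lookup_add)

section \<open>The Hilbert basis theorem\<close>

lemma nat_sequence_incseq_subsequence:
  fixes f :: "nat \<Rightarrow> nat"
  shows "\<exists>\<phi>. strict_mono \<phi> \<and> incseq (f \<circ> \<phi>)"
proof -
  obtain \<phi> where \<phi>: "strict_mono \<phi>" "monoseq (f \<circ> \<phi>)"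
    using seq_monosub[of f] by (auto simp: comp_def)
  show ?thesis
  proof (cases "incseq (f \<circ> \<phi>)")
    case True then show ?thesis using \<phi> by blast
  next
    case False
    then have dec: "decseq (f \<circ> \<phi>)" using \<phi>(2) by (simp add: monoseq_iff)
    obtain N where N: "\<And>n. (f \<circ> \<phi>) N \<le> (f \<circ> \<phi>) n"
      using ex_has_least_nat[of "\<lambda>_. True" 0 "f \<circ> \<phi>"] by blast
    have "(f \<circ> \<phi>) (n + N) = (f \<circ> \<phi>) N" for n
      using N[of "n + N"] decseqD[OF dec, of N "n + N"] by simp
    then have "incseq (f \<circ> (\<lambda>n. \<phi> (n + N)))" by (simp add: incseq_def)
    moreover have "strict_mono (\<lambda>n. \<phi> (n + N))" using \<phi>(1) by (simp add: strict_mono_def)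
    ultimately show ?thesis by blast
  qed
qed

text \<open>Passing to subsequences one coordinate at a time makes all coordinates of the exponent vectors
  weakly increasing.\<close>

lemma dickson:
  fixes f :: "nat \<Rightarrow> ('n::finite \<Rightarrow>\<^sub>0 nat)"
  shows "\<exists>i j. i < j \<and> (\<forall>n. Poly_Mapping.lookup (f i) n \<le> Poly_Mapping.lookup (f j) n)"
proof -
  have "\<exists>\<phi>. strict_mono \<phi> \<and> (\<forall>n\<in>A. incseq (\<lambda>k. Poly_Mapping.lookup (f (\<phi> k)) n))" for A :: "'n set"
  proof (induction A rule: finite_induct[OF finite])
    case 1 then show ?case by (auto intro: exI[of _ id] simp: strict_mono_def)
  next
    case (2 n A)
    then obtain \<phi> where \<phi>: "strict_mono \<phi>" "\<forall>n\<in>A. incseq (\<lambda>k. Poly_Mapping.lookup (f (\<phi> k)) n)" by blast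
    obtain \<psi> where \<psi>: "strict_mono \<psi>" "incseq ((\<lambda>k. Poly_Mapping.lookup (f (\<phi> k)) n) \<circ> \<psi>)"
      using nat_sequence_incseq_subsequence by blast
    have "strict_mono (\<phi> \<circ> \<psi>)" using \<phi>(1) \<psi>(1) by (rule strict_mono_o)
    moreover have "\<forall>m\<in>insert n A. incseq (\<lambda>k. Poly_Mapping.lookup (f ((\<phi> \<circ> \<psi>) k)) m)"
      using \<phi>(2) \<psi> unfolding incseq_def comp_def by (metis insert_iff strict_mono_less_eq)
    ultimately show ?case by blast
  qed
  then obtain \<phi> where \<phi>: "strict_mono \<phi>" "\<And>n. incseq (\<lambda>k. Poly_Mapping.lookup (f (\<phi> k)) n)"
    by (metis UNIV_I)
  have "\<phi> 0 < \<phi> 1" using \<phi>(1) by (simp add: strict_mono_def)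
  moreover have "Poly_Mapping.lookup (f (\<phi> 0)) n \<le> Poly_Mapping.lookup (f (\<phi> 1)) n" for n
    using incseqD[OF \<phi>(2), of 0 1] by simp
  ultimately show ?thesis by blast
qed

text \<open>A monomial order. The list \<open>xs\<close> fixes an enumeration of the variables, whose index type carries no
  order of its own.\<close>

definition lex_exponents :: "'n list \<Rightarrow> (('n \<Rightarrow>\<^sub>0 nat) \<times> ('n \<Rightarrow>\<^sub>0 nat)) set" where
  "lex_exponents xs = inv_image (lex less_than) (\<lambda>t. map (Poly_Mapping.lookup t) xs)"

lemma wf_lex_exponents: "wf (lex_exponents xs)"
  unfolding lex_exponents_def by (intro wf_inv_image wf_lex) simp

lemma trans_lex_exponents: "trans (lex_exponents xs)"
  unfolding lex_exponents_def by (intro trans_inv_image lex_transI) simp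

lemma lex_exponents_add: "(s, t) \<in> lex_exponents xs \<Longrightarrow> (u + s, u + t) \<in> lex_exponents xs"
  unfolding lex_exponents_def by (induction xs) (auto simp: lookup_add)

lemma lex_exponents_total:
  assumes "set xs = UNIV" and "s \<noteq> t"
  shows "(s, t) \<in> lex_exponents xs \<or> (t, s) \<in> lex_exponents xs"
proof -
  have "(\<exists>i\<in>set xs. Poly_Mapping.lookup s i \<noteq> Poly_Mapping.lookup t i) \<Longrightarrow>
        (s, t) \<in> lex_exponents xs \<or> (t, s) \<in> lex_exponents xs"
    unfolding lex_exponents_def by (induction xs) auto
  then show ?thesis using assms by (metis UNIV_I poly_mapping_eqI)
qed

text \<open>Hilbert's basis theorem. In a strictly ascending chain of ideals, choose in each step a new element with
  the least possible leading exponent. By Dickson's lemma an earlier leading exponent divides a later one;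
  subtracting a multiple of the earlier element lowers the leading exponent of the later one, which
  contradicts the choice.\<close>

lemma wf_ascending_ideals_mpoly: "wf (ascending_ideals :: (('n::finite, 'k::field) mpoly set \<times> _) set)"
proof (rule ccontr)
  assume "\<not> ?thesis"
  then obtain f :: "nat \<Rightarrow> ('n, 'k) mpoly set" where f: "\<And>i. (f (Suc i), f i) \<in> ascending_ideals"
    by (auto simp: wf_iff_no_infinite_down_chain)
  have id: "is_ideal (f i)" and less: "f i \<subset> f (Suc i)" for i
    using f[of i] by (auto simp: ascending_ideals_def)
  have mono: "f i \<subseteq> f j" if "i \<le> j" for i j using lift_Suc_mono_le[of f, OF _ that] less by blast
  obtain xs :: "'n list" where xs: "set xs = UNIV" using finite_list[OF finite_UNIV] by blast
  let ?L = "lex_exponents xs"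
  have "\<exists>t\<in>A. \<forall>s\<in>A. s \<noteq> t \<longrightarrow> (s, t) \<in> ?L" if "finite A" "A \<noteq> {}" for A
    using that
  proof (induction A rule: finite_ne_induct)
    case (insert x A)
    then obtain t where t: "t \<in> A" "\<forall>s\<in>A. s \<noteq> t \<longrightarrow> (s, t) \<in> ?L" by blast
    have tr: "(a, c) \<in> ?L" if "(a, b) \<in> ?L" "(b, c) \<in> ?L" for a b c
      using trans_lex_exponents that by (rule transD)
    have "x \<noteq> t" using t(1) insert.hyps by blast
    show ?case
    proof (cases "(x, t) \<in> ?L")
      case True
      then show ?thesis using t by (intro bexI[of _ t]) auto
    next
      case False
      then have "(t, x) \<in> ?L" using lex_exponents_total[OF xs \<open>x \<noteq> t\<close>] by blast
      then have "(s, x) \<in> ?L" if "s \<in> A" for s using t(2) that tr[of s t x] by (cases "s = t") auto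
      then show ?thesis by (intro bexI[of _ x]) auto
    qed
  qed simp
  then have "\<exists>t\<in>Poly_Mapping.keys p. \<forall>s\<in>Poly_Mapping.keys p. s \<noteq> t \<longrightarrow> (s, t) \<in> ?L" if "p \<noteq> 0" for p :: "('n, 'k) mpoly"
    using that by (simp add: keys_eq_empty)
  then obtain ld :: "('n, 'k) mpoly \<Rightarrow> ('n \<Rightarrow>\<^sub>0 nat)" where
    ld: "\<And>p. p \<noteq> 0 \<Longrightarrow> ld p \<in> Poly_Mapping.keys p"
        "\<And>p s. p \<noteq> 0 \<Longrightarrow> s \<in> Poly_Mapping.keys p \<Longrightarrow> s \<noteq> ld p \<Longrightarrow> (s, ld p) \<in> ?L"
    by metis
  have "\<exists>p \<in> f (Suc k) - f k. \<forall>q \<in> f (Suc k) - f k. (ld q, ld p) \<notin> ?L" for k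
  proof -
    obtain p0 where "p0 \<in> f (Suc k) - f k" using less by blast
    then show ?thesis
      using wfE_min[OF wf_inv_image[OF wf_lex_exponents, of xs ld], of p0 "f (Suc k) - f k"]
      by (metis in_inv_image)
  qed
  then obtain P where P: "\<And>k. P k \<in> f (Suc k) - f k"
    and min: "\<And>k q. q \<in> f (Suc k) - f k \<Longrightarrow> (ld q, ld (P k)) \<notin> ?L"
    by metis
  have P0: "P k \<noteq> 0" for k using P[of k] ideals.subspace_0[OF id[of k]] by auto
  obtain i j where ij: "i < j" and "\<And>n. Poly_Mapping.lookup (ld (P i)) n \<le> Poly_Mapping.lookup (ld (P j)) n"
    using dickson[of "\<lambda>k. ld (P k)"] by blast
  then obtain u where u: "ld (P j) = u + ld (P i)"
    using exponent_le_imp_add by (metis add.commute)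
  define c where "c = Poly_Mapping.lookup (P j) (ld (P j)) / Poly_Mapping.lookup (P i) (ld (P i))"
  define q where "q = P j - Poly_Mapping.single u c * P i"
  have "P i \<in> f j" using P[of i] mono[of "Suc i" j] ij by auto
  then have sub: "Poly_Mapping.single u c * P i \<in> f j" using id ideals.subspace_scale by blast
  then have "q \<in> f (Suc j)" unfolding q_def using P[of j] less[of j] ideals.subspace_diff[OF id] by blast
  moreover have "q \<notin> f j"
  proof
    assume "q \<in> f j"
    then have "q + Poly_Mapping.single u c * P i \<in> f j" using sub ideals.subspace_add[OF id] by blast
    then show False using P[of j] by (simp add: q_def)
  qed
  ultimately have q: "q \<in> f (Suc j) - f j" by blast
  then have q0: "q \<noteq> 0" using ideals.subspace_0[OF id[of j]] by auto
  have "Poly_Mapping.lookup q (ld (P j)) = 0"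
    using ld(1)[OF P0[of i]] unfolding q_def lookup_minus
    by (simp add: u lookup_single_times) (simp add: c_def u in_keys_iff)
  then have "ld q \<noteq> ld (P j)" using ld(1)[OF q0] by (auto simp: in_keys_iff)
  moreover have "ld q \<in> Poly_Mapping.keys (P j) \<union> (+) u ` Poly_Mapping.keys (P i)"
    using ld(1)[OF q0] keys_diff[of "P j" "Poly_Mapping.single u c * P i"] keys_single_times[of u c "P i"]
    unfolding q_def by blast
  moreover have "(s, ld (P j)) \<in> ?L" if "s \<in> (+) u ` Poly_Mapping.keys (P i)" "s \<noteq> ld (P j)" for s
    using that ld(2)[OF P0, of _ i] lex_exponents_add[of _ "ld (P i)" xs u] unfolding u by auto
  ultimately have "(ld q, ld (P j)) \<in> ?L"
    using ld(2)[OF P0, of "ld q" j] by blast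
  then show False using min[OF q] by blast
qed

section \<open>Squarefree monomial ideals\<close>

definition indicator_exponent :: "'n::finite set \<Rightarrow> 'n \<Rightarrow>\<^sub>0 nat" where
  "indicator_exponent S = Abs_poly_mapping (\<lambda>i. if i \<in> S then 1 else 0)"

lemma lookup_indicator_exponent [simp]:
  "Poly_Mapping.lookup (indicator_exponent S) i = (if i \<in> S then 1 else 0)"
  by (simp add: indicator_exponent_def)

lemma keys_indicator_exponent [simp]: "Poly_Mapping.keys (indicator_exponent S) = S"
  by (auto simp: in_keys_iff split: if_splits)

lemma sqfree_monomial_eq_single: "sqfree_monomial S = Poly_Mapping.single (indicator_exponent S) 1"
proof (induction S rule: finite_induct[OF finite])
  case 1
  have "indicator_exponent ({} :: 'a set) = 0" by (rule poly_mapping_eqI) simp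
  then show ?case by (simp add: sqfree_monomial_def)
next
  case (2 x F)
  have "indicator_exponent (insert x F) = Poly_Mapping.single x 1 + indicator_exponent F"
    using 2 by (intro poly_mapping_eqI) (auto simp: lookup_add lookup_single when_def)
  then show ?case using 2 by (simp add: sqfree_monomial_def Var_def mult_single)
qed

lemma Var_eq_sqfree_monomial: "Var i = sqfree_monomial {i}"
  by (simp add: sqfree_monomial_def)

text \<open>The squarefree monomials of an ideal form an up-closed family of variable sets.\<close>

definition upset :: "'n set set \<Rightarrow> bool" where
  "upset \<Gamma> \<longleftrightarrow> (\<forall>A\<in>\<Gamma>. \<forall>B. A \<subseteq> B \<longrightarrow> B \<in> \<Gamma>)"

lemma upsetD: "upset \<Gamma> \<Longrightarrow> A \<in> \<Gamma> \<Longrightarrow> A \<subseteq> B \<Longrightarrow> B \<in> \<Gamma>"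
  by (auto simp: upset_def)

text \<open>The Stanley-Reisner ideal of the simplicial complex whose nonfaces are the members of \<open>\<Gamma>\<close>. All
  ideals of the theorem have this form, and the operations on them become operations on \<open>\<Gamma>\<close>.\<close>

definition nonface_ideal :: "'n set set \<Rightarrow> ('n::finite, 'k::field) mpoly set" where
  "nonface_ideal \<Gamma> = {p. \<forall>t\<in>Poly_Mapping.keys p. Poly_Mapping.keys t \<in> \<Gamma>}"

lemma ideal_nonface_ideal:
  assumes "upset \<Gamma>"
  shows "is_ideal (nonface_ideal \<Gamma>)"
proof (rule ideals.subspaceI)
  show "x + y \<in> nonface_ideal \<Gamma>" if "x \<in> nonface_ideal \<Gamma>" "y \<in> nonface_ideal \<Gamma>" for x y :: "('a, 'b) mpoly"
    using that keys_add[of x y] unfolding nonface_ideal_def by blast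
  show "c * x \<in> nonface_ideal \<Gamma>" if "x \<in> nonface_ideal \<Gamma>" for c x :: "('a, 'b) mpoly"
    using that keys_mult[of c x] upsetD[OF assms]
    unfolding nonface_ideal_def by (fastforce simp: keys_add_exponents)
qed (simp add: nonface_ideal_def)

lemma nonface_ideal_eq_span:
  "(ideal_of (sqfree_monomial ` \<S>) :: ('n::finite, 'k::field) mpoly set) = nonface_ideal {B. \<exists>A\<in>\<S>. A \<subseteq> B}"
proof
  show "ideal_of (sqfree_monomial ` \<S>) \<subseteq> nonface_ideal {B. \<exists>A\<in>\<S>. A \<subseteq> B}"
    by (intro ideals.span_minimal ideal_nonface_ideal)
      (auto simp: nonface_ideal_def sqfree_monomial_eq_single upset_def)
  show "nonface_ideal {B. \<exists>A\<in>\<S>. A \<subseteq> B} \<subseteq> (ideal_of (sqfree_monomial ` \<S>) :: ('n, 'k) mpoly set)"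
  proof
    fix p :: "('n, 'k) mpoly"
    assume p: "p \<in> nonface_ideal {B. \<exists>A\<in>\<S>. A \<subseteq> B}"
    have "Poly_Mapping.single t (Poly_Mapping.lookup p t) \<in> ideal_of (sqfree_monomial ` \<S>)"
      if t: "t \<in> Poly_Mapping.keys p" for t
    proof -
      obtain A where A: "A \<in> \<S>" "A \<subseteq> Poly_Mapping.keys t" using p t by (auto simp: nonface_ideal_def)
      have "t = indicator_exponent A + (t - indicator_exponent A)"
        using A by (intro exponent_le_imp_add) (auto simp: in_keys_iff Suc_le_eq)
      then have "Poly_Mapping.single t (Poly_Mapping.lookup p t)
          = Poly_Mapping.single (t - indicator_exponent A) (Poly_Mapping.lookup p t) * sqfree_monomial A"
        by (simp add: sqfree_monomial_eq_single mult_single add.commute)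
      then show ?thesis using A by (simp add: ideals.span_base ideals.span_scale)
    qed
    then show "p \<in> ideal_of (sqfree_monomial ` \<S>)"
      by (subst poly_mapping_expand_keys) (rule ideals.span_sum)
  qed
qed

lemma nonface_ideal_eq_span_upset:
  assumes "upset \<Gamma>"
  shows "nonface_ideal \<Gamma> = ideal_of (sqfree_monomial ` \<Gamma>)"
proof -
  have "{B. \<exists>A\<in>\<Gamma>. A \<subseteq> B} = \<Gamma>" using assms by (auto simp: upset_def)
  then show ?thesis by (simp add: nonface_ideal_eq_span)
qed

lemma sqfree_monomial_ideal_iff:
  "sqfree_monomial_ideal I \<longleftrightarrow> (\<exists>\<Gamma>. upset \<Gamma> \<and> I = nonface_ideal \<Gamma>)"
proof
  assume "sqfree_monomial_ideal I"
  then obtain \<S> where "I = nonface_ideal {B. \<exists>A\<in>\<S>. A \<subseteq> B}"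
    by (auto simp: sqfree_monomial_ideal_def nonface_ideal_eq_span)
  moreover have "upset {B. \<exists>A\<in>\<S>. A \<subseteq> B}" by (auto simp: upset_def)
  ultimately show "\<exists>\<Gamma>. upset \<Gamma> \<and> I = nonface_ideal \<Gamma>" by blast
qed (auto simp: sqfree_monomial_ideal_def nonface_ideal_eq_span_upset)

lemma upset_adjoin: "upset \<Gamma> \<Longrightarrow> upset (\<Gamma> \<union> {B. S \<subseteq> B})"
  by (auto simp: upset_def)

lemma upset_colon: "upset \<Gamma> \<Longrightarrow> upset {B. B \<union> S \<in> \<Gamma>}"
  unfolding upset_def by (auto intro: Un_mono)

lemma adjoin_nonface_ideal:
  assumes "upset \<Gamma>"
  shows "adjoin (nonface_ideal \<Gamma>) (sqfree_monomial S) = nonface_ideal (\<Gamma> \<union> {B. S \<subseteq> B})"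
proof -
  have "{B. \<exists>A\<in>insert S \<Gamma>. A \<subseteq> B} = \<Gamma> \<union> {B. S \<subseteq> B}" using assms by (auto simp: upset_def)
  then show ?thesis
    using nonface_ideal_eq_span[of "insert S \<Gamma>"]
    by (simp add: nonface_ideal_eq_span_upset[OF assms] adjoin_span)
qed

lemma colon_nonface_ideal:
  "colon (nonface_ideal \<Gamma>) (sqfree_monomial S) = nonface_ideal {B. B \<union> S \<in> \<Gamma>}"
proof -
  have "Poly_Mapping.keys (p * sqfree_monomial S) = (+) (indicator_exponent S) ` Poly_Mapping.keys p"
    for p :: "('a, 'b) mpoly"
  proof -
    have "Poly_Mapping.lookup (Poly_Mapping.single (indicator_exponent S) 1 * p) (indicator_exponent S + t)
        = Poly_Mapping.lookup p t" for t
      by (simp add: lookup_single_times)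
    then show ?thesis
      using keys_single_times[of "indicator_exponent S" 1 p]
      by (force simp: sqfree_monomial_eq_single mult.commute[of p] in_keys_iff)
  qed
  then show ?thesis
    by (simp add: colon_def nonface_ideal_def keys_add_exponents Un_commute)
qed

lemma max_ideal_eq_nonface_ideal: "max_ideal = nonface_ideal {B. B \<noteq> {}}"
proof -
  have 1: "range Var = sqfree_monomial ` (range (\<lambda>i. {i}))"
    by (auto simp: Var_eq_sqfree_monomial)
  have 2: "{B. \<exists>A\<in>range (\<lambda>i. {i}). A \<subseteq> B} = {B :: 'a set. B \<noteq> {}}" by auto
  show ?thesis unfolding max_ideal_def 1 nonface_ideal_eq_span 2 ..
qed

lemma max_ideal_iff: "p \<in> max_ideal \<longleftrightarrow> Poly_Mapping.lookup p 0 = 0"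
  by (auto simp: max_ideal_eq_nonface_ideal nonface_ideal_def in_keys_iff)

lemma ideal_max_ideal: "is_ideal max_ideal"
  by (simp add: max_ideal_def)

lemma nonface_ideal_subset_max_ideal: "{} \<notin> \<Gamma> \<Longrightarrow> nonface_ideal \<Gamma> \<subseteq> max_ideal"
  by (auto simp: nonface_ideal_def max_ideal_eq_nonface_ideal)

lemma nonface_ideal_eq_UNIV_iff:
  assumes "upset \<Gamma>"
  shows "nonface_ideal \<Gamma> = UNIV \<longleftrightarrow> {} \<in> \<Gamma>"
proof
  assume "nonface_ideal \<Gamma> = (UNIV :: ('a, 'b) mpoly set)"
  then have "(1 :: ('a, 'b) mpoly) \<in> nonface_ideal \<Gamma>" by blast
  then show "{} \<in> \<Gamma>" by (simp add: nonface_ideal_def)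
next
  assume "{} \<in> \<Gamma>"
  then have "\<Gamma> = UNIV" using assms by (auto simp: upset_def)
  then show "nonface_ideal \<Gamma> = (UNIV :: ('a, 'b) mpoly set)" by (simp add: nonface_ideal_def)
qed

section \<open>Regular sequences on squarefree monomial quotients\<close>

lemma regular_sequence_Cons:
  assumes "ideal_of (J \<union> set (g # gs)) \<noteq> UNIV" and J: "is_ideal J"
  shows "regular_sequence J (g # gs) \<longleftrightarrow> nonzerodivisor_mod J g \<and> regular_sequence (adjoin J g) gs"
proof -
  have span: "ideal_of (adjoin J g \<union> B) = ideal_of (insert g (J \<union> B))" for B
  proof
    show "ideal_of (adjoin J g \<union> B) \<subseteq> ideal_of (insert g (J \<union> B))"
      using ideals.span_mono[of "insert g J" "insert g (J \<union> B)"]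
        ideals.span_superset[of "insert g (J \<union> B)"]
      by (intro ideals.span_minimal) (auto simp: adjoin_def)
    show "ideal_of (insert g (J \<union> B)) \<subseteq> ideal_of (adjoin J g \<union> B)"
      using adjoin_generator[of g J] adjoin_superset[of J g] by (intro ideals.span_mono) auto
  qed
  have J': "ideal_of J = J" using J by simp
  show ?thesis
    using assms(1) unfolding regular_sequence_def
    by (auto simp: All_less_Suc2 span J' nonzerodivisor_mod_def)
qed

text \<open>The ideal generated by \<open>J\<close> and the sequence stays inside the maximal ideal, hence is proper.\<close>

lemma depth_ge_iff_regular_sequence:
  fixes J :: "('n::finite, 'k::field) mpoly set"
  assumes "is_ideal J" "J \<subseteq> max_ideal"
  shows "depth_ge max_ideal J d \<longleftrightarrow> (\<exists>gs. set gs \<subseteq> max_ideal \<and> length gs = d \<and> regular_sequence J gs)"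
  using assms
proof (induction d arbitrary: J)
  case 0
  have "ideal_of J = J" using 0 by simp
  moreover have "1 \<notin> J" using 0 by (auto simp: max_ideal_iff)
  ultimately have "ideal_of J \<noteq> UNIV" by (metis UNIV_I)
  then show ?case by (auto simp: regular_sequence_def)
next
  case (Suc d)
  have proper: "ideal_of (J \<union> set gs) \<noteq> UNIV" if "set gs \<subseteq> max_ideal" for gs
  proof -
    have "ideal_of (J \<union> set gs) \<subseteq> max_ideal"
      using that Suc.prems ideal_max_ideal by (intro ideals.span_minimal) auto
    moreover have "1 \<notin> (max_ideal :: ('n, 'k) mpoly set)" by (simp add: max_ideal_iff)
    ultimately show ?thesis by auto
  qed
  have sub: "adjoin J g \<subseteq> max_ideal" if "g \<in> max_ideal" for g
    using that Suc.prems ideal_max_ideal unfolding adjoin_def by (intro ideals.span_minimal) auto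
  have "depth_ge max_ideal J (Suc d) \<longleftrightarrow> (\<exists>g\<in>max_ideal. nonzerodivisor_mod J g \<and>
      (\<exists>gs. set gs \<subseteq> max_ideal \<and> length gs = d \<and> regular_sequence (adjoin J g) gs))"
    using Suc.IH[OF ideal_adjoin sub] by auto
  also have "\<dots> \<longleftrightarrow> (\<exists>g gs. set (g # gs) \<subseteq> max_ideal \<and> length gs = d \<and> regular_sequence J (g # gs))"
    using regular_sequence_Cons[OF proper Suc.prems(1)] by (auto simp del: set_simps) auto
  also have "\<dots> \<longleftrightarrow> (\<exists>gs. set gs \<subseteq> max_ideal \<and> length gs = Suc d \<and> regular_sequence J gs)"
  proof
    assume "\<exists>g gs. set (g # gs) \<subseteq> max_ideal \<and> length gs = d \<and> regular_sequence J (g # gs)"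
    then show "\<exists>gs. set gs \<subseteq> max_ideal \<and> length gs = Suc d \<and> regular_sequence J gs"
      by (metis length_Cons)
  next
    assume "\<exists>gs. set gs \<subseteq> max_ideal \<and> length gs = Suc d \<and> regular_sequence J gs"
    then show "\<exists>g gs. set (g # gs) \<subseteq> max_ideal \<and> length gs = d \<and> regular_sequence J (g # gs)"
      by (auto simp del: set_simps simp: length_Suc_conv)
  qed
  finally show ?case .
qed

lemma depth_quot_eq_Sup:
  assumes "is_ideal J" "J \<subseteq> max_ideal"
  shows "depth_quot J = Sup {ereal (real d) | d. depth_ge max_ideal J d}"
proof -
  have "1 \<notin> J" using assms by (auto simp: max_ideal_iff)
  then have "depth_quot J
      = Sup {ereal (real (length gs)) | gs. set gs \<subseteq> max_ideal \<and> regular_sequence J gs}"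
    by (auto simp: depth_quot_def)
  also have "{ereal (real (length gs)) | gs. set gs \<subseteq> max_ideal \<and> regular_sequence J gs}
      = {ereal (real d) | d. depth_ge max_ideal J d}"
    using depth_ge_iff_regular_sequence[OF assms] by auto
  finally show ?thesis .
qed

section \<open>The splitting along squares of variables\<close>

text \<open>The ring endomorphism \<open>x\<^sub>i \<mapsto> x\<^sub>i\<^sup>2\<close> over \<open>K\<close>.\<close>

definition square_variables :: "('n, 'k::field) mpoly \<Rightarrow> ('n, 'k) mpoly" where
  "square_variables p = (\<Sum>t\<in>Poly_Mapping.keys p. Poly_Mapping.single (t + t) (Poly_Mapping.lookup p t))"

lemma square_variables_superset:
  assumes "finite A" "Poly_Mapping.keys p \<subseteq> A"
  shows "square_variables p = (\<Sum>t\<in>A. Poly_Mapping.single (t + t) (Poly_Mapping.lookup p t))"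
  unfolding square_variables_def using assms
  by (intro sum.mono_neutral_left) (auto simp: in_keys_iff)

lemma square_variables_add: "square_variables (p + q) = square_variables p + square_variables q"
proof -
  let ?A = "Poly_Mapping.keys p \<union> Poly_Mapping.keys q"
  have "square_variables (p + q) = (\<Sum>t\<in>?A. Poly_Mapping.single (t + t) (Poly_Mapping.lookup (p + q) t))"
    by (rule square_variables_superset) (use keys_add[of p q] in auto)
  also have "\<dots> = square_variables p + square_variables q"
    by (subst (1 2) square_variables_superset[of ?A]) (auto simp: lookup_add single_add sum.distrib)
  finally show ?thesis .
qed

lemma square_variables_zero: "square_variables 0 = 0"
  by (simp add: square_variables_def)

lemma square_variables_sum: "square_variables (\<Sum>x\<in>A. f x) = (\<Sum>x\<in>A. square_variables (f x))"
  by (induction A rule: infinite_finite_induct) (auto simp: square_variables_add square_variables_zero)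

lemma square_variables_single: "square_variables (Poly_Mapping.single t c) = Poly_Mapping.single (t + t) c"
  by (simp add: square_variables_def)

lemma square_variables_mult: "square_variables (p * q) = square_variables p * square_variables q"
proof -
  have "p * q = (\<Sum>s\<in>Poly_Mapping.keys p. \<Sum>t\<in>Poly_Mapping.keys q.
      Poly_Mapping.single (s + t) (Poly_Mapping.lookup p s * Poly_Mapping.lookup q t))"
    by (subst poly_mapping_expand_keys[of p], subst poly_mapping_expand_keys[of q])
      (simp add: sum_product mult_single)
  then have "square_variables (p * q) = (\<Sum>s\<in>Poly_Mapping.keys p. \<Sum>t\<in>Poly_Mapping.keys q.
      Poly_Mapping.single ((s + t) + (s + t)) (Poly_Mapping.lookup p s * Poly_Mapping.lookup q t))"
    by (simp add: square_variables_sum square_variables_single)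
  also have "\<dots> = square_variables p * square_variables q"
    by (simp add: square_variables_def sum_product mult_single ac_simps)
  finally show ?thesis .
qed

lemma square_variables_minus: "square_variables (- p) = - square_variables p"
  using square_variables_add[of "- p" p] by (simp add: square_variables_zero eq_neg_iff_add_eq_0)

lemma square_variables_diff: "square_variables (p - q) = square_variables p - square_variables q"
  using square_variables_add[of p "- q"] by (simp add: square_variables_minus)

lemma keys_square_variables: "Poly_Mapping.keys (square_variables p) \<subseteq> (\<lambda>t. t + t) ` Poly_Mapping.keys p"
proof -
  have "Poly_Mapping.keys (square_variables p)
      \<subseteq> (\<Union>t\<in>Poly_Mapping.keys p. Poly_Mapping.keys (Poly_Mapping.single (t + t) (Poly_Mapping.lookup p t)))"
    unfolding square_variables_def by (rule keys_sum)
  then show ?thesis by (auto split: if_splits)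
qed

text \<open>The projection of \<open>R\<close>, seen as a free module over itself through \<open>x\<^sub>i \<mapsto> x\<^sub>i\<^sup>2\<close>, to the coefficient of the
  basis element \<open>x\<^sub>S\<close>.\<close>

definition residue_part :: "'n::finite set \<Rightarrow> ('n, 'k::field) mpoly \<Rightarrow> ('n, 'k) mpoly" where
  "residue_part S = Poly_Mapping.map_key (\<lambda>t. t + t + indicator_exponent S)"

lemma inj_double_exponent: "inj (\<lambda>t :: 'n::finite \<Rightarrow>\<^sub>0 nat. t + t + indicator_exponent S)"
proof (rule injI)
  fix s t :: "'n \<Rightarrow>\<^sub>0 nat"
  assume eq: "s + s + indicator_exponent S = t + t + indicator_exponent S"
  have "Poly_Mapping.lookup s i = Poly_Mapping.lookup t i" for i
    using arg_cong[OF eq, of "\<lambda>u. Poly_Mapping.lookup u i"] by (simp add: lookup_add)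
  then show "s = t" by (rule poly_mapping_eqI)
qed

lemma lookup_residue_part [simp]:
  "Poly_Mapping.lookup (residue_part S p) t = Poly_Mapping.lookup p (t + t + indicator_exponent S)"
  unfolding residue_part_def by (simp add: map_key.rep_eq[OF inj_double_exponent])

lemma residue_part_diff: "residue_part S (p - q) = residue_part S p - residue_part S q"
  by (rule poly_mapping_eqI) (simp add: lookup_minus)

lemma residue_part_sum: "residue_part S (\<Sum>x\<in>A. f x) = (\<Sum>x\<in>A. residue_part S (f x))"
  by (rule poly_mapping_eqI) (simp add: lookup_sum)

text \<open>Linearity of the projection over the squared variables.\<close>

lemma residue_part_square_variables_mult: "residue_part S (square_variables p * q) = p * residue_part S q"
proof -
  have single: "residue_part S (Poly_Mapping.single (s + s) c * q) = Poly_Mapping.single s c * residue_part S q" for s c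
  proof (rule poly_mapping_eqI)
    fix t
    show "Poly_Mapping.lookup (residue_part S (Poly_Mapping.single (s + s) c * q)) t
        = Poly_Mapping.lookup (Poly_Mapping.single s c * residue_part S q) t"
    proof (cases "\<forall>i. Poly_Mapping.lookup s i \<le> Poly_Mapping.lookup t i")
      case True
      then obtain r where t: "t = s + r" using exponent_le_imp_add by blast
      have "t + t + indicator_exponent S = (s + s) + (r + r + indicator_exponent S)"
        by (simp add: t ac_simps)
      then show ?thesis by (simp add: t lookup_single_times)
    next
      case False
      then obtain i where i: "Poly_Mapping.lookup t i < Poly_Mapping.lookup s i" using not_le by blast
      have "t \<noteq> s + r" for r using i by (auto simp: lookup_add)
      moreover have "t + t + indicator_exponent S \<noteq> s + s + r" for r
      proof
        assume eq: "t + t + indicator_exponent S = s + s + r"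
        show False using arg_cong[OF eq, of "\<lambda>u. Poly_Mapping.lookup u i"] i
          by (auto simp: lookup_add split: if_splits)
      qed
      ultimately show ?thesis by (simp add: lookup_single_times_0)
    qed
  qed
  have "residue_part S (square_variables p * q)
      = (\<Sum>t\<in>Poly_Mapping.keys p. Poly_Mapping.single t (Poly_Mapping.lookup p t)) * residue_part S q"
    by (simp add: square_variables_def sum_distrib_right residue_part_sum single)
  then show ?thesis by (simp flip: poly_mapping_expand_keys)
qed

lemma residue_part_sqfree_monomial: "residue_part S (sqfree_monomial S) = 1"
proof (rule poly_mapping_eqI)
  fix t :: "'a \<Rightarrow>\<^sub>0 nat"
  have "t + t + indicator_exponent S = indicator_exponent S \<longleftrightarrow> t = 0"
    by (auto intro!: poly_mapping_eqI simp: poly_mapping_eq_iff fun_eq_iff lookup_add)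
  then show "Poly_Mapping.lookup (residue_part S (sqfree_monomial S)) t = Poly_Mapping.lookup (1 :: ('a, 'b) mpoly) t"
    by (simp add: sqfree_monomial_eq_single lookup_single lookup_one when_def eq_commute[of "indicator_exponent S"])
qed

text \<open>The hypotheses say that \<open>h \<mapsto> \<phi>(h) x\<^sub>S\<close> maps \<open>R/J\<^sub>1\<close> into \<open>R/J\<close> with left inverse \<open>residue_part S\<close>, where
  \<open>\<phi>\<close> squares the variables and \<open>J\<^sub>1\<close> is written \<open>J'\<close>. They persist when \<open>\<phi>(p)\<close> is adjoined to \<open>J\<close> and \<open>p\<close> to
  \<open>J'\<close>, and a direct summand inherits regular elements.\<close>

lemma depth_ge_residue_part:
  assumes "is_ideal J" "is_ideal J'"
    and in_J: "\<And>h. h \<in> J' \<Longrightarrow> square_variables h * sqfree_monomial S \<in> J"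
    and in_J': "\<And>q. q \<in> J \<Longrightarrow> residue_part S q \<in> J'"
    and "depth_ge (square_variables ` U) J d"
  shows "depth_ge U J' d"
  using assms
proof (induction d arbitrary: J J')
  case (Suc d)
  note J = Suc.prems(1) and J' = Suc.prems(2)
  from Suc.prems(5) obtain p where p: "p \<in> U" "nonzerodivisor_mod J (square_variables p)"
    "depth_ge (square_variables ` U) (adjoin J (square_variables p)) d" by auto
  have residue_shift: "residue_part S (square_variables h * sqfree_monomial S) = h" for h
    by (simp add: residue_part_square_variables_mult residue_part_sqfree_monomial)
  have "nonzerodivisor_mod J' p"
    unfolding nonzerodivisor_mod_def
  proof (intro allI impI)
    fix h assume "p * h \<in> J'"
    then have "square_variables p * (square_variables h * sqfree_monomial S) \<in> J"
      using Suc.prems(3) by (fastforce simp: square_variables_mult mult.assoc)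
    then have "square_variables h * sqfree_monomial S \<in> J" using p(2) nonzerodivisor_modD by blast
    then show "h \<in> J'" using Suc.prems(4) residue_shift by metis
  qed
  moreover have "depth_ge U (adjoin J' p) d"
  proof (rule Suc.IH[OF ideal_adjoin ideal_adjoin _ _ p(3)])
    fix h assume "h \<in> adjoin J' p"
    then obtain k where "h - k * p \<in> J'" using mem_adjoin[OF J'] by blast
    then have "square_variables h * sqfree_monomial S
        - (square_variables k * sqfree_monomial S) * square_variables p \<in> J"
      using Suc.prems(3) by (fastforce simp: square_variables_diff square_variables_mult algebra_simps)
    then show "square_variables h * sqfree_monomial S \<in> adjoin J (square_variables p)"
      using mem_adjoin[OF J] by blast
  next
    fix q assume "q \<in> adjoin J (square_variables p)"
    then obtain k where "q - k * square_variables p \<in> J" using mem_adjoin[OF J] by blast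
    then have "residue_part S (q - square_variables p * k) \<in> J'" using Suc.prems(4) by (simp add: mult.commute)
    then have "residue_part S q - residue_part S k * p \<in> J'"
      unfolding residue_part_diff residue_part_square_variables_mult by (simp add: mult.commute)
    then show "residue_part S q \<in> adjoin J' p" using mem_adjoin[OF J'] by blast
  qed
  ultimately show ?case using p(1) by auto
qed simp

interpretation max_ideal: noetherian_with_subset "max_ideal :: ('n::finite, 'k::field) mpoly set"
  using ideals.subspace_0[OF ideal_max_ideal] ideals.subspace_add[OF ideal_max_ideal]
    ideals.subspace_scale[OF ideal_max_ideal]
  by unfold_locales (auto intro: wf_ascending_ideals_mpoly)

text \<open>Multiply \<open>h\<close> by each variable in turn, as long as the product stays outside \<open>J\<close>.\<close>

lemma socle_of_squared_variables:
  fixes J :: "('n::finite, 'k::field) mpoly set"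
  assumes J: "is_ideal J" and h: "h \<notin> J" "\<And>i. (Var i * Var i) * h \<in> J"
  shows "\<exists>h'. h' \<notin> J \<and> (\<forall>u\<in>max_ideal. u * h' \<in> J)"
proof -
  have "\<exists>h'. h' \<notin> J \<and> (\<forall>i. (Var i * Var i) * h' \<in> J) \<and> (\<forall>i\<in>A. Var i * h' \<in> J)" for A :: "'n set"
  proof (induction A rule: finite_induct[OF finite])
    case 1 then show ?case using h by auto
  next
    case (2 x A)
    then obtain h' where h': "h' \<notin> J" "\<And>i. (Var i * Var i) * h' \<in> J" "\<And>i. i \<in> A \<Longrightarrow> Var i * h' \<in> J"
      by blast
    show ?case
    proof (cases "Var x * h' \<in> J")
      case True then show ?thesis using h' by auto
    next
      case False
      have "Var i * (Var x * h') \<in> J" if "i \<in> insert x A" for i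
        using that h'(2)[of x] ideals.subspace_scale[OF J h'(3)[of i], of "Var x"]
        by (auto simp: mult.assoc mult.left_commute)
      moreover have "(Var i * Var i) * (Var x * h') \<in> J" for i
        using ideals.subspace_scale[OF J h'(2)[of i], of "Var x"] by (simp add: ac_simps)
      ultimately show ?thesis using False by blast
    qed
  qed
  then obtain h' where h': "h' \<notin> J" "\<And>i. Var i * h' \<in> J" by (metis UNIV_I)
  have "max_ideal \<subseteq> colon J h'"
    unfolding max_ideal_def using h' by (intro ideals.span_minimal ideal_colon J) (auto simp: colon_def)
  then show ?thesis using h'(1) by (auto simp: colon_def)
qed

text \<open>Move the regular sequence into the image of \<open>\<phi>\<close>, then restrict it to the summand \<open>R/(I : x\<^sub>S)\<close> of \<open>R/I\<close>.
  Squarefreeness of \<open>I\<close> enters through the equivalence of \<open>x\<^sup>2\<^sup>t x\<^sub>S \<in> I\<close> and \<open>x\<^sup>t x\<^sub>S \<in> I\<close>.\<close>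

lemma depth_ge_colon:
  fixes \<Gamma> :: "'n::finite set set"
  assumes \<Gamma>: "upset \<Gamma>" and d: "depth_ge max_ideal (nonface_ideal \<Gamma> :: ('n, 'k::field) mpoly set) d"
  shows "depth_ge max_ideal (colon (nonface_ideal \<Gamma>) (sqfree_monomial S :: ('n, 'k) mpoly)) d"
proof (rule depth_ge_residue_part)
  let ?I = "nonface_ideal \<Gamma> :: ('n, 'k) mpoly set"
  let ?V = "square_variables ` max_ideal :: ('n, 'k) mpoly set"
  show I: "is_ideal ?I" by (rule ideal_nonface_ideal[OF \<Gamma>])
  then show "is_ideal (colon ?I (sqfree_monomial S))" by (rule ideal_colon)
  show "square_variables h * sqfree_monomial S \<in> ?I" if "h \<in> colon ?I (sqfree_monomial S)" for h
  proof -
    have h: "h \<in> nonface_ideal {B. B \<union> S \<in> \<Gamma>}" using that by (simp add: colon_nonface_ideal)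
    have "square_variables h \<in> nonface_ideal {B. B \<union> S \<in> \<Gamma>}"
      using h keys_square_variables[of h] by (force simp: nonface_ideal_def keys_add_exponents)
    then show ?thesis by (simp flip: colon_nonface_ideal add: colon_def)
  qed
  show "residue_part S q \<in> colon ?I (sqfree_monomial S)" if "q \<in> ?I" for q
    unfolding colon_nonface_ideal nonface_ideal_def[of "{B. B \<union> S \<in> \<Gamma>}"]
  proof (intro CollectI ballI)
    fix t assume "t \<in> Poly_Mapping.keys (residue_part S q)"
    then have "t + t + indicator_exponent S \<in> Poly_Mapping.keys q" by (simp add: in_keys_iff)
    then show "Poly_Mapping.keys t \<union> S \<in> \<Gamma>"
      using that by (auto simp: nonface_ideal_def keys_add_exponents)
  qed
  show "depth_ge ?V ?I d"
  proof (rule max_ideal.depth_ge_subset[OF _ _ _ _ _ I d])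
    show "?V \<subseteq> max_ideal"
    proof -
      have "square_variables p \<in> max_ideal" if "p \<in> max_ideal" for p :: "('n, 'k) mpoly"
        unfolding max_ideal_eq_nonface_ideal nonface_ideal_def
      proof (intro CollectI ballI)
        fix t assume "t \<in> Poly_Mapping.keys (square_variables p)"
        then obtain s where "s \<in> Poly_Mapping.keys p" "t = s + s" using keys_square_variables[of p] by blast
        then have "Poly_Mapping.keys s \<noteq> {}" "Poly_Mapping.keys t = Poly_Mapping.keys s"
          using that unfolding max_ideal_eq_nonface_ideal nonface_ideal_def
          by (auto simp only: keys_add_exponents Un_absorb)
        then show "Poly_Mapping.keys t \<noteq> {}" by simp
      qed
      then show ?thesis by blast
    qed
    show "?V \<noteq> {}" using max_ideal.U_nonempty by blast
    show "x + y \<in> ?V" if "x \<in> ?V" "y \<in> ?V" for x y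
      using that by (auto simp flip: square_variables_add intro!: imageI max_ideal.U_add)
    show "x * y \<in> ?V" if "x \<in> ?V" "y \<in> ?V" for x y
      using that by (auto simp flip: square_variables_mult intro!: imageI max_ideal.U_mult)
    fix J :: "('n, 'k) mpoly set" and h
    assume J: "is_ideal J" "h \<notin> J" and V: "\<And>v. v \<in> ?V \<Longrightarrow> v * h \<in> J"
    have "Var i * Var i \<in> ?V" for i
    proof -
      have "square_variables (Var i) = (Var i * Var i :: ('n, 'k) mpoly)"
        by (simp add: Var_def square_variables_single mult_single)
      moreover have "Var i \<in> (max_ideal :: ('n, 'k) mpoly set)"
        by (simp add: max_ideal_def ideals.span_base)
      ultimately show ?thesis by (metis image_eqI)
    qed
    then show "\<exists>h'. h' \<notin> J \<and> (\<forall>u\<in>max_ideal. u * h' \<in> J)"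
      using socle_of_squared_variables[OF J] V by blast
  qed
qed

lemma depth_quot_le:
  assumes "is_ideal J" "J \<subseteq> max_ideal"
    and "\<And>d. depth_ge max_ideal J d \<Longrightarrow> ereal (real d) \<le> b"
  shows "depth_quot J \<le> b"
  unfolding depth_quot_eq_Sup[OF assms(1,2)] using assms(3) by (auto intro: Sup_least)

lemma depth_quot_ge:
  assumes "is_ideal J" "J = UNIV \<or> J \<subseteq> max_ideal" and "depth_ge max_ideal J d"
  shows "ereal (real d) \<le> depth_quot J"
proof (cases "J = UNIV")
  case False
  then have "J \<subseteq> max_ideal" using assms by blast
  then show ?thesis unfolding depth_quot_eq_Sup[OF assms(1) \<open>J \<subseteq> max_ideal\<close>]
    using assms(3) by (auto intro: Sup_upper)
qed (simp add: depth_quot_def)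

lemma depth_quot_colon:
  assumes \<Gamma>: "upset \<Gamma>"
  shows "depth_quot (nonface_ideal \<Gamma> :: ('n::finite, 'k::field) mpoly set)
    \<le> depth_quot (colon (nonface_ideal \<Gamma>) (sqfree_monomial S :: ('n, 'k) mpoly))"
proof (cases "{} \<in> {B. B \<union> S \<in> \<Gamma>}")
  case True
  then have "colon (nonface_ideal \<Gamma>) (sqfree_monomial S :: ('n, 'k) mpoly) = UNIV"
    unfolding colon_nonface_ideal nonface_ideal_eq_UNIV_iff[OF upset_colon[OF \<Gamma>]] .
  then show ?thesis by (simp add: depth_quot_def)
next
  case False
  then have "{} \<notin> \<Gamma>" using upsetD[OF \<Gamma>, of "{}" S] by auto
  moreover have "colon (nonface_ideal \<Gamma>) (sqfree_monomial S :: ('n, 'k) mpoly) \<subseteq> max_ideal"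
    unfolding colon_nonface_ideal using False by (rule nonface_ideal_subset_max_ideal)
  ultimately show ?thesis
    by (intro depth_quot_le depth_quot_ge depth_ge_colon \<Gamma> ideal_colon ideal_nonface_ideal
        disjI2 nonface_ideal_subset_max_ideal)
qed

lemma depth_quot_adjoin:
  assumes \<Gamma>: "upset \<Gamma>"
  shows "depth_quot (nonface_ideal \<Gamma> :: ('n::finite, 'k::field) mpoly set) - 1
    \<le> depth_quot (adjoin (nonface_ideal \<Gamma>) (sqfree_monomial S :: ('n, 'k) mpoly))"
proof (cases "{} \<in> \<Gamma> \<union> {B. S \<subseteq> B}")
  case True
  then have "adjoin (nonface_ideal \<Gamma>) (sqfree_monomial S :: ('n, 'k) mpoly) = UNIV"
    unfolding adjoin_nonface_ideal[OF \<Gamma>] nonface_ideal_eq_UNIV_iff[OF upset_adjoin[OF \<Gamma>]] .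
  then show ?thesis by (simp add: depth_quot_def)
next
  case False
  let ?I = "nonface_ideal \<Gamma> :: ('n, 'k) mpoly set"
  let ?b = "depth_quot (adjoin ?I (sqfree_monomial S))"
  have sub: "adjoin ?I (sqfree_monomial S) \<subseteq> max_ideal"
    unfolding adjoin_nonface_ideal[OF \<Gamma>] using False by (rule nonface_ideal_subset_max_ideal)
  have nonneg: "ereal (real 0) \<le> ?b" using sub by (intro depth_quot_ge) auto
  have "depth_quot ?I \<le> ?b + 1"
  proof (rule depth_quot_le)
    fix d assume d: "depth_ge max_ideal ?I d"
    show "ereal (real d) \<le> ?b + 1"
    proof (cases d)
      case 0 then show ?thesis using nonneg add_mono[of 0 ?b 0 "1::ereal"] by (simp add: zero_ereal_def)
    next
      case (Suc e)
      have "depth_ge max_ideal (adjoin ?I (sqfree_monomial S)) e"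
        using max_ideal.depth_ge_cokernel[OF ideal_nonface_ideal[OF \<Gamma>]] d depth_ge_colon[OF \<Gamma> d]
        unfolding Suc by blast
      then have "ereal (real e) \<le> ?b" using sub by (intro depth_quot_ge) auto
      then have "ereal (real e) + 1 \<le> ?b + 1" by (rule add_right_mono)
      then show ?thesis by (simp add: Suc one_ereal_def add.commute)
    qed
  qed (use False in \<open>auto intro: ideal_nonface_ideal[OF \<Gamma>] nonface_ideal_subset_max_ideal[THEN subsetD]\<close>)
  then show ?thesis by (simp add: ereal_minus_le_iff add.commute)
qed

section \<open>Comparing graded free resolutions\<close>

text \<open>Reduction modulo the maximal ideal is multiplicative.\<close>

lemma lookup_mult_at_0:
  fixes p q :: "('n, 'k::field) mpoly"
  shows "Poly_Mapping.lookup (p * q) 0 = Poly_Mapping.lookup p 0 * Poly_Mapping.lookup q 0"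
proof -
  have single: "Poly_Mapping.lookup (Poly_Mapping.single s c * q) 0 = (if s = 0 then c * Poly_Mapping.lookup q 0 else 0)" for s c
  proof (cases "s = 0")
    case True then show ?thesis using lookup_single_times[of 0 c q 0] by simp
  next
    case False
    have "0 \<noteq> s + r" for r
    proof
      assume "0 = s + r"
      then have "Poly_Mapping.keys s \<union> Poly_Mapping.keys r = {}" by (metis keys_add_exponents keys_zero)
      then show False using False by simp
    qed
    then show ?thesis using False by (simp add: lookup_single_times_0)
  qed
  have "Poly_Mapping.lookup (p * q) 0
      = (\<Sum>s\<in>Poly_Mapping.keys p. Poly_Mapping.lookup (Poly_Mapping.single s (Poly_Mapping.lookup p s) * q) 0)"
    by (subst (1) poly_mapping_expand_keys[of p]) (simp add: sum_distrib_right lookup_sum)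
  also have "\<dots> = (\<Sum>s\<in>Poly_Mapping.keys p. if s = 0 then Poly_Mapping.lookup p s * Poly_Mapping.lookup q 0 else 0)"
    by (simp add: single cong: sum.cong)
  also have "\<dots> = Poly_Mapping.lookup p 0 * Poly_Mapping.lookup q 0"
    by (auto simp: in_keys_iff)
  finally show ?thesis .
qed

definition homogeneous_mat :: "nat list \<Rightarrow> nat list \<Rightarrow> ('n::finite, 'k::field) mpoly mat \<Rightarrow> bool" where
  "homogeneous_mat as bs M \<longleftrightarrow> M \<in> carrier_mat (length as) (length bs) \<and>
     (\<forall>r<length as. \<forall>c<length bs. homogeneous_shift (as ! r) (bs ! c) (M $$ (r, c)))"

lemma homogeneous_shift_mult:
  assumes "homogeneous_shift a b p" "homogeneous_shift b c q"
  shows "homogeneous_shift a c (p * q)"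
  unfolding homogeneous_shift_def
proof
  fix t assume "t \<in> Poly_Mapping.keys (p * q)"
  then obtain u v where "t = u + v" "u \<in> Poly_Mapping.keys p" "v \<in> Poly_Mapping.keys q"
    using keys_mult[of p q] by blast
  then show "a + (\<Sum>i\<in>UNIV. Poly_Mapping.lookup t i) = c"
    using assms by (auto simp: homogeneous_shift_def lookup_add sum.distrib)
qed

lemma homogeneous_shift_sum:
  "(\<And>x. x \<in> A \<Longrightarrow> homogeneous_shift a b (f x)) \<Longrightarrow> homogeneous_shift a b (\<Sum>x\<in>A. f x)"
  using keys_sum[of f A] unfolding homogeneous_shift_def by blast

lemma mult_mat_entry:
  "A \<in> carrier_mat n m \<Longrightarrow> B \<in> carrier_mat m k \<Longrightarrow> r < n \<Longrightarrow> c < k \<Longrightarrow>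
     (A * B) $$ (r, c) = (\<Sum>j<m. A $$ (r, j) * B $$ (j, c))"
  by (auto simp: scalar_prod_def atLeast0LessThan)

lemma homogeneous_mat_mult:
  assumes A: "homogeneous_mat as bs A" and B: "homogeneous_mat bs cs B"
  shows "homogeneous_mat as cs (A * B)"
proof -
  have car: "A \<in> carrier_mat (length as) (length bs)" "B \<in> carrier_mat (length bs) (length cs)"
    using A B by (auto simp: homogeneous_mat_def)
  have "homogeneous_shift (as ! r) (cs ! c) ((A * B) $$ (r, c))" if "r < length as" "c < length cs" for r c
    unfolding mult_mat_entry[OF car that] using A B that
    by (intro homogeneous_shift_sum homogeneous_shift_mult) (auto simp: homogeneous_mat_def)
  then show ?thesis using car by (simp add: homogeneous_mat_def)
qed

lift_definition homogeneous_part :: "nat \<Rightarrow> nat \<Rightarrow> ('n::finite, 'k::field) mpoly \<Rightarrow> ('n, 'k) mpoly" is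
  "\<lambda>a b p t. if a + (\<Sum>i\<in>UNIV. Poly_Mapping.lookup t i) = b then p t else 0"
  by (rule finite_subset) (auto split: if_splits)

lemma homogeneous_shift_homogeneous_part: "homogeneous_shift a b (homogeneous_part a b p)"
  by (auto simp: homogeneous_shift_def in_keys_iff homogeneous_part.rep_eq split: if_splits)

lemma homogeneous_part_id: "homogeneous_shift a b p \<Longrightarrow> homogeneous_part a b p = p"
  by (rule poly_mapping_eqI) (auto simp: homogeneous_shift_def in_keys_iff homogeneous_part.rep_eq)

lemma homogeneous_part_sum: "homogeneous_part a b (\<Sum>x\<in>A. f x) = (\<Sum>x\<in>A. homogeneous_part a b (f x))"
  by (rule poly_mapping_eqI) (auto simp: lookup_sum homogeneous_part.rep_eq intro: sum.neutral)

lemma homogeneous_part_mult: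
  assumes q: "homogeneous_shift a b q"
  shows "homogeneous_part a c (q * p) = q * homogeneous_part b c p"
proof -
  have single: "homogeneous_part a c (Poly_Mapping.single s x * p) = Poly_Mapping.single s x * homogeneous_part b c p"
    if "a + (\<Sum>i\<in>UNIV. Poly_Mapping.lookup s i) = b" for s x
  proof (rule poly_mapping_eqI)
    fix t
    show "Poly_Mapping.lookup (homogeneous_part a c (Poly_Mapping.single s x * p)) t
        = Poly_Mapping.lookup (Poly_Mapping.single s x * homogeneous_part b c p) t"
    proof (cases "\<exists>r. t = s + r")
      case True
      then obtain r where r: "t = s + r" by blast
      show ?thesis
        unfolding r homogeneous_part.rep_eq lookup_single_times using that
        by (simp add: lookup_add sum.distrib algebra_simps)
    next
      case False
      then show ?thesis by (simp add: homogeneous_part.rep_eq lookup_single_times_0)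
    qed
  qed
  have "homogeneous_part a c (q * p)
      = (\<Sum>s\<in>Poly_Mapping.keys q. homogeneous_part a c (Poly_Mapping.single s (Poly_Mapping.lookup q s) * p))"
    by (subst (1) poly_mapping_expand_keys[of q]) (simp add: sum_distrib_right homogeneous_part_sum)
  also have "\<dots> = (\<Sum>s\<in>Poly_Mapping.keys q. Poly_Mapping.single s (Poly_Mapping.lookup q s) * homogeneous_part b c p)"
    using q by (intro sum.cong single) (auto simp: homogeneous_shift_def)
  also have "\<dots> = q * homogeneous_part b c p"
    by (subst (3) poly_mapping_expand_keys[of q]) (simp add: sum_distrib_right)
  finally show ?thesis .
qed

lemma lift_columns:
  fixes M E :: "'a::comm_ring_1 mat"
  assumes M: "M \<in> carrier_mat n m" and E: "E \<in> carrier_mat n k"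
    and im: "\<And>c. c < m \<Longrightarrow> col M c \<in> mat_im E"
  shows "\<exists>X \<in> carrier_mat k m. E * X = M"
proof -
  have "\<exists>v. v \<in> carrier_vec k \<and> E *\<^sub>v v = col M c" if "c < m" for c
    using im[OF that] E by (auto simp: mat_im_def)
  then obtain v where v: "\<And>c. c < m \<Longrightarrow> v c \<in> carrier_vec k" "\<And>c. c < m \<Longrightarrow> E *\<^sub>v v c = col M c"
    by metis
  define X where "X = mat k m (\<lambda>(r, c). v c $ r)"
  have X: "X \<in> carrier_mat k m" by (simp add: X_def)
  have "col X c = v c" if "c < m" for c
    using v(1)[OF that] that by (intro eq_vecI) (auto simp: X_def)
  then have "col (E * X) c = col M c" if "c < m" for c
    using v(2)[OF that] that by (simp add: col_mult2[OF E X])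
  then have "E * X = M" using M E X by (intro mat_col_eqI) auto
  then show ?thesis using X by blast
qed

text \<open>A preimage of a homogeneous column can be chosen homogeneous: take the homogeneous part of each
  entry in the required degree.\<close>

lemma lift_columns_homogeneous:
  assumes M: "homogeneous_mat as cs M" and E: "homogeneous_mat as bs E"
    and im: "\<And>c. c < length cs \<Longrightarrow> col M c \<in> mat_im E"
  shows "\<exists>X. homogeneous_mat bs cs X \<and> E * X = M"
proof -
  have car: "M \<in> carrier_mat (length as) (length cs)" "E \<in> carrier_mat (length as) (length bs)"
    using M E by (auto simp: homogeneous_mat_def)
  obtain X where X: "X \<in> carrier_mat (length bs) (length cs)" "E * X = M"
    using lift_columns[OF car im] by blast
  define Y where "Y = mat (length bs) (length cs) (\<lambda>(r, c). homogeneous_part (bs ! r) (cs ! c) (X $$ (r, c)))"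
  have Y: "homogeneous_mat bs cs Y"
    by (simp add: homogeneous_mat_def Y_def homogeneous_shift_homogeneous_part)
  then have Ycar: "Y \<in> carrier_mat (length bs) (length cs)" by (simp add: homogeneous_mat_def)
  have "E * Y = M"
  proof (rule eq_matI)
    fix r c assume "r < dim_row M" "c < dim_col M"
    then have rc: "r < length as" "c < length cs" using car by auto
    have "M $$ (r, c) = homogeneous_part (as ! r) (cs ! c) ((E * X) $$ (r, c))"
      using M X rc by (simp add: homogeneous_part_id homogeneous_mat_def)
    also have "\<dots> = (\<Sum>j<length bs. homogeneous_part (as ! r) (cs ! c) (E $$ (r, j) * X $$ (j, c)))"
      by (simp only: mult_mat_entry[OF car(2) X(1) rc] homogeneous_part_sum)
    also have "\<dots> = (\<Sum>j<length bs. E $$ (r, j) * Y $$ (j, c))"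
      using E rc by (intro sum.cong) (auto simp: Y_def homogeneous_mat_def intro!: homogeneous_part_mult)
    also have "\<dots> = (E * Y) $$ (r, c)" by (simp only: mult_mat_entry[OF car(2) Ycar rc])
    finally show "(E * Y) $$ (r, c) = M $$ (r, c)" ..
  qed (use car Ycar in auto)
  then show ?thesis using Y by blast
qed

lemma graded_free_resolutionD:
  assumes "graded_free_resolution J a d"
  shows "a 0 = [0]" "homogeneous_mat (a i) (a (Suc i)) (d i)"
    "d i \<in> carrier_mat (length (a i)) (length (a (Suc i)))"
    "(\<lambda>v. v $ 0) ` mat_im (d 0) = J" "mat_ker (d i) = mat_im (d (Suc i))"
  using assms by (auto simp: graded_free_resolution_def homogeneous_mat_def)

lemma col_in_mat_im:
  fixes E :: "'a::comm_ring_1 mat"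
  assumes "E \<in> carrier_mat n k" "c < k"
  shows "col E c \<in> mat_im E"
proof -
  have "col E c = E *\<^sub>v unit_vec k c"
    using assms by (intro eq_vecI) (auto simp: scalar_prod_right_unit[of _ k])
  then show ?thesis using assms by (auto simp: mat_im_def)
qed

lemma resolution_composition_zero:
  assumes "graded_free_resolution J a d"
  shows "d i * d (Suc i) = 0\<^sub>m (length (a i)) (length (a (Suc (Suc i))))"
proof (rule mat_col_eqI)
  note car = graded_free_resolutionD(3)[OF assms]
  fix c assume "c < dim_col (0\<^sub>m (length (a i)) (length (a (Suc (Suc i)))))"
  then have c: "c < length (a (Suc (Suc i)))" by simp
  then have "col (d (Suc i)) c \<in> mat_ker (d i)"
    using col_in_mat_im[OF car[of "Suc i"]] graded_free_resolutionD(5)[OF assms] by auto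
  then have "d i *\<^sub>v col (d (Suc i)) c = 0\<^sub>v (length (a i))"
    using car[of i] by (auto simp: mat_ker_def)
  then show "col (d i * d (Suc i)) c = col (0\<^sub>m (length (a i)) (length (a (Suc (Suc i))))) c"
    using c by (auto simp: col_mult2[OF car[of i] car[of "Suc i"] c])
qed (use graded_free_resolutionD(3)[OF assms, of i] graded_free_resolutionD(3)[OF assms, of "Suc i"] in auto)

lemma kernel_columns_in_image:
  assumes C: "graded_free_resolution J b e"
    and M: "M \<in> carrier_mat (length (b (Suc i))) m" and "e i * M = 0\<^sub>m (length (b i)) m" and "c < m"
  shows "col M c \<in> mat_im (e (Suc i))"
proof -
  note car = graded_free_resolutionD(3)[OF C]
  have "e i *\<^sub>v col M c = 0\<^sub>v (length (b i))"
    using assms(3,4) col_mult2[OF car[of i] M \<open>c < m\<close>] by auto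
  then have "col M c \<in> mat_ker (e i)" using car[of i] M assms(4) by (auto simp: mat_ker_def)
  then show ?thesis using graded_free_resolutionD(5)[OF C] by simp
qed

text \<open>The comparison theorem: the identity of \<open>R\<close> lifts to a graded chain map between two graded resolutions of
  the same quotient.\<close>

lemma homogeneous_chain_map:
  assumes G: "graded_free_resolution J a d" and C: "graded_free_resolution J b e"
  shows "\<exists>A. A 0 = 1\<^sub>m 1 \<and> (\<forall>i. homogeneous_mat (b i) (a i) (A i) \<and> e i * A (Suc i) = A i * d i)"
proof -
  note G' = graded_free_resolutionD[OF G] and C' = graded_free_resolutionD[OF C]
  define P where "P i A \<longleftrightarrow> (i = 0 \<longrightarrow> A = 1\<^sub>m 1) \<and> homogeneous_mat (b i) (a i) A \<and>
      (\<forall>c<length (a (Suc i)). col (A * d i) c \<in> mat_im (e i))" for i A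
  \<comment> \<open>The last conjunct of \<open>P\<close> is the induction hypothesis that makes the next lift possible.\<close>
  have "\<exists>A. \<forall>i. P i (A i) \<and> e i * A (Suc i) = A i * d i"
  proof (rule dependent_nat_choice)
    have d0: "d 0 \<in> carrier_mat 1 (length (a 1))" using G'(3)[of 0] G'(1) by simp
    have e0: "e 0 \<in> carrier_mat 1 (length (b 1))" using C'(3)[of 0] C'(1) by simp
    have "col (1\<^sub>m 1 * d 0) c \<in> mat_im (e 0)" if c: "c < length (a 1)" for c
    proof -
      have "col (d 0) c $ 0 \<in> J" using col_in_mat_im[OF d0 c] G'(4) by blast
      then obtain v where v: "v \<in> mat_im (e 0)" "v $ 0 = col (d 0) c $ 0" using C'(4) by force
      have "v = col (d 0) c" using v d0 e0 by (intro eq_vecI) (auto simp: mat_im_def)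
      then show ?thesis using v d0 by simp
    qed
    moreover have "homogeneous_mat (b 0) (a 0) (1\<^sub>m 1)"
      using G'(1) C'(1) by (auto simp: homogeneous_mat_def homogeneous_shift_def)
    ultimately show "\<exists>A. P 0 A" by (auto simp: P_def)
  next
    fix A i assume A: "P i A"
    have hom: "homogeneous_mat (b i) (a (Suc i)) (A * d i)"
      using A G'(2)[of i] by (auto simp: P_def intro: homogeneous_mat_mult)
    obtain X where X: "homogeneous_mat (b (Suc i)) (a (Suc i)) X" "e i * X = A * d i"
      using lift_columns_homogeneous[OF hom C'(2)[of i]] A by (auto simp: P_def)
    have Xcar: "X \<in> carrier_mat (length (b (Suc i))) (length (a (Suc i)))"
      and Acar: "A \<in> carrier_mat (length (b i)) (length (a i))"
      using X A by (auto simp: homogeneous_mat_def P_def)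
    have "e i * (X * d (Suc i)) = A * (d i * d (Suc i))"
      using X(2) assoc_mult_mat[OF C'(3)[of i] Xcar G'(3)[of "Suc i"]]
        assoc_mult_mat[OF Acar G'(3)[of i] G'(3)[of "Suc i"]] by simp
    also have "\<dots> = 0\<^sub>m (length (b i)) (length (a (Suc (Suc i))))"
      using resolution_composition_zero[OF G, of i] Acar by simp
    finally have "col (X * d (Suc i)) c \<in> mat_im (e (Suc i))" if "c < length (a (Suc (Suc i)))" for c
      using that kernel_columns_in_image[OF C mult_carrier_mat[OF Xcar G'(3)[of "Suc i"]]] by simp
    then show "\<exists>A'. P (Suc i) A' \<and> e i * A' = A * d i"
      using X by (auto simp: P_def)
  qed
  then show ?thesis unfolding P_def by blast
qed

text \<open>The homotopy starts with zero in degree zero, where \<open>T\<close> is the identity.\<close>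

lemma homotopic_to_identity:
  assumes G: "graded_free_resolution J a d"
    and T0: "T 0 = 1\<^sub>m 1"
    and Tcar: "\<And>i. T i \<in> carrier_mat (length (a i)) (length (a i))"
    and T: "\<And>i. d i * T (Suc i) = T i * d i"
  shows "\<exists>H. (\<forall>i. H i \<in> carrier_mat (length (a (Suc i))) (length (a i))) \<and>
      (\<forall>i. T (Suc i) - 1\<^sub>m (length (a (Suc i))) = d (Suc i) * H (Suc i) + H i * d i)"
proof -
  note G' = graded_free_resolutionD[OF G]
  let ?n = "\<lambda>i. length (a i)"
  define P where "P i H \<longleftrightarrow> H \<in> carrier_mat (?n (Suc i)) (?n i) \<and>
      d i * (H * d i) = (T i - 1\<^sub>m (?n i)) * d i" for i H
  have "\<exists>H. \<forall>i. P i (H i) \<and> T (Suc i) - 1\<^sub>m (?n (Suc i)) = d (Suc i) * H (Suc i) + H i * d i"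
  proof (rule dependent_nat_choice)
    have n0: "?n 0 = 1" using G'(1) by simp
    have "T 0 - 1\<^sub>m (?n 0) = 0\<^sub>m 1 1" using T0 n0 by auto
    then have "P 0 (0\<^sub>m (?n (Suc 0)) (?n 0))"
      using G'(3)[of 0] n0 by (auto simp: P_def)
    then show "\<exists>H. P 0 H" by blast
  next
    fix H i assume H: "P i H"
    \<comment> \<open>This difference maps to zero under \<open>d i\<close>, so its columns lift along \<open>d (Suc i)\<close>.\<close>
    let ?M = "T (Suc i) - 1\<^sub>m (?n (Suc i)) - H * d i"
    have Hcar: "H \<in> carrier_mat (?n (Suc i)) (?n i)" using H by (simp add: P_def)
    have Hd: "H * d i \<in> carrier_mat (?n (Suc i)) (?n (Suc i))" using Hcar G'(3) by simp
    have N: "T (Suc i) - 1\<^sub>m (?n (Suc i)) \<in> carrier_mat (?n (Suc i)) (?n (Suc i))" by (simp add: minus_carrier_mat)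
    have dN: "d i * (T (Suc i) - 1\<^sub>m (?n (Suc i))) = (T i - 1\<^sub>m (?n i)) * d i" for i
      using T[of i] mult_minus_distrib_mat[OF G'(3)[of i] Tcar[of "Suc i"] one_carrier_mat]
        minus_mult_distrib_mat[OF Tcar[of i] one_carrier_mat G'(3)[of i]] G'(3)[of i] by simp
    have Mcar: "?M \<in> carrier_mat (?n (Suc i)) (?n (Suc i))" using Hd by (simp add: minus_carrier_mat)
    have "d i * ?M = 0\<^sub>m (?n i) (?n (Suc i))"
      using H mult_minus_distrib_mat[OF G'(3)[of i] N Hd] dN[of i] G'(3)[of i]
      by (auto simp: P_def intro!: eq_matI)
    then have "\<exists>X\<in>carrier_mat (?n (Suc (Suc i))) (?n (Suc i)). d (Suc i) * X = ?M"
      using kernel_columns_in_image[OF G Mcar] by (intro lift_columns[OF Mcar G'(3)[of "Suc i"]]) blast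
    then obtain X where X: "X \<in> carrier_mat (?n (Suc (Suc i))) (?n (Suc i))" "d (Suc i) * X = ?M" by blast
    have dX: "d (Suc i) * X \<in> carrier_mat (?n (Suc i)) (?n (Suc i))" using X(1) G'(3)[of "Suc i"] by simp
    have eq: "T (Suc i) - 1\<^sub>m (?n (Suc i)) = d (Suc i) * X + H * d i"
      unfolding X(2) using Hd N by (intro eq_matI) auto
    have "d (Suc i) * (X * d (Suc i)) = ?M * d (Suc i)"
      using X(2) assoc_mult_mat[OF G'(3)[of "Suc i"] X(1) G'(3)[of "Suc i"]] by simp
    also have "\<dots> = (T (Suc i) - 1\<^sub>m (?n (Suc i))) * d (Suc i) - H * (d i * d (Suc i))"
      using minus_mult_distrib_mat[OF N Hd G'(3)[of "Suc i"]]
        assoc_mult_mat[OF Hcar G'(3)[of i] G'(3)[of "Suc i"]] by simp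
    also have "H * (d i * d (Suc i)) = 0\<^sub>m (?n (Suc i)) (?n (Suc (Suc i)))"
      using resolution_composition_zero[OF G, of i] Hcar by simp
    also have "(T (Suc i) - 1\<^sub>m (?n (Suc i))) * d (Suc i) - 0\<^sub>m (?n (Suc i)) (?n (Suc (Suc i)))
        = (T (Suc i) - 1\<^sub>m (?n (Suc i))) * d (Suc i)"
      using N G'(3)[of "Suc i"] by (intro eq_matI) auto
    finally have "P (Suc i) X" using X(1) by (simp add: P_def)
    then show "\<exists>H'. P (Suc i) H' \<and> T (Suc i) - 1\<^sub>m (?n (Suc i)) = d (Suc i) * H' + H * d i"
      using eq by blast
  qed
  then show ?thesis unfolding P_def by blast
qed

text \<open>Let \<open>A\<close> and \<open>B\<close> be chain maps from the minimal resolution to the other one and back. Then \<open>B A\<close> is homotopic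
  to the identity, and by minimality the homotopy terms vanish modulo the maximal ideal. So each diagonal entry
  of \<open>B A\<close> has constant term \<open>1\<close>, which forces a nonzero constant term in the corresponding column of \<open>A\<close>; as
  \<open>A\<close> is graded, such an entry joins two basis elements of the same degree.\<close>

lemma minimal_resolution_degrees_subset:
  assumes min: "minimal_graded_free_resolution J a d" and C: "graded_free_resolution J b e"
  shows "set (a i) \<subseteq> set (b i)"
proof -
  have G: "graded_free_resolution J a d" using min by (simp add: minimal_graded_free_resolution_def)
  note G' = graded_free_resolutionD[OF G] and C' = graded_free_resolutionD[OF C]
  let ?n = "\<lambda>i. length (a i)"
  obtain A where A: "A 0 = 1\<^sub>m 1" "\<And>i. homogeneous_mat (b i) (a i) (A i)" "\<And>i. e i * A (Suc i) = A i * d i"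
    using homogeneous_chain_map[OF G C] by blast
  obtain B where B: "B 0 = 1\<^sub>m 1" "\<And>i. homogeneous_mat (a i) (b i) (B i)" "\<And>i. d i * B (Suc i) = B i * e i"
    using homogeneous_chain_map[OF C G] by blast
  have Acar: "A i \<in> carrier_mat (length (b i)) (?n i)" for i using A(2)[of i] by (simp add: homogeneous_mat_def)
  have Bcar: "B i \<in> carrier_mat (?n i) (length (b i))" for i using B(2)[of i] by (simp add: homogeneous_mat_def)
  define T where "T i = B i * A i" for i
  have Tcar: "T i \<in> carrier_mat (?n i) (?n i)" for i unfolding T_def by (rule mult_carrier_mat[OF Bcar Acar])
  have T: "d i * T (Suc i) = T i * d i" for i
  proof -
    have "d i * T (Suc i) = B i * (e i * A (Suc i))"
      using B(3)[of i] by (simp add: T_def flip: assoc_mult_mat[OF G'(3) Bcar Acar] assoc_mult_mat[OF Bcar C'(3) Acar])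
    also have "\<dots> = T i * d i"
      unfolding A(3) T_def by (simp add: assoc_mult_mat[OF Bcar Acar G'(3)])
    finally show ?thesis .
  qed
  have T0: "T 0 = 1\<^sub>m 1" using A(1) B(1) by (simp add: T_def)
  obtain H where H: "\<And>i. H i \<in> carrier_mat (?n (Suc i)) (?n i)"
    "\<And>i. T (Suc i) - 1\<^sub>m (?n (Suc i)) = d (Suc i) * H (Suc i) + H i * d i"
    using homotopic_to_identity[OF G T0 Tcar T] by blast
  have dmax: "Poly_Mapping.lookup (d i $$ (r, c)) 0 = 0" if "r < ?n i" "c < ?n (Suc i)" for i r c
    using min that by (simp add: minimal_graded_free_resolution_def max_ideal_iff)
  have diag: "Poly_Mapping.lookup (T i $$ (c, c)) 0 = 1" if c: "c < ?n i" for c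
  proof (cases i)
    case 0
    then show ?thesis using c T0 G'(1) by simp
  next
    case (Suc j)
    have "T i $$ (c, c) = 1 + (d i * H i) $$ (c, c) + (H j * d j) $$ (c, c)"
      using arg_cong[OF H(2)[of j], of "\<lambda>M. M $$ (c, c)"] c Tcar[of i] H(1)[of i] H(1)[of j] G'(3)[of i] G'(3)[of j]
      unfolding Suc by (auto simp: algebra_simps)
    moreover have "Poly_Mapping.lookup ((d i * H i) $$ (c, c)) 0 = 0"
      unfolding mult_mat_entry[OF G'(3)[of i] H(1)[of i] c c]
      using dmax c by (auto simp: lookup_sum lookup_mult_at_0 intro!: sum.neutral)
    moreover have "Poly_Mapping.lookup ((H j * d j) $$ (c, c)) 0 = 0"
      using c dmax unfolding Suc mult_mat_entry[OF H(1)[of j] G'(3)[of j] c[unfolded Suc] c[unfolded Suc]]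
      by (auto simp: lookup_sum lookup_mult_at_0 intro!: sum.neutral)
    ultimately show ?thesis by (simp add: lookup_add)
  qed
  show ?thesis
  proof
    fix x assume "x \<in> set (a i)"
    then obtain c where c: "c < ?n i" "x = a i ! c" by (metis in_set_conv_nth)
    have "(\<Sum>j<length (b i). Poly_Mapping.lookup (B i $$ (c, j)) 0 * Poly_Mapping.lookup (A i $$ (j, c)) 0) \<noteq> 0"
      using diag[OF c(1)] unfolding T_def mult_mat_entry[OF Bcar Acar c(1) c(1)]
      by (simp add: lookup_sum lookup_mult_at_0)
    then obtain j where j: "j < length (b i)" "Poly_Mapping.lookup (A i $$ (j, c)) 0 \<noteq> 0"
      by (metis (no_types, lifting) lessThan_iff mult_zero_right sum.neutral)
    have "homogeneous_shift (b i ! j) (a i ! c) (A i $$ (j, c))"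
      using A(2)[of i] j c by (simp add: homogeneous_mat_def)
    then have "b i ! j = x" using j c by (auto simp: homogeneous_shift_def in_keys_iff dest: bspec[of _ _ 0])
    then show "x \<in> set (b i)" using j by auto
  qed
qed

section \<open>Squarefree multigraded resolutions\<close>

text \<open>A basis element of degree \<open>A\<close> contributes to the part of multidegree \<open>W\<close> exactly when \<open>A \<subseteq> W\<close>. A strand
  is this part: the coefficient vectors supported on the contributing basis elements.\<close>

definition strand :: "'n set list \<Rightarrow> 'n set \<Rightarrow> (nat \<Rightarrow> 'k::zero) set" where
  "strand L W = {v. \<forall>c. v c \<noteq> 0 \<longrightarrow> c < length L \<and> L ! c \<subseteq> W}"

lemma strandD: "v \<in> strand L W \<Longrightarrow> v c \<noteq> 0 \<Longrightarrow> c < length L \<and> L ! c \<subseteq> W"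
  by (auto simp: strand_def)

text \<open>A free resolution of \<open>R/I\<close> graded by sets of variables. The list \<open>s i\<close> holds the degrees of the basis of the
  \<open>i\<close>-th module, and the entry in row \<open>r\<close> and column \<open>c\<close> of the \<open>i\<close>-th differential is
  \<open>\<mu> i r c\<close> times the monomial of the difference of the two degrees. The third clause says that the cokernel at
  the beginning is \<open>R/I\<close>, where \<open>x\<^sub>W \<in> I\<close> for \<open>W \<in> \<Gamma>\<close>; the fourth is exactness, strand by strand.\<close>

definition sqfree_resolution ::
  "'n set set \<Rightarrow> (nat \<Rightarrow> 'n set list) \<Rightarrow> (nat \<Rightarrow> nat \<Rightarrow> nat \<Rightarrow> 'k::field) \<Rightarrow> bool" where
  "sqfree_resolution \<Gamma> s \<mu> \<longleftrightarrow>
     s 0 = [{}] \<and>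
     (\<forall>i r c. r < length (s i) \<longrightarrow> c < length (s (Suc i)) \<longrightarrow> \<mu> i r c \<noteq> 0 \<longrightarrow> s i ! r \<subseteq> s (Suc i) ! c) \<and>
     (\<forall>W. W \<in> \<Gamma> \<longleftrightarrow> (\<exists>w \<in> strand (s 1) W. (\<Sum>c<length (s 1). \<mu> 0 0 c * w c) \<noteq> 0)) \<and>
     (\<forall>i W. \<forall>v \<in> strand (s (Suc i)) W.
        (\<forall>r<length (s i). (\<Sum>c<length (s (Suc i)). \<mu> i r c * v c) = 0) \<longleftrightarrow>
        (\<exists>w \<in> strand (s (Suc (Suc i))) W. \<forall>c<length (s (Suc i)).
            v c = (\<Sum>k<length (s (Suc (Suc i))). \<mu> (Suc i) c k * w k)))"

definition minimal_sqfree_resolution ::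
  "'n set set \<Rightarrow> (nat \<Rightarrow> 'n set list) \<Rightarrow> (nat \<Rightarrow> nat \<Rightarrow> nat \<Rightarrow> 'k::field) \<Rightarrow> bool" where
  "minimal_sqfree_resolution \<Gamma> s \<mu> \<longleftrightarrow> sqfree_resolution \<Gamma> s \<mu> \<and>
     (\<forall>i r c. r < length (s i) \<longrightarrow> c < length (s (Suc i)) \<longrightarrow> \<mu> i r c \<noteq> 0 \<longrightarrow> s i ! r \<noteq> s (Suc i) ! c)"

lemma sqfree_resolutionD:
  assumes "sqfree_resolution \<Gamma> s \<mu>"
  shows "s 0 = [{}]"
    "\<And>i r c. r < length (s i) \<Longrightarrow> c < length (s (Suc i)) \<Longrightarrow> \<mu> i r c \<noteq> 0 \<Longrightarrow> s i ! r \<subseteq> s (Suc i) ! c"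
    "\<And>W. W \<in> \<Gamma> \<longleftrightarrow> (\<exists>w \<in> strand (s 1) W. (\<Sum>c<length (s 1). \<mu> 0 0 c * w c) \<noteq> 0)"
    "\<And>i W v. v \<in> strand (s (Suc i)) W \<Longrightarrow>
        (\<forall>r<length (s i). (\<Sum>c<length (s (Suc i)). \<mu> i r c * v c) = 0) \<longleftrightarrow>
        (\<exists>w \<in> strand (s (Suc (Suc i))) W. \<forall>c<length (s (Suc i)).
            v c = (\<Sum>k<length (s (Suc (Suc i))). \<mu> (Suc i) c k * w k))"
  using assms unfolding sqfree_resolution_def by blast+

section \<open>From scalars to matrices\<close>

definition monomial_mat :: "'n::finite set list \<Rightarrow> 'n set list \<Rightarrow> (nat \<Rightarrow> nat \<Rightarrow> 'k::field) \<Rightarrow> ('n, 'k) mpoly mat" where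
  "monomial_mat L M \<mu> = mat (length L) (length M)
     (\<lambda>(r, c). Poly_Mapping.single (indicator_exponent (M ! c - L ! r)) (\<mu> r c))"

lemma monomial_mat_carrier [simp]: "monomial_mat L M \<mu> \<in> carrier_mat (length L) (length M)"
  by (simp add: monomial_mat_def)

lemma dim_monomial_mat [simp]:
  "dim_row (monomial_mat L M \<mu>) = length L" "dim_col (monomial_mat L M \<mu>) = length M"
  by (simp_all add: monomial_mat_def)

text \<open>The multidegree \<open>e\<close> part of a vector of polynomials, as a vector of scalars. It depends on the exponent vector \<open>e\<close>,
  but the strand that contains it only on the support of \<open>e\<close>.\<close>

definition component :: "'n::finite set list \<Rightarrow> ('n \<Rightarrow>\<^sub>0 nat) \<Rightarrow> ('n, 'k::field) mpoly vec \<Rightarrow> nat \<Rightarrow> 'k" where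
  "component L e v c = (if c < length L \<and> L ! c \<subseteq> Poly_Mapping.keys e
     then Poly_Mapping.lookup (v $ c) (e - indicator_exponent (L ! c)) else 0)"

lemma component_in_strand: "component L e v \<in> strand L (Poly_Mapping.keys e)"
  by (auto simp: strand_def component_def)

lemma minus_indicator_add:
  assumes "A \<subseteq> Poly_Mapping.keys e"
  shows "e - indicator_exponent A + indicator_exponent A = e"
  using exponent_le_imp_add[of "indicator_exponent A" e] assms
  by (force simp: in_keys_iff add.commute Suc_le_eq)

lemma lookup_eq_component:
  "c < length L \<Longrightarrow> Poly_Mapping.lookup (v $ c) t = component L (t + indicator_exponent (L ! c)) v c"
  by (simp add: component_def keys_add_exponents)

text \<open>The matrices are multigraded: on the part of multidegree \<open>e\<close> they act through their scalars.\<close>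

lemma component_monomial_mat:
  fixes \<mu> :: "nat \<Rightarrow> nat \<Rightarrow> 'k::field" and L M :: "'n::finite set list"
  assumes \<mu>: "\<And>c. c < length M \<Longrightarrow> \<mu> r c \<noteq> 0 \<Longrightarrow> L ! r \<subseteq> M ! c"
    and r: "r < length L" and v: "v \<in> carrier_vec (length M)"
  shows "component L e (monomial_mat L M \<mu> *\<^sub>v v) r = (\<Sum>c<length M. \<mu> r c * component M e v c)"
proof (cases "L ! r \<subseteq> Poly_Mapping.keys e")
  case False
  have "\<mu> r c * component M e v c = 0" if "c < length M" for c
    using \<mu>[OF that] False by (auto simp: component_def)
  then have "(\<Sum>c<length M. \<mu> r c * component M e v c) = 0" by (intro sum.neutral) auto
  then show ?thesis using False by (simp add: component_def[of L])
next
  case True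
  let ?t = "e - indicator_exponent (L ! r)"
  have e: "?t + indicator_exponent (L ! r) = e" using True by (rule minus_indicator_add)
  have "Poly_Mapping.lookup (Poly_Mapping.single (indicator_exponent (M ! c - L ! r)) (\<mu> r c) * v $ c) ?t
      = \<mu> r c * component M e v c" if c: "c < length M" for c
  proof (cases "\<mu> r c = 0")
    case False
    then have sub: "L ! r \<subseteq> M ! c" using \<mu> c by blast
    show ?thesis
    proof (cases "M ! c \<subseteq> Poly_Mapping.keys e")
      case Mc: True
      have "?t = indicator_exponent (M ! c - L ! r) + (e - indicator_exponent (M ! c))"
      proof (rule poly_mapping_eqI)
        fix i
        show "Poly_Mapping.lookup ?t i
            = Poly_Mapping.lookup (indicator_exponent (M ! c - L ! r) + (e - indicator_exponent (M ! c))) i"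
          using sub Mc by (auto simp: lookup_add lookup_minus in_keys_iff subset_iff)
      qed
      then show ?thesis using c Mc by (simp add: component_def lookup_single_times)
    next
      case Mc: False
      then obtain j where j: "j \<in> M ! c" "j \<notin> Poly_Mapping.keys e" by blast
      have "?t \<noteq> indicator_exponent (M ! c - L ! r) + u" for u
      proof
        assume "?t = indicator_exponent (M ! c - L ! r) + u"
        then have "Poly_Mapping.lookup ?t j = Poly_Mapping.lookup (indicator_exponent (M ! c - L ! r) + u) j" by simp
        moreover have "j \<notin> L ! r" using j True by blast
        ultimately show False using j by (auto simp: lookup_add lookup_minus in_keys_iff)
      qed
      then show ?thesis using Mc by (simp add: component_def lookup_single_times_0)
    qed
  qed simp
  moreover have "(monomial_mat L M \<mu> *\<^sub>v v) $ r
      = (\<Sum>c<length M. Poly_Mapping.single (indicator_exponent (M ! c - L ! r)) (\<mu> r c) * v $ c)"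
    using r v by (auto simp: monomial_mat_def scalar_prod_def atLeast0LessThan)
  ultimately show ?thesis
    using r True by (simp add: component_def[of L] lookup_sum)
qed

text \<open>Preimages of the finitely many nonzero components assemble to a preimage of the vector.\<close>

lemma in_image_monomial_mat:
  fixes \<mu> :: "nat \<Rightarrow> nat \<Rightarrow> 'k::field" and L M :: "'n::finite set list"
  assumes \<mu>: "\<And>r c. r < length L \<Longrightarrow> c < length M \<Longrightarrow> \<mu> r c \<noteq> 0 \<Longrightarrow> L ! r \<subseteq> M ! c"
    and v: "v \<in> carrier_vec (length L)"
    and ex: "\<And>e. \<exists>w \<in> strand M (Poly_Mapping.keys e). \<forall>r<length L. component L e v r = (\<Sum>c<length M. \<mu> r c * w c)"
  shows "v \<in> mat_im (monomial_mat L M \<mu>)"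
proof -
  obtain w where w: "\<And>e. w e \<in> strand M (Poly_Mapping.keys e)"
    "\<And>e r. r < length L \<Longrightarrow> component L e v r = (\<Sum>c<length M. \<mu> r c * w e c)"
    using ex by metis
  define E where "E = (\<Union>r<length L. (\<lambda>t. t + indicator_exponent (L ! r)) ` Poly_Mapping.keys (v $ r))"
  have finE: "finite E" by (simp add: E_def)
  define x where "x = vec (length M) (\<lambda>c. \<Sum>e\<in>{e\<in>E. M ! c \<subseteq> Poly_Mapping.keys e}.
      Poly_Mapping.single (e - indicator_exponent (M ! c)) (w e c))"
  have x: "x \<in> carrier_vec (length M)" by (simp add: x_def)
  have comp_x: "component M e x c = (if e \<in> E then w e c else 0)" if c: "c < length M" for e c
  proof (cases "M ! c \<subseteq> Poly_Mapping.keys e")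
    case False
    then show ?thesis using strandD[OF w(1), of e c] by (auto simp: component_def)
  next
    case True
    let ?E = "{e\<in>E. M ! c \<subseteq> Poly_Mapping.keys e}"
    have "component M e x c = (\<Sum>e'\<in>?E. Poly_Mapping.lookup
        (Poly_Mapping.single (e' - indicator_exponent (M ! c)) (w e' c)) (e - indicator_exponent (M ! c)))"
      using c True by (simp add: component_def x_def lookup_sum)
    also have "\<dots> = (\<Sum>e'\<in>?E. if e' = e then w e' c else 0)"
    proof (rule sum.cong[OF refl])
      fix e' assume "e' \<in> ?E"
      then have "e' - indicator_exponent (M ! c) = e - indicator_exponent (M ! c) \<longleftrightarrow> e' = e"
        using minus_indicator_add[of "M ! c" e'] minus_indicator_add[OF True] by (metis (mono_tags) mem_Collect_eq)
      then show "Poly_Mapping.lookup (Poly_Mapping.single (e' - indicator_exponent (M ! c)) (w e' c))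
          (e - indicator_exponent (M ! c)) = (if e' = e then w e' c else 0)"
        by (auto simp: lookup_single when_def)
    qed
    also have "\<dots> = (if e \<in> E then w e c else 0)" using finE True by auto
    finally show ?thesis .
  qed
  have "monomial_mat L M \<mu> *\<^sub>v x = v"
  proof (rule eq_vecI)
    fix r assume "r < dim_vec v"
    then have r: "r < length L" using v by simp
    show "(monomial_mat L M \<mu> *\<^sub>v x) $ r = v $ r"
    proof (rule poly_mapping_eqI)
      fix t
      let ?e = "t + indicator_exponent (L ! r)"
      have "Poly_Mapping.lookup ((monomial_mat L M \<mu> *\<^sub>v x) $ r) t
          = (\<Sum>c<length M. \<mu> r c * component M ?e x c)"
        unfolding lookup_eq_component[OF r] by (rule component_monomial_mat[OF \<mu>[OF r] r x])
      also have "\<dots> = (if ?e \<in> E then \<Sum>c<length M. \<mu> r c * w ?e c else 0)"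
        by (simp add: comp_x)
      also have "\<dots> = (if ?e \<in> E then component L ?e v r else 0)" using w(2)[OF r] by simp
      also have "\<dots> = Poly_Mapping.lookup (v $ r) t"
      proof (cases "?e \<in> E")
        case True then show ?thesis by (simp add: lookup_eq_component[OF r])
      next
        case False
        then have "t \<notin> Poly_Mapping.keys (v $ r)" using r by (auto simp: E_def)
        then show ?thesis using False by (simp add: in_keys_iff)
      qed
      finally show "Poly_Mapping.lookup ((monomial_mat L M \<mu> *\<^sub>v x) $ r) t = Poly_Mapping.lookup (v $ r) t" .
    qed
  qed (use v in auto)
  then show ?thesis using x by (auto simp: mat_im_def)
qed

lemma sum_indicator_exponent: "(\<Sum>i\<in>UNIV. Poly_Mapping.lookup (indicator_exponent S) i) = card S"
  by (simp add: sum.If_cases)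

lemma graded_free_resolution_sqfree:
  fixes \<mu> :: "nat \<Rightarrow> nat \<Rightarrow> nat \<Rightarrow> 'k::field" and \<Gamma> :: "'n::finite set set"
  assumes "sqfree_resolution \<Gamma> s \<mu>"
  shows "graded_free_resolution (nonface_ideal \<Gamma>) (\<lambda>i. map card (s i)) (\<lambda>i. monomial_mat (s i) (s (Suc i)) (\<mu> i))"
    (is "graded_free_resolution ?I ?a ?d")
proof -
  note D = sqfree_resolutionD[OF assms]
  have "?a 0 = [0]" using D(1) by simp
  moreover have "?d i \<in> carrier_mat (length (?a i)) (length (?a (Suc i)))" for i by simp
  moreover have "homogeneous_shift (?a i ! r) (?a (Suc i) ! c) (?d i $$ (r, c))"
    if "r < length (?a i)" "c < length (?a (Suc i))" for i r c
  proof -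
    have "card (s i ! r) + card (s (Suc i) ! c - s i ! r) = card (s (Suc i) ! c)" if "\<mu> i r c \<noteq> 0"
    proof -
      have "s i ! r \<subseteq> s (Suc i) ! c" using D(2) \<open>r < _\<close> \<open>c < _\<close> that by auto
      then show ?thesis by (simp add: card_Diff_subset card_mono)
    qed
    then show ?thesis using that
      by (simp add: homogeneous_shift_def monomial_mat_def sum_indicator_exponent del: lookup_indicator_exponent)
  qed
  moreover have "(\<lambda>v. v $ 0) ` mat_im (?d 0) = ?I"
  proof (rule equalityI; rule subsetI)
    fix p assume "p \<in> (\<lambda>v. v $ 0) ` mat_im (?d 0)"
    then obtain x where x: "x \<in> carrier_vec (length (s 1))" "p = (?d 0 *\<^sub>v x) $ 0"
      by (auto simp: mat_im_def)
    have "Poly_Mapping.keys t \<in> \<Gamma>" if t: "t \<in> Poly_Mapping.keys p" for t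
    proof -
      have "t + indicator_exponent (s 0 ! 0) = t" using D(1) by (intro poly_mapping_eqI) (simp add: lookup_add)
      then have "Poly_Mapping.lookup p t = component (s 0) t (?d 0 *\<^sub>v x) 0"
        using lookup_eq_component[of 0 "s 0" "?d 0 *\<^sub>v x" t] D(1) x(2) by simp
      also have "\<dots> = (\<Sum>c<length (s (Suc 0)). \<mu> 0 0 c * component (s (Suc 0)) t x c)"
        using D(1) x by (intro component_monomial_mat D(2)) auto
      finally show ?thesis
        using t D(3) component_in_strand[of "s 1" t x] by (auto simp: in_keys_iff)
    qed
    then show "p \<in> ?I" by (simp add: nonface_ideal_def)
  next
    fix p :: "('n, 'k) mpoly" assume p: "p \<in> ?I"
    have "vec 1 (\<lambda>_. p) \<in> mat_im (?d 0)"
    proof (rule in_image_monomial_mat)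
      fix e
      have comp: "component (s 0) e (vec 1 (\<lambda>_. p)) 0 = Poly_Mapping.lookup p e"
        using D(1) minus_indicator_add[of "{}" e] by (simp add: component_def)
          (metis add.right_neutral empty_subsetI keys_eq_empty keys_indicator_exponent minus_indicator_add)
      show "\<exists>w\<in>strand (s (Suc 0)) (Poly_Mapping.keys e). \<forall>r<length (s 0).
          component (s 0) e (vec 1 (\<lambda>_. p)) r = (\<Sum>c<length (s (Suc 0)). \<mu> 0 r c * w c)"
      proof (cases "Poly_Mapping.lookup p e = 0")
        case True
        then show ?thesis using D(1) comp by (intro bexI[of _ "\<lambda>_. 0"]) (auto simp: strand_def)
      next
        case False
        then have "Poly_Mapping.keys e \<in> \<Gamma>" using p by (auto simp: nonface_ideal_def in_keys_iff)
        then obtain w where w: "w \<in> strand (s 1) (Poly_Mapping.keys e)" "(\<Sum>c<length (s 1). \<mu> 0 0 c * w c) \<noteq> 0"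
          using D(3) by blast
        define y where "y = Poly_Mapping.lookup p e / (\<Sum>c<length (s 1). \<mu> 0 0 c * w c)"
        have "(\<Sum>c<length (s 1). \<mu> 0 0 c * (y * w c)) = y * (\<Sum>c<length (s 1). \<mu> 0 0 c * w c)"
          by (simp add: sum_distrib_left ac_simps)
        then have "(\<Sum>c<length (s 1). \<mu> 0 0 c * (y * w c)) = Poly_Mapping.lookup p e"
          using w(2) by (simp add: y_def)
        moreover have "(\<lambda>c. y * w c) \<in> strand (s 1) (Poly_Mapping.keys e)"
          using w(1) by (auto simp: strand_def)
        ultimately show ?thesis using D(1) comp by (intro bexI[of _ "\<lambda>c. y * w c"]) auto
      qed
    qed (use D(1,2) in auto)
    then show "p \<in> (\<lambda>v. v $ 0) ` mat_im (?d 0)" by (force intro!: image_eqI[of _ _ "vec 1 (\<lambda>_. p)"])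
  qed
  moreover have "mat_ker (?d i) = mat_im (?d (Suc i))" for i
  proof (rule equalityI; rule subsetI)
    fix v assume "v \<in> mat_ker (?d i)"
    then have v: "v \<in> carrier_vec (length (s (Suc i)))" "?d i *\<^sub>v v = 0\<^sub>v (length (s i))"
      by (auto simp: mat_ker_def)
    show "v \<in> mat_im (?d (Suc i))"
    proof (rule in_image_monomial_mat[OF D(2) v(1)])
      fix e
      have "(\<Sum>c<length (s (Suc i)). \<mu> i r c * component (s (Suc i)) e v c) = 0" if "r < length (s i)" for r
      proof -
        have "component (s i) e (?d i *\<^sub>v v) r = 0" using that by (simp add: v(2) component_def)
        then show ?thesis
          using component_monomial_mat[of "s (Suc i)" "\<mu> i" r "s i" v e, OF D(2)[OF that] that v(1)] by simp
      qed
      then show "\<exists>w\<in>strand (s (Suc (Suc i))) (Poly_Mapping.keys e). \<forall>r<length (s (Suc i)).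
          component (s (Suc i)) e v r = (\<Sum>c<length (s (Suc (Suc i))). \<mu> (Suc i) r c * w c)"
        using D(4)[OF component_in_strand] by blast
    qed
  next
    fix v assume "v \<in> mat_im (?d (Suc i))"
    then obtain x where x: "x \<in> carrier_vec (length (s (Suc (Suc i))))" "v = ?d (Suc i) *\<^sub>v x"
      by (auto simp: mat_im_def)
    have v: "v \<in> carrier_vec (length (s (Suc i)))"
      unfolding x(2) by (rule mult_mat_vec_carrier[OF monomial_mat_carrier x(1)])
    have zero: "component (s i) e (?d i *\<^sub>v v) r = 0" if r: "r < length (s i)" for e r
    proof -
      have "component (s (Suc i)) e v c
          = (\<Sum>k<length (s (Suc (Suc i))). \<mu> (Suc i) c k * component (s (Suc (Suc i))) e x k)"
        if "c < length (s (Suc i))" for c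
        unfolding x(2) using that x(1) D(2) by (intro component_monomial_mat) auto
      then have "\<forall>r<length (s i). (\<Sum>c<length (s (Suc i)). \<mu> i r c * component (s (Suc i)) e v c) = 0"
        using D(4)[OF component_in_strand] component_in_strand by blast
      then show ?thesis using component_monomial_mat[OF D(2)[OF r] r v] r by simp
    qed
    have "?d i *\<^sub>v v = 0\<^sub>v (length (s i))"
    proof (rule eq_vecI)
      fix r assume "r < dim_vec (0\<^sub>v (length (s i)))"
      then have r: "r < length (s i)" by simp
      have "Poly_Mapping.lookup ((?d i *\<^sub>v v) $ r) t = 0" for t
        using lookup_eq_component[OF r] zero[OF r] by metis
      then show "(?d i *\<^sub>v v) $ r = 0\<^sub>v (length (s i)) $ r" using r by (auto intro: poly_mapping_eqI)
    qed simp
    then show "v \<in> mat_ker (?d i)" using v by (simp add: mat_ker_def)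
  qed
  ultimately show ?thesis unfolding graded_free_resolution_def by blast
qed

lemma minimal_graded_free_resolution_sqfree:
  assumes "minimal_sqfree_resolution \<Gamma> s \<mu>"
  shows "minimal_graded_free_resolution (nonface_ideal \<Gamma>) (\<lambda>i. map card (s i))
      (\<lambda>i. monomial_mat (s i) (s (Suc i)) (\<mu> i))"
proof -
  have res: "sqfree_resolution \<Gamma> s \<mu>" using assms by (simp add: minimal_sqfree_resolution_def)
  have "monomial_mat (s i) (s (Suc i)) (\<mu> i) $$ (r, c) \<in> max_ideal"
    if "r < length (s i)" "c < length (s (Suc i))" for i r c
  proof (cases "\<mu> i r c = 0")
    case False
    then have "s i ! r \<subset> s (Suc i) ! c"
      using assms sqfree_resolutionD(2)[OF res that] that unfolding minimal_sqfree_resolution_def by blast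
    then have "indicator_exponent (s (Suc i) ! c - s i ! r) \<noteq> 0"
      by (metis Diff_eq_empty_iff keys_indicator_exponent keys_zero psubsetE)
    then show ?thesis using that
      by (auto simp: monomial_mat_def max_ideal_eq_nonface_ideal nonface_ideal_def)
  qed (use that in \<open>simp add: monomial_mat_def max_ideal_iff\<close>)
  then show ?thesis using graded_free_resolution_sqfree[OF res] by (simp add: minimal_graded_free_resolution_def)
qed

section \<open>Existence of minimal squarefree resolutions\<close>

lemma finite_dimensional_subspace_generators:
  fixes Z :: "(nat \<Rightarrow> 'k::field) set"
  assumes m: "\<And>v c. v \<in> Z \<Longrightarrow> v c \<noteq> 0 \<Longrightarrow> c < m"
  shows "\<exists>B. finite B \<and> B \<subseteq> Z \<and> (\<forall>v\<in>Z. \<exists>u. \<forall>c. v c = (\<Sum>b\<in>B. u b * b c))"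
proof -
  interpret fv: vector_space "\<lambda>(a::'k) (v::nat \<Rightarrow> 'k) c. a * v c"
    by unfold_locales (auto simp: fun_eq_iff algebra_simps)
  have sum_apply: "(\<Sum>b\<in>B. f b) c = (\<Sum>b\<in>B. f b c)" for f :: "'b \<Rightarrow> nat \<Rightarrow> 'k" and B c
    by (induction B rule: infinite_finite_induct) auto
  obtain B where B: "B \<subseteq> Z" "fv.independent B" "Z \<subseteq> fv.span B"
    using fv.maximal_independent_subset[of Z] by blast
  let ?e = "\<lambda>i c. if c = i then 1 else 0 :: 'k"
  have "Z \<subseteq> fv.span (?e ` {..<m})"
  proof
    fix v assume v: "v \<in> Z"
    have "v = (\<Sum>i<m. (\<lambda>c. v i * ?e i c))"
    proof
      fix c
      have "(\<Sum>i<m. v i * ?e i c) = (\<Sum>i<m. if c = i then v i else 0)" by (intro sum.cong) auto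
      also have "\<dots> = v c" using m[OF v, of c] by auto
      finally show "v c = (\<Sum>i<m. (\<lambda>c. v i * ?e i c)) c" by (simp add: sum_apply)
    qed
    also have "\<dots> \<in> fv.span (?e ` {..<m})"
      by (intro fv.span_sum fv.span_scale fv.span_base) auto
    finally show "v \<in> fv.span (?e ` {..<m})" .
  qed
  then have finB: "finite B" using fv.independent_span_bound[of "?e ` {..<m}" B] B by auto
  have "\<exists>u. \<forall>c. v c = (\<Sum>b\<in>B. u b * b c)" if "v \<in> Z" for v
  proof -
    have "v \<in> range (\<lambda>u. \<Sum>b\<in>B. (\<lambda>c. u b * b c))"
      using B(3) that fv.span_finite[OF finB] by blast
    then show ?thesis by (auto simp: sum_apply)
  qed
  then show ?thesis using finB B(1) by blast
qed

text \<open>A multigraded submodule of a free module with squarefree degrees is given by a monotone family of finite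
  dimensional spaces \<open>Z W\<close>. Among its finite generating sets take one of least cardinality: a relation with a
  nonzero coefficient at a generator of the same degree as the relation would make that generator redundant. The
  absence of such relations is the minimality of the resolution built from the generators.\<close>

lemma minimal_multigraded_generators:
  fixes Z :: "'n::finite set \<Rightarrow> (nat \<Rightarrow> 'k::field) set"
  assumes m: "\<And>W v c. v \<in> Z W \<Longrightarrow> v c \<noteq> 0 \<Longrightarrow> c < m"
    and zero: "\<And>W. (\<lambda>_. 0) \<in> Z W"
    and add: "\<And>W u v. u \<in> Z W \<Longrightarrow> v \<in> Z W \<Longrightarrow> (\<lambda>c. u c + v c) \<in> Z W"
    and scale: "\<And>W a v. v \<in> Z W \<Longrightarrow> (\<lambda>c. a * v c) \<in> Z W"
    and mono: "\<And>W W'. W \<subseteq> W' \<Longrightarrow> Z W \<subseteq> Z W'"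
  shows "\<exists>L \<mu>. (\<forall>k<length L. (\<lambda>c. \<mu> c k) \<in> Z (L ! k)) \<and>
    (\<forall>W v. v \<in> Z W \<longleftrightarrow> (\<exists>w \<in> strand L W. v = (\<lambda>c. \<Sum>k<length L. \<mu> c k * w k))) \<and>
    (\<forall>W. \<forall>w \<in> strand L W. (\<forall>c. (\<Sum>k<length L. \<mu> c k * w k) = 0) \<longrightarrow> (\<forall>k<length L. L ! k = W \<longrightarrow> w k = 0))"
proof -
  define gen where "gen G \<longleftrightarrow> finite G \<and> (\<forall>p\<in>G. snd p \<in> Z (fst p)) \<and>
     (\<forall>W. \<forall>v\<in>Z W. \<exists>u. (\<forall>p. u p \<noteq> 0 \<longrightarrow> fst p \<subseteq> W) \<and> (\<forall>c. v c = (\<Sum>p\<in>G. u p * snd p c)))"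
    for G :: "('n set \<times> (nat \<Rightarrow> 'k)) set"
  have "\<exists>G. gen G"
  proof -
    have "\<exists>B. finite B \<and> B \<subseteq> Z W \<and> (\<forall>v\<in>Z W. \<exists>u. \<forall>c. v c = (\<Sum>b\<in>B. u b * b c))" for W
      by (rule finite_dimensional_subspace_generators[OF m])
    then obtain B where B: "\<And>W. finite (B W)" "\<And>W. B W \<subseteq> Z W"
      "\<And>W v. v \<in> Z W \<Longrightarrow> \<exists>u. \<forall>c. v c = (\<Sum>b\<in>B W. u b * b c)" by metis
    have "gen (Sigma UNIV B)"
      unfolding gen_def
    proof (intro conjI ballI allI)
      show "finite (Sigma UNIV B)" using B(1) by (intro finite_SigmaI) auto
      show "snd p \<in> Z (fst p)" if "p \<in> Sigma UNIV B" for p using that subsetD[OF B(2)] by auto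
      fix W v assume "v \<in> Z W"
      then obtain u where u: "\<And>c. v c = (\<Sum>b\<in>B W. u b * b c)" using B(3) by blast
      define u' where "u' p = (if fst p = W then u (snd p) else 0)" for p :: "'n set \<times> (nat \<Rightarrow> 'k)"
      have "v c = (\<Sum>p\<in>Sigma UNIV B. u' p * snd p c)" for c
      proof -
        have "(\<Sum>p\<in>Sigma UNIV B. u' p * snd p c) = (\<Sum>W'\<in>UNIV. \<Sum>b\<in>B W'. u' (W', b) * b c)"
          by (subst sum.Sigma) (auto simp: B(1) split_def)
        also have "\<dots> = (\<Sum>W'\<in>UNIV. if W' = W then \<Sum>b\<in>B W'. u b * b c else 0)"
          by (intro sum.cong) (auto simp: u'_def)
        also have "\<dots> = v c" by (simp add: u)
        finally show ?thesis ..
      qed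
      then show "\<exists>u. (\<forall>p. u p \<noteq> 0 \<longrightarrow> fst p \<subseteq> W) \<and> (\<forall>c. v c = (\<Sum>p\<in>Sigma UNIV B. u p * snd p c))"
        by (intro exI[of _ u']) (auto simp: u'_def)
    qed
    then show ?thesis by blast
  qed
  then obtain G where G: "gen G" and least: "\<And>G'. gen G' \<Longrightarrow> card G \<le> card G'"
    using ex_has_least_nat[of gen _ card] by blast
  have finG: "finite G" and GZ: "\<And>p. p \<in> G \<Longrightarrow> snd p \<in> Z (fst p)"
    and Gen: "\<And>W v. v \<in> Z W \<Longrightarrow> \<exists>u. (\<forall>p. u p \<noteq> 0 \<longrightarrow> fst p \<subseteq> W) \<and> (\<forall>c. v c = (\<Sum>p\<in>G. u p * snd p c))"
    using G by (auto simp: gen_def)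
  have irredundant: "u q = 0"
    if q: "q \<in> G" and u: "\<And>p. p \<in> G \<Longrightarrow> u p \<noteq> 0 \<Longrightarrow> fst p \<subseteq> fst q" "\<And>c. (\<Sum>p\<in>G. u p * snd p c) = 0" for u q
  proof (rule ccontr)
    assume uq: "u q \<noteq> 0"
    have "gen (G - {q})"
      unfolding gen_def
    proof (intro conjI ballI allI)
      fix W v assume "v \<in> Z W"
      then obtain x where x: "\<And>p. x p \<noteq> 0 \<Longrightarrow> fst p \<subseteq> W" "\<And>c. v c = (\<Sum>p\<in>G. x p * snd p c)"
        using Gen by blast
      define y where "y p = (if p \<in> G then x p - x q / u q * u p else 0)" for p
      have "y p \<noteq> 0 \<longrightarrow> fst p \<subseteq> W" for p
      proof
        assume "y p \<noteq> 0"
        then have "p \<in> G" "x p \<noteq> 0 \<or> (x q \<noteq> 0 \<and> u p \<noteq> 0)" by (auto simp: y_def split: if_splits)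
        then show "fst p \<subseteq> W" using x(1) u(1) by blast
      qed
      moreover have "v c = (\<Sum>p\<in>G - {q}. y p * snd p c)" for c
      proof -
        have "(\<Sum>p\<in>G. y p * snd p c) = (\<Sum>p\<in>G. x p * snd p c) - x q / u q * (\<Sum>p\<in>G. u p * snd p c)"
          unfolding sum_distrib_left sum_subtractf[symmetric]
          by (intro sum.cong) (auto simp: y_def algebra_simps)
        then have "v c = (\<Sum>p\<in>G. y p * snd p c)" using x(2) u(2) by simp
        also have "\<dots> = y q * snd q c + (\<Sum>p\<in>G - {q}. y p * snd p c)"
          using finG q by (rule sum.remove)
        also have "y q = 0" using uq q by (simp add: y_def)
        finally show ?thesis by simp
      qed
      ultimately show "\<exists>u. (\<forall>p. u p \<noteq> 0 \<longrightarrow> fst p \<subseteq> W) \<and> (\<forall>c. v c = (\<Sum>p\<in>G - {q}. u p * snd p c))"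
        by blast
    qed (use finG GZ in auto)
    then have "card G \<le> card (G - {q})" by (rule least)
    then show False using q finG by (metis card_Diff1_less not_le)
  qed
  obtain ps where ps: "set ps = G" "distinct ps" using finite_distinct_list[OF finG] by blast
  let ?L = "map fst ps" and ?\<mu> = "\<lambda>c k. snd (ps ! k) c"
  have bij: "bij_betw ((!) ps) {..<length ps} G"
    using ps by (auto intro: bij_betw_nth)
  have reindex: "(\<Sum>k<length ps. f (ps ! k)) = (\<Sum>p\<in>G. f p)" for f :: "_ \<Rightarrow> 'k"
    by (rule sum.reindex_bij_betw[OF bij])
  have columns: "(\<lambda>c. ?\<mu> c k) \<in> Z (?L ! k)" if "k < length ?L" for k
    using that GZ[of "ps ! k"] ps(1) by auto
  have span: "v \<in> Z W \<longleftrightarrow> (\<exists>w \<in> strand ?L W. v = (\<lambda>c. \<Sum>k<length ?L. ?\<mu> c k * w k))" for W v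
  proof
    assume "v \<in> Z W"
    then obtain u where u: "\<And>p. u p \<noteq> 0 \<Longrightarrow> fst p \<subseteq> W" "\<And>c. v c = (\<Sum>p\<in>G. u p * snd p c)"
      using Gen by blast
    define w where "w k = (if k < length ps then u (ps ! k) else 0)" for k
    have "w \<in> strand ?L W" using u(1) by (auto simp: strand_def w_def split: if_splits)
    moreover have "v c = (\<Sum>k<length ?L. ?\<mu> c k * w k)" for c
    proof -
      have "(\<Sum>k<length ?L. ?\<mu> c k * w k) = (\<Sum>k<length ps. u (ps ! k) * snd (ps ! k) c)"
        by (auto simp: w_def intro!: sum.cong)
      then show ?thesis using reindex[of "\<lambda>p. u p * snd p c"] u(2) by simp
    qed
    ultimately show "\<exists>w \<in> strand ?L W. v = (\<lambda>c. \<Sum>k<length ?L. ?\<mu> c k * w k)" by blast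
  next
    assume "\<exists>w \<in> strand ?L W. v = (\<lambda>c. \<Sum>k<length ?L. ?\<mu> c k * w k)"
    then obtain w where w: "w \<in> strand ?L W" "v = (\<lambda>c. \<Sum>k<length ps. ?\<mu> c k * w k)" by auto
    have "(\<lambda>c. \<Sum>k<n. ?\<mu> c k * w k) \<in> Z W" if "n \<le> length ps" for n
      using that
    proof (induction n)
      case 0 then show ?case by (simp add: zero)
    next
      case (Suc n)
      have "(\<lambda>c. w n * snd (ps ! n) c) \<in> Z W"
      proof (cases "w n = 0")
        case True then show ?thesis by (simp add: zero)
      next
        case False
        then have "fst (ps ! n) \<subseteq> W" using strandD[OF w(1), of n] Suc.prems by auto
        moreover have "snd (ps ! n) \<in> Z (fst (ps ! n))" using GZ ps(1) Suc.prems by auto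
        ultimately show ?thesis using mono scale by blast
      qed
      then show ?case using add[OF Suc.IH] Suc.prems by (simp add: mult.commute)
    qed
    then show "v \<in> Z W" using w(2) by simp
  qed
  have minimal: "w k = 0"
    if w: "w \<in> strand ?L W" "\<forall>c. (\<Sum>k<length ?L. ?\<mu> c k * w k) = 0" and k: "k < length ?L" "?L ! k = W" for W w k
  proof -
    define u where "u p = w (the_inv_into {..<length ps} ((!) ps) p)" for p
    have inj: "inj_on ((!) ps) {..<length ps}" using bij by (simp add: bij_betw_def)
    have u: "u (ps ! j) = w j" if "j < length ps" for j
      using the_inv_into_f_f[OF inj, of j] that by (simp add: u_def)
    have "u (ps ! k) = 0"
    proof (rule irredundant)
      show "ps ! k \<in> G" using k ps by auto
      show "fst p \<subseteq> fst (ps ! k)" if p: "p \<in> G" "u p \<noteq> 0" for p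
      proof -
        obtain j where "j < length ps" "p = ps ! j" using p(1) ps(1) by (metis in_set_conv_nth)
        then show ?thesis using strandD[OF w(1), of j] u p(2) k by auto
      qed
      show "(\<Sum>p\<in>G. u p * snd p c) = 0" for c
      proof -
        have "(\<Sum>p\<in>G. u p * snd p c) = (\<Sum>k<length ps. u (ps ! k) * snd (ps ! k) c)"
          by (rule reindex[symmetric])
        also have "\<dots> = (\<Sum>k<length ?L. ?\<mu> c k * w k)"
          by (intro sum.cong) (auto simp: u)
        finally show ?thesis using w(2) by simp
      qed
    qed
    then show ?thesis using u k by simp
  qed
  show ?thesis
  proof (intro exI conjI)
    show "\<forall>k<length ?L. (\<lambda>c. ?\<mu> c k) \<in> Z (?L ! k)" using columns by blast
    show "\<forall>W v. v \<in> Z W \<longleftrightarrow> (\<exists>w \<in> strand ?L W. v = (\<lambda>c. \<Sum>k<length ?L. ?\<mu> c k * w k))"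
      using span by simp
    show "\<forall>W. \<forall>w \<in> strand ?L W. (\<forall>c. (\<Sum>k<length ?L. ?\<mu> c k * w k) = 0) \<longrightarrow> (\<forall>k<length ?L. ?L ! k = W \<longrightarrow> w k = 0)"
    proof (intro allI ballI impI)
      fix W w k assume "w \<in> strand ?L W" "\<forall>c. (\<Sum>k<length ?L. ?\<mu> c k * w k) = 0" "k < length ?L" "?L ! k = W"
      then show "w k = 0" by (rule minimal)
    qed
  qed
qed

lemma strand_closed:
  fixes v :: "nat \<Rightarrow> 'k::field"
  shows "(\<lambda>_. 0 :: 'k) \<in> strand L W"
    "u \<in> strand L W \<Longrightarrow> v \<in> strand L W \<Longrightarrow> (\<lambda>c. u c + v c) \<in> strand L W"
    "v \<in> strand L W \<Longrightarrow> (\<lambda>c. a * v c) \<in> strand L W"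
    "W \<subseteq> W' \<Longrightarrow> v \<in> strand L W \<Longrightarrow> v \<in> strand L W'"
proof -
  show "(\<lambda>c. u c + v c) \<in> strand L W" if "u \<in> strand L W" "v \<in> strand L W"
    unfolding strand_def
  proof (intro CollectI allI impI)
    fix c assume "u c + v c \<noteq> 0"
    then have "u c \<noteq> 0 \<or> v c \<noteq> 0" by auto
    then show "c < length L \<and> L ! c \<subseteq> W" using strandD[OF that(1), of c] strandD[OF that(2), of c] by blast
  qed
qed (auto simp: strand_def)

text \<open>The resolution is built one syzygy module at a time. A state consists of the degrees of a basis together with
  the submodule that the next differential has to cover: the ideal itself at the start, then the kernel
  of the previous differential.\<close>

lemma minimal_sqfree_resolution_exists:
  fixes \<Gamma> :: "'n::finite set set"
  assumes \<Gamma>: "upset \<Gamma>" "{} \<notin> \<Gamma>"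
  shows "\<exists>s (\<mu> :: nat \<Rightarrow> nat \<Rightarrow> nat \<Rightarrow> 'k::field). minimal_sqfree_resolution \<Gamma> s \<mu>"
proof -
  define P where "P x \<longleftrightarrow> (\<forall>W. (\<lambda>_. 0) \<in> snd x W) \<and>
      (\<forall>W. \<forall>u\<in>snd x W. \<forall>v\<in>snd x W. (\<lambda>c. u c + v c) \<in> snd x W) \<and>
      (\<forall>W a. \<forall>v\<in>snd x W. (\<lambda>c. a * v c) \<in> snd x W) \<and>
      (\<forall>W W'. W \<subseteq> W' \<longrightarrow> snd x W \<subseteq> snd x W') \<and>
      (\<forall>W. snd x W \<subseteq> strand (fst x) W) \<and>
      (\<forall>W. \<forall>v\<in>snd x W. \<forall>c<length (fst x). fst x ! c = W \<longrightarrow> v c = 0)"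
    for x :: "'n set list \<times> ('n set \<Rightarrow> (nat \<Rightarrow> 'k) set)"
  define R where "R x y \<mu> \<longleftrightarrow> (\<forall>k<length (fst y). (\<lambda>c. \<mu> c k) \<in> snd x (fst y ! k)) \<and>
      (\<forall>W v. v \<in> snd x W \<longleftrightarrow> (\<exists>w \<in> strand (fst y) W. v = (\<lambda>c. \<Sum>k<length (fst y). \<mu> c k * w k))) \<and>
      (\<forall>W. snd y W = {w \<in> strand (fst y) W. \<forall>c<length (fst x). (\<Sum>k<length (fst y). \<mu> c k * w k) = 0})"
    for x y :: "'n set list \<times> ('n set \<Rightarrow> (nat \<Rightarrow> 'k) set)" and \<mu> :: "nat \<Rightarrow> nat \<Rightarrow> 'k"
  define x0 where "x0 = ([{} :: 'n set], \<lambda>W. {v \<in> strand [{}] W. W \<in> \<Gamma> \<or> (\<forall>c. v c = (0::'k))})"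
  have "\<exists>x. \<forall>i. (P (x i) \<and> (i = 0 \<longrightarrow> x i = x0)) \<and> (\<exists>\<mu>. R (x i) (x (Suc i)) \<mu>)"
  proof (rule dependent_nat_choice)
    have "P x0"
      unfolding P_def
    proof (intro conjI allI ballI impI)
      show "(\<lambda>c. u c + v c) \<in> snd x0 W" if "u \<in> snd x0 W" "v \<in> snd x0 W" for W u v
        using that strand_closed(2)[of u "[{}]" W v] by (auto simp: x0_def)
      show "(\<lambda>c. a * v c) \<in> snd x0 W" if "v \<in> snd x0 W" for W a v
        using that strand_closed(3)[of v "[{}]" W a] by (auto simp: x0_def)
      show "snd x0 W \<subseteq> snd x0 W'" if "W \<subseteq> W'" for W W'
        using that upsetD[OF \<Gamma>(1)] by (auto simp: x0_def strand_closed(4))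
      show "v c = 0" if "v \<in> snd x0 W" "c < length (fst x0)" "fst x0 ! c = W" for W v c
        using that \<Gamma>(2) by (auto simp: x0_def)
    qed (auto simp: x0_def strand_closed)
    then show "\<exists>x. P x \<and> (0 = 0 \<longrightarrow> x = x0)" by blast
  next
    fix x and i :: nat assume "P x \<and> (i = 0 \<longrightarrow> x = x0)"
    then have zero: "\<And>W. (\<lambda>_. 0) \<in> snd x W"
      and add: "\<And>W u v. u \<in> snd x W \<Longrightarrow> v \<in> snd x W \<Longrightarrow> (\<lambda>c. u c + v c) \<in> snd x W"
      and scale: "\<And>W a v. v \<in> snd x W \<Longrightarrow> (\<lambda>c. a * v c) \<in> snd x W"
      and mono: "\<And>W W'. W \<subseteq> W' \<Longrightarrow> snd x W \<subseteq> snd x W'"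
      and str: "\<And>W. snd x W \<subseteq> strand (fst x) W"
      by (auto simp: P_def)
    have m: "c < length (fst x)" if "v \<in> snd x W" "v c \<noteq> 0" for W v c
      using that str[of W] by (auto dest: strandD)
    have "\<exists>L \<mu>. (\<forall>k<length L. (\<lambda>c. \<mu> c k) \<in> snd x (L ! k)) \<and>
      (\<forall>W v. v \<in> snd x W \<longleftrightarrow> (\<exists>w \<in> strand L W. v = (\<lambda>c. \<Sum>k<length L. \<mu> c k * w k))) \<and>
      (\<forall>W. \<forall>w \<in> strand L W. (\<forall>c. (\<Sum>k<length L. \<mu> c k * w k) = 0) \<longrightarrow> (\<forall>k<length L. L ! k = W \<longrightarrow> w k = 0))"
      by (rule minimal_multigraded_generators[of "snd x" "length (fst x)", OF m zero add scale mono])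
    then obtain L \<mu> where L: "\<forall>k<length L. (\<lambda>c. \<mu> c k) \<in> snd x (L ! k)"
      "\<forall>W v. v \<in> snd x W \<longleftrightarrow> (\<exists>w \<in> strand L W. v = (\<lambda>c. \<Sum>k<length L. \<mu> c k * w k))"
      "\<forall>W. \<forall>w \<in> strand L W. (\<forall>c. (\<Sum>k<length L. \<mu> c k * w k) = 0) \<longrightarrow> (\<forall>k<length L. L ! k = W \<longrightarrow> w k = 0)"
      by (elim exE conjE)
    define y where "y = (L, \<lambda>W. {w \<in> strand L W. \<forall>c<length (fst x). (\<Sum>k<length L. \<mu> c k * w k) = 0})"
    have "P y"
      unfolding P_def
    proof (intro conjI allI ballI impI)
      show "(\<lambda>c. u c + v c) \<in> snd y W" if "u \<in> snd y W" "v \<in> snd y W" for W u v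
        using that strand_closed(2)[of u L W v] by (auto simp: y_def distrib_left sum.distrib)
      show "(\<lambda>c. a * v c) \<in> snd y W" if "v \<in> snd y W" for W a v
        using that strand_closed(3)[of v L W a]
        by (auto simp: y_def mult.left_commute[of _ a] simp flip: sum_distrib_left)
      show "snd y W \<subseteq> snd y W'" if "W \<subseteq> W'" for W W'
        using that by (auto simp: y_def strand_closed(4))
      show "v k = 0" if v: "v \<in> snd y W" "k < length (fst y)" "fst y ! k = W" for W v k
      proof -
        have "(\<Sum>k<length L. \<mu> c k * v k) = 0" for c
        proof (cases "c < length (fst x)")
          case True then show ?thesis using v by (auto simp: y_def)
        next
          case False
          have "\<mu> c k = 0" if "k < length L" for k using m[OF L(1)[rule_format, OF that], of c] False by auto
          then show ?thesis by simp
        qed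
        then show ?thesis using v by (intro L(3)[rule_format, of v W]) (auto simp: y_def)
      qed
    qed (auto simp: y_def strand_closed)
    moreover have "R x y \<mu>" using L(1,2) by (simp add: R_def y_def)
    ultimately show "\<exists>y. (P y \<and> (Suc i = 0 \<longrightarrow> y = x0)) \<and> (\<exists>\<mu>. R x y \<mu>)" by blast
  qed
  then obtain x where x: "\<And>i. P (x i)" "x 0 = x0" "\<And>i. \<exists>\<mu>. R (x i) (x (Suc i)) \<mu>" by blast
  from x(3) obtain \<mu> where R: "\<And>i. R (x i) (x (Suc i)) (\<mu> i)" by metis
  define s where "s i = fst (x i)" for i
  define Z where "Z i = snd (x i)" for i
  have Zs: "Z i W \<subseteq> strand (s i) W" for i W using x(1)[of i] by (auto simp: P_def s_def Z_def)
  have Zmin: "v c = 0" if "v \<in> Z i (s i ! c)" "c < length (s i)" for i v c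
    using x(1)[of i] that by (auto simp: P_def s_def Z_def)
  have col: "(\<lambda>c. \<mu> i c k) \<in> Z i (s (Suc i) ! k)" if "k < length (s (Suc i))" for i k
    using R[of i] that by (auto simp: R_def s_def Z_def)
  have span: "v \<in> Z i W \<longleftrightarrow> (\<exists>w \<in> strand (s (Suc i)) W. v = (\<lambda>c. \<Sum>k<length (s (Suc i)). \<mu> i c k * w k))" for i W v
    using R[of i] unfolding R_def s_def Z_def by blast
  have ker: "Z (Suc i) W = {w \<in> strand (s (Suc i)) W. \<forall>c<length (s i). (\<Sum>k<length (s (Suc i)). \<mu> i c k * w k) = 0}" for i W
    using R[of i] unfolding R_def s_def Z_def by blast
  have s0: "s 0 = [{}]" and Z0: "Z 0 W = {v \<in> strand [{}] W. W \<in> \<Gamma> \<or> (\<forall>c. v c = 0)}" for W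
    using x(2) by (simp_all add: s_def Z_def x0_def)
  have "sqfree_resolution \<Gamma> s \<mu>"
    unfolding sqfree_resolution_def
  proof (intro conjI allI ballI impI)
    show "s 0 = [{}]" by (rule s0)
    show "s i ! r \<subseteq> s (Suc i) ! c" if "r < length (s i)" "c < length (s (Suc i))" "\<mu> i r c \<noteq> 0" for i r c
      using strandD[of "\<lambda>r. \<mu> i r c" "s i" "s (Suc i) ! c" r] col[OF that(2)] Zs that(3) by auto
    show "W \<in> \<Gamma> \<longleftrightarrow> (\<exists>w \<in> strand (s 1) W. (\<Sum>c<length (s 1). \<mu> 0 0 c * w c) \<noteq> 0)" for W
    proof
      assume "W \<in> \<Gamma>"
      then have "(\<lambda>c. if c = 0 then 1 else 0) \<in> Z 0 W" by (auto simp: Z0 strand_def)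
      then obtain w where w: "w \<in> strand (s 1) W" "(\<lambda>c. if c = 0 then 1 else 0) = (\<lambda>c. \<Sum>k<length (s 1). \<mu> 0 c k * w k)"
        using span[of _ 0 W] by auto
      then show "\<exists>w \<in> strand (s 1) W. (\<Sum>c<length (s 1). \<mu> 0 0 c * w c) \<noteq> 0"
        using fun_cong[OF w(2), of 0] by (intro bexI[OF _ w(1)]) auto
    next
      assume "\<exists>w \<in> strand (s 1) W. (\<Sum>c<length (s 1). \<mu> 0 0 c * w c) \<noteq> 0"
      then obtain w where w: "w \<in> strand (s 1) W" "(\<Sum>c<length (s 1). \<mu> 0 0 c * w c) \<noteq> 0" by blast
      then have "(\<lambda>c. \<Sum>k<length (s 1). \<mu> 0 c k * w k) \<in> Z 0 W" using span[of _ 0 W] by auto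
      then show "W \<in> \<Gamma>" using w(2) by (auto simp: Z0)
    qed
    fix i W and v :: "nat \<Rightarrow> 'k" assume v: "v \<in> strand (s (Suc i)) W"
    have "(\<forall>r<length (s i). (\<Sum>c<length (s (Suc i)). \<mu> i r c * v c) = 0) \<longleftrightarrow> v \<in> Z (Suc i) W"
      using v by (simp add: ker)
    also have "\<dots> \<longleftrightarrow> (\<exists>w \<in> strand (s (Suc (Suc i))) W. v = (\<lambda>c. \<Sum>k<length (s (Suc (Suc i))). \<mu> (Suc i) c k * w k))"
      by (rule span)
    also have "\<dots> \<longleftrightarrow> (\<exists>w \<in> strand (s (Suc (Suc i))) W. \<forall>c<length (s (Suc i)).
            v c = (\<Sum>k<length (s (Suc (Suc i))). \<mu> (Suc i) c k * w k))"
    proof -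
      have "v c = (\<Sum>k<length (s (Suc (Suc i))). \<mu> (Suc i) c k * w k)" if c: "\<not> c < length (s (Suc i))" for c w
      proof -
        have "\<mu> (Suc i) c k = 0" if "k < length (s (Suc (Suc i)))" for k
          using strandD[of "\<lambda>c. \<mu> (Suc i) c k" "s (Suc i)" "s (Suc (Suc i)) ! k" c] col[OF that] Zs c by auto
        then have "(\<Sum>k<length (s (Suc (Suc i))). \<mu> (Suc i) c k * w k) = 0" by simp
        then show ?thesis using strandD[OF v, of c] c by auto
      qed
      then show ?thesis by (metis (no_types, lifting) ext)
    qed
    finally show "(\<forall>r<length (s i). (\<Sum>c<length (s (Suc i)). \<mu> i r c * v c) = 0) \<longleftrightarrow>
        (\<exists>w \<in> strand (s (Suc (Suc i))) W. \<forall>c<length (s (Suc i)).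
            v c = (\<Sum>k<length (s (Suc (Suc i))). \<mu> (Suc i) c k * w k))" .
  qed
  moreover have "s i ! r \<noteq> s (Suc i) ! c"
    if "r < length (s i)" "c < length (s (Suc i))" "\<mu> i r c \<noteq> 0" for i r c
    using Zmin[of "\<lambda>r. \<mu> i r c" i r] col[OF that(2)] that by auto
  ultimately show ?thesis unfolding minimal_sqfree_resolution_def by blast
qed

section \<open>Dehomogenization and mapping cones\<close>

lemma strand_map_diff: "strand (map (\<lambda>A. A - S) L) W = strand L (W \<union> S)"
proof -
  have "c < length L \<and> map (\<lambda>A. A - S) L ! c \<subseteq> W \<longleftrightarrow> c < length L \<and> L ! c \<subseteq> W \<union> S" for c
    by (cases "c < length L") (simp_all add: Diff_subset_conv Un_commute)
  then show ?thesis by (simp add: strand_def)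
qed

text \<open>Setting the variables in \<open>S\<close> to \<open>1\<close>. The scalars stay the same, and the strand at \<open>W\<close> becomes the old strand at
  \<open>W \<union> S\<close>.\<close>

lemma dehomogenized_resolution:
  assumes "sqfree_resolution \<Gamma> s \<mu>"
  shows "sqfree_resolution {B. B \<union> S \<in> \<Gamma>} (\<lambda>i. map (\<lambda>A. A - S) (s i)) \<mu>"
  unfolding sqfree_resolution_def strand_map_diff length_map
proof (intro conjI allI ballI impI)
  note D = sqfree_resolutionD[OF assms]
  show "map (\<lambda>A. A - S) (s 0) = [{}]" by (simp add: D(1))
  show "map (\<lambda>A. A - S) (s i) ! r \<subseteq> map (\<lambda>A. A - S) (s (Suc i)) ! c"
    if "r < length (s i)" "c < length (s (Suc i))" "\<mu> i r c \<noteq> 0" for i r c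
    using D(2)[OF that] that by auto
  show "W \<in> {B. B \<union> S \<in> \<Gamma>} \<longleftrightarrow> (\<exists>w \<in> strand (s 1) (W \<union> S). (\<Sum>c<length (s 1). \<mu> 0 0 c * w c) \<noteq> 0)" for W
    using D(3)[of "W \<union> S"] by simp
qed (rule sqfree_resolutionD(4)[OF assms])

lemma sum_lessThan_add:
  fixes f :: "nat \<Rightarrow> 'b::comm_monoid_add"
  shows "(\<Sum>c<n + m. f c) = (\<Sum>c<n. f c) + (\<Sum>c<m. f (n + c))"
  by (induction m) (auto simp: add.assoc)

text \<open>The mapping cone of multiplication by \<open>x\<^sub>S\<close>. The resolution of \<open>R/(I : x\<^sub>S)\<close> with degrees \<open>A - S\<close>, shifted by
  \<open>S\<close>, has degrees \<open>A \<union> S\<close>; in the cone its index goes up by one.\<close>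

definition cone_degrees :: "'n set \<Rightarrow> (nat \<Rightarrow> 'n set list) \<Rightarrow> nat \<Rightarrow> 'n set list" where
  "cone_degrees S s i = (case i of 0 \<Rightarrow> s 0 | Suc j \<Rightarrow> s i @ map (\<lambda>A. A \<union> S) (s j))"

text \<open>The block matrix with rows \<open>(\<mu> i, 1)\<close> and \<open>(0, - \<mu> (i - 1))\<close>: on scalars the chain map between the two resolutions is
  the identity. For \<open>i = 0\<close> there are no rows in the lower block.\<close>

definition cone_scalars :: "(nat \<Rightarrow> 'n set list) \<Rightarrow> (nat \<Rightarrow> nat \<Rightarrow> nat \<Rightarrow> 'k::field) \<Rightarrow> nat \<Rightarrow> nat \<Rightarrow> nat \<Rightarrow> 'k" where
  "cone_scalars s \<mu> i r c =
     (if c < length (s (Suc i)) then if r < length (s i) then \<mu> i r c else 0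
      else if r < length (s i) then if r = c - length (s (Suc i)) then 1 else 0
      else - \<mu> (i - 1) (r - length (s i)) (c - length (s (Suc i))))"

text \<open>If \<open>S \<subseteq> W\<close>, both resolutions have the same strand at \<open>W\<close>, and the cone is that of an identity map, which is
  exact also at the beginning, as \<open>x\<^sub>W \<in> (x\<^sub>S)\<close>. Otherwise the shifted resolution has zero strand at \<open>W\<close>, and the cone
  is the strand of the old resolution.\<close>

lemma cone_resolution:
  fixes \<mu> :: "nat \<Rightarrow> nat \<Rightarrow> nat \<Rightarrow> 'k::field"
  assumes res: "sqfree_resolution \<Gamma> s \<mu>"
  shows "sqfree_resolution (\<Gamma> \<union> {B. S \<subseteq> B}) (cone_degrees S s) (cone_scalars s \<mu>)"
proof -
  note D = sqfree_resolutionD[OF res]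
  let ?n = "\<lambda>i. length (s i)"
  have deg_Suc: "cone_degrees S s (Suc i) = s (Suc i) @ map (\<lambda>A. A \<union> S) (s i)" for i
    by (simp add: cone_degrees_def)
  have len_Suc: "length (cone_degrees S s (Suc i)) = ?n (Suc i) + ?n i" for i
    by (simp add: deg_Suc)
  have deg_0: "cone_degrees S s 0 = s 0" by (simp add: cone_degrees_def)
  have strand_iff: "v \<in> strand (cone_degrees S s (Suc i)) W \<longleftrightarrow>
      (\<forall>c. v c \<noteq> 0 \<longrightarrow> c < ?n (Suc i) + ?n i) \<and>
      (\<lambda>c. if c < ?n (Suc i) then v c else 0) \<in> strand (s (Suc i)) W \<and>
      (\<forall>c<?n i. v (?n (Suc i) + c) \<noteq> 0 \<longrightarrow> s i ! c \<union> S \<subseteq> W)" for i v W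
  proof -
    have "v \<in> strand (cone_degrees S s (Suc i)) W \<longleftrightarrow>
      (\<forall>c. v c \<noteq> 0 \<longrightarrow> c < ?n (Suc i) + ?n i) \<and>
      (\<forall>c<?n (Suc i) + ?n i. v c \<noteq> 0 \<longrightarrow> cone_degrees S s (Suc i) ! c \<subseteq> W)"
      unfolding strand_def len_Suc by blast
    also have "(\<forall>c<?n (Suc i) + ?n i. v c \<noteq> 0 \<longrightarrow> cone_degrees S s (Suc i) ! c \<subseteq> W) \<longleftrightarrow>
      (\<forall>c<?n (Suc i). v c \<noteq> 0 \<longrightarrow> s (Suc i) ! c \<subseteq> W) \<and>
      (\<forall>c<?n i. v (?n (Suc i) + c) \<noteq> 0 \<longrightarrow> s i ! c \<union> S \<subseteq> W)" (is "?l \<longleftrightarrow> ?r")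
    proof
      assume l: ?l
      have "s (Suc i) ! c \<subseteq> W" if "c < ?n (Suc i)" "v c \<noteq> 0" for c
        using l[rule_format, of c] that by (simp add: deg_Suc nth_append)
      moreover have "s i ! c \<union> S \<subseteq> W" if "c < ?n i" "v (?n (Suc i) + c) \<noteq> 0" for c
        using l[rule_format, of "?n (Suc i) + c"] that by (simp add: deg_Suc nth_append)
      ultimately show ?r by blast
    next
      assume r: ?r
      show ?l
      proof (intro allI impI)
        fix c assume c: "c < ?n (Suc i) + ?n i" "v c \<noteq> 0"
        show "cone_degrees S s (Suc i) ! c \<subseteq> W"
        proof (cases "c < ?n (Suc i)")
          case True then show ?thesis using r c by (simp add: deg_Suc nth_append)
        next
          case False
          then show ?thesis using conjunct2[OF r, rule_format, of "c - ?n (Suc i)"] c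
            by (simp add: deg_Suc nth_append)
        qed
      qed
    qed
    also have "(\<forall>c<?n (Suc i). v c \<noteq> 0 \<longrightarrow> s (Suc i) ! c \<subseteq> W) \<longleftrightarrow>
      (\<lambda>c. if c < ?n (Suc i) then v c else 0) \<in> strand (s (Suc i)) W"
      by (auto simp: strand_def)
    finally show ?thesis .
  qed
  have up: "(\<Sum>c<?n (Suc i) + ?n i. cone_scalars s \<mu> i r c * v c)
      = (\<Sum>c<?n (Suc i). \<mu> i r c * v c) + v (?n (Suc i) + r)" if r: "r < ?n i" for i r and v :: "nat \<Rightarrow> 'k"
  proof -
    have "(\<Sum>c<?n i. cone_scalars s \<mu> i r (?n (Suc i) + c) * v (?n (Suc i) + c))
        = (\<Sum>c<?n i. if c = r then v (?n (Suc i) + c) else 0)"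
      using r by (intro sum.cong) (auto simp: cone_scalars_def)
    moreover have "(\<Sum>c<?n (Suc i). cone_scalars s \<mu> i r c * v c) = (\<Sum>c<?n (Suc i). \<mu> i r c * v c)"
      using r by (intro sum.cong) (auto simp: cone_scalars_def)
    ultimately show ?thesis using r by (simp add: sum_lessThan_add)
  qed
  have low: "(\<Sum>c<?n (Suc (Suc i)) + ?n (Suc i). cone_scalars s \<mu> (Suc i) (?n (Suc i) + r) c * v c)
      = - (\<Sum>c<?n (Suc i). \<mu> i r c * v (?n (Suc (Suc i)) + c))" for i r and v :: "nat \<Rightarrow> 'k"
    by (simp add: sum_lessThan_add cone_scalars_def sum_negf)
  show ?thesis
    unfolding sqfree_resolution_def
  proof (intro conjI allI ballI impI)
    show "cone_degrees S s 0 = [{}]" by (simp add: deg_0 D(1))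
  next
    fix i r c assume rc: "r < length (cone_degrees S s i)" "c < length (cone_degrees S s (Suc i))"
      "cone_scalars s \<mu> i r c \<noteq> 0"
    show "cone_degrees S s i ! r \<subseteq> cone_degrees S s (Suc i) ! c"
    proof (cases "c < ?n (Suc i)")
      case True
      then have r: "r < ?n i" "\<mu> i r c \<noteq> 0" using rc(3) by (auto simp: cone_scalars_def split: if_splits)
      have "cone_degrees S s i ! r = s i ! r" using r by (cases i) (auto simp: deg_0 deg_Suc nth_append)
      then show ?thesis using D(2)[OF r(1) True r(2)] True by (simp add: deg_Suc nth_append)
    next
      case False
      define c' where "c' = c - ?n (Suc i)"
      have c': "c' < ?n i" "cone_degrees S s (Suc i) ! c = s i ! c' \<union> S"
        using False rc(2) by (auto simp: c'_def deg_Suc nth_append)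
      show ?thesis
      proof (cases "r < ?n i")
        case True
        then have "r = c'" using rc(3) False by (auto simp: cone_scalars_def c'_def split: if_splits)
        moreover have "cone_degrees S s i ! r = s i ! r" using True by (cases i) (auto simp: deg_0 deg_Suc nth_append)
        ultimately show ?thesis using c' by simp
      next
        case r: False
        then obtain j where j: "i = Suc j" using rc(1) by (cases i) (auto simp: deg_0)
        define r' where "r' = r - ?n i"
        have r': "r' < ?n j" "cone_degrees S s i ! r = s j ! r' \<union> S"
          using r rc(1) unfolding j r'_def deg_Suc by (auto simp: nth_append)
        have "\<mu> j r' c' \<noteq> 0" using rc(3) False r by (simp add: cone_scalars_def j r'_def c'_def)
        then show ?thesis using D(2)[of r' j c'] r' c' j by auto
      qed
    qed
  next
    fix W
    have sum: "(\<Sum>c<length (cone_degrees S s 1). cone_scalars s \<mu> 0 0 c * w c)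
        = (\<Sum>c<?n 1. \<mu> 0 0 c * w c) + w (?n 1)" for w
      using up[of 0 0 w] D(1) by (simp add: len_Suc)
    show "W \<in> \<Gamma> \<union> {B. S \<subseteq> B} \<longleftrightarrow>
        (\<exists>w \<in> strand (cone_degrees S s 1) W. (\<Sum>c<length (cone_degrees S s 1). cone_scalars s \<mu> 0 0 c * w c) \<noteq> 0)"
      unfolding sum
    proof
      assume W: "W \<in> \<Gamma> \<union> {B. S \<subseteq> B}"
      show "\<exists>w \<in> strand (cone_degrees S s 1) W. (\<Sum>c<?n 1. \<mu> 0 0 c * w c) + w (?n 1) \<noteq> 0"
      proof (cases "S \<subseteq> W")
        case True
        have "(\<lambda>c. if c = ?n 1 then 1 else 0) \<in> strand (cone_degrees S s 1) W"
          using True D(1) by (auto simp: strand_def deg_Suc nth_append)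
        then show ?thesis by (intro bexI) auto
      next
        case False
        then obtain w where w: "w \<in> strand (s 1) W" "(\<Sum>c<?n 1. \<mu> 0 0 c * w c) \<noteq> 0" using W D(3) by blast
        have "w (?n 1) = 0" using strandD[OF w(1), of "?n 1"] by auto
        moreover have "w \<in> strand (cone_degrees S s 1) W"
          using w(1) by (auto simp: strand_def deg_Suc nth_append)
        ultimately show ?thesis using w(2) by (intro bexI[of _ w]) auto
      qed
    next
      assume "\<exists>w \<in> strand (cone_degrees S s 1) W. (\<Sum>c<?n 1. \<mu> 0 0 c * w c) + w (?n 1) \<noteq> 0"
      then obtain w where w: "w \<in> strand (cone_degrees S s 1) W" "(\<Sum>c<?n 1. \<mu> 0 0 c * w c) + w (?n 1) \<noteq> 0"
        by blast
      show "W \<in> \<Gamma> \<union> {B. S \<subseteq> B}"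
      proof (cases "w (?n 1) = 0")
        case True
        let ?w = "\<lambda>c. if c < ?n 1 then w c else 0"
        have "?w \<in> strand (s 1) W" using w(1) strand_iff[of w 0 W] by simp
        moreover have "(\<Sum>c<?n 1. \<mu> 0 0 c * ?w c) \<noteq> 0" using w(2) True by simp
        ultimately have "W \<in> \<Gamma>" unfolding D(3) by (intro bexI[of _ ?w])
        then show ?thesis ..
      next
        case False
        then show ?thesis using w(1) strand_iff[of w 0 W] D(1) by auto
      qed
    qed
  next
    fix i W and v :: "nat \<Rightarrow> 'k" assume v: "v \<in> strand (cone_degrees S s (Suc i)) W"
    \<comment> \<open>The two blocks of \<open>v\<close>.\<close>
    define x where "x = (\<lambda>c. if c < ?n (Suc i) then v c else 0)"
    define y where "y = (\<lambda>c. v (?n (Suc i) + c))"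
    have x: "x \<in> strand (s (Suc i)) W" and yS: "\<And>c. c < ?n i \<Longrightarrow> y c \<noteq> 0 \<Longrightarrow> s i ! c \<union> S \<subseteq> W"
      and vlen: "\<And>c. v c \<noteq> 0 \<Longrightarrow> c < ?n (Suc i) + ?n i"
      using v unfolding strand_iff x_def y_def by auto
    have y: "y \<in> strand (s i) W" using yS vlen by (fastforce simp: strand_def y_def)
    have sum_x: "(\<Sum>c<?n (Suc i). f c * v c) = (\<Sum>c<?n (Suc i). f c * x c)" for f
      by (intro sum.cong) (auto simp: x_def)
    show "(\<forall>r<length (cone_degrees S s i). (\<Sum>c<length (cone_degrees S s (Suc i)). cone_scalars s \<mu> i r c * v c) = 0)
      \<longleftrightarrow> (\<exists>w \<in> strand (cone_degrees S s (Suc (Suc i))) W. \<forall>c<length (cone_degrees S s (Suc i)).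
            v c = (\<Sum>k<length (cone_degrees S s (Suc (Suc i))). cone_scalars s \<mu> (Suc i) c k * w k))"
      (is "?ker \<longleftrightarrow> ?im")
    proof
      assume ?ker
      have ker: "(\<Sum>c<?n (Suc i). \<mu> i r c * x c) + y r = 0" if "r < ?n i" for r
      proof -
        have "r < length (cone_degrees S s i)" using that by (cases i) (auto simp: deg_0 deg_Suc)
        then show ?thesis using \<open>?ker\<close> up[OF that, of v] unfolding len_Suc sum_x y_def by simp
      qed
      have "\<exists>w \<in> strand (cone_degrees S s (Suc (Suc i))) W.
          (\<forall>c<?n (Suc i). x c = (\<Sum>k<?n (Suc (Suc i)). \<mu> (Suc i) c k * w k) + w (?n (Suc (Suc i)) + c)) \<and>
          (\<forall>c<?n i. y c = - (\<Sum>k<?n (Suc i). \<mu> i c k * w (?n (Suc (Suc i)) + k)))"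
      proof (cases "S \<subseteq> W")
        case True
        \<comment> \<open>The contraction of the cone of an identity map:
          the first block of \<open>v\<close> becomes the second block of \<open>w\<close>.\<close>
        let ?w = "\<lambda>c. if c < ?n (Suc (Suc i)) then 0 else x (c - ?n (Suc (Suc i)))"
        have "?w \<in> strand (cone_degrees S s (Suc (Suc i))) W"
          unfolding strand_iff
        proof (intro conjI allI impI)
          show "c < ?n (Suc (Suc i)) + ?n (Suc i)" if "?w c \<noteq> 0" for c
            using that strandD[OF x, of "c - ?n (Suc (Suc i))"] by (auto split: if_splits)
          show "s (Suc i) ! c \<union> S \<subseteq> W" if "c < ?n (Suc i)" "?w (?n (Suc (Suc i)) + c) \<noteq> 0" for c
            using that strandD[OF x, of c] True by auto
        qed (auto simp: strand_def)
        moreover have "y c = - (\<Sum>k<?n (Suc i). \<mu> i c k * x k)" if "c < ?n i" for c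
          using ker[OF that] by (simp add: eq_neg_iff_add_eq_0 add.commute)
        ultimately show ?thesis by (intro bexI[of _ ?w]) auto
      next
        case False
        have y0: "y c = 0" if "c < ?n i" for c using yS[OF that] False by blast
        then have "\<forall>r<?n i. (\<Sum>c<?n (Suc i). \<mu> i r c * x c) = 0" using ker by simp
        then obtain w where w: "w \<in> strand (s (Suc (Suc i))) W"
          "\<And>c. c < ?n (Suc i) \<Longrightarrow> x c = (\<Sum>k<?n (Suc (Suc i)). \<mu> (Suc i) c k * w k)"
          using D(4)[OF x] by blast
        have w0: "w (?n (Suc (Suc i)) + c) = 0" for c using strandD[OF w(1), of "?n (Suc (Suc i)) + c"] by auto
        have "w \<in> strand (cone_degrees S s (Suc (Suc i))) W"
          using w(1) by (auto simp: strand_def deg_Suc nth_append)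
        then show ?thesis using w(2) w0 y0 by (intro bexI[of _ w]) auto
      qed
      then obtain w where w: "w \<in> strand (cone_degrees S s (Suc (Suc i))) W"
        "\<And>c. c < ?n (Suc i) \<Longrightarrow> x c = (\<Sum>k<?n (Suc (Suc i)). \<mu> (Suc i) c k * w k) + w (?n (Suc (Suc i)) + c)"
        "\<And>c. c < ?n i \<Longrightarrow> y c = - (\<Sum>k<?n (Suc i). \<mu> i c k * w (?n (Suc (Suc i)) + k))"
        by blast
      have "v c = (\<Sum>k<?n (Suc (Suc i)) + ?n (Suc i). cone_scalars s \<mu> (Suc i) c k * w k)"
        if c: "c < ?n (Suc i) + ?n i" for c
      proof (cases "c < ?n (Suc i)")
        case True
        then show ?thesis using w(2)[OF True] up[OF True, of w] by (simp add: x_def)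
      next
        case False
        then obtain r where r: "c = ?n (Suc i) + r" "r < ?n i"
          using c by (metis add_less_cancel_left le_Suc_ex not_less)
        then show ?thesis using w(3)[OF r(2)] low[of i r w] by (simp add: y_def)
      qed
      then show ?im using w(1) by (auto simp: len_Suc)
    next
      assume ?im
      then obtain w where w: "w \<in> strand (cone_degrees S s (Suc (Suc i))) W"
        "\<And>c. c < ?n (Suc i) + ?n i \<Longrightarrow> v c = (\<Sum>k<?n (Suc (Suc i)) + ?n (Suc i). cone_scalars s \<mu> (Suc i) c k * w k)"
        by (auto simp: len_Suc)
      define a where "a = (\<lambda>c. if c < ?n (Suc (Suc i)) then w c else 0)"
      define b where "b = (\<lambda>c. w (?n (Suc (Suc i)) + c))"
      have a: "a \<in> strand (s (Suc (Suc i))) W" and bS: "\<And>c. c < ?n (Suc i) \<Longrightarrow> b c \<noteq> 0 \<Longrightarrow> s (Suc i) ! c \<union> S \<subseteq> W"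
        and wlen: "\<And>c. w c \<noteq> 0 \<Longrightarrow> c < ?n (Suc (Suc i)) + ?n (Suc i)"
        using w(1) unfolding strand_iff a_def b_def by auto
      have b: "b \<in> strand (s (Suc i)) W" using bS wlen by (fastforce simp: strand_def b_def)
      define da where "da = (\<lambda>c. if c < ?n (Suc i) then \<Sum>k<?n (Suc (Suc i)). \<mu> (Suc i) c k * a k else 0)"
      have xe: "x c = da c + b c" if "c < ?n (Suc i)" for c
      proof -
        have "(\<Sum>k<?n (Suc (Suc i)). \<mu> (Suc i) c k * w k) = (\<Sum>k<?n (Suc (Suc i)). \<mu> (Suc i) c k * a k)"
          by (intro sum.cong) (auto simp: a_def)
        then show ?thesis using that w(2)[of c] up[OF that, of w] by (simp add: x_def da_def b_def)
      qed
      have ye: "y c = - (\<Sum>k<?n (Suc i). \<mu> i c k * b k)" if "c < ?n i" for c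
        using that w(2)[of "?n (Suc i) + c"] low[of i c w] by (simp add: y_def b_def)
      have da: "da \<in> strand (s (Suc i)) W"
        unfolding strand_def
      proof (intro CollectI allI impI)
        fix c assume "da c \<noteq> 0"
        then have c: "c < ?n (Suc i)" and "(\<Sum>k<?n (Suc (Suc i)). \<mu> (Suc i) c k * a k) \<noteq> 0"
          by (auto simp: da_def split: if_splits)
        then obtain k where "k < ?n (Suc (Suc i))" "\<mu> (Suc i) c k * a k \<noteq> 0"
          by (meson lessThan_iff sum.neutral)
        then show "c < ?n (Suc i) \<and> s (Suc i) ! c \<subseteq> W"
          using D(2)[of c "Suc i" k] c strandD[OF a, of k] by auto
      qed
      have dda: "(\<Sum>c<?n (Suc i). \<mu> i r c * da c) = 0" if "r < ?n i" for r
        using D(4)[OF da] a that by (auto simp: da_def)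
      show ?ker
      proof (intro allI impI)
        fix r assume r: "r < length (cone_degrees S s i)"
        show "(\<Sum>c<length (cone_degrees S s (Suc i)). cone_scalars s \<mu> i r c * v c) = 0"
        proof (cases "r < ?n i")
          case True
          have "(\<Sum>c<?n (Suc i). \<mu> i r c * x c) = (\<Sum>c<?n (Suc i). \<mu> i r c * da c) + (\<Sum>c<?n (Suc i). \<mu> i r c * b c)"
            unfolding sum.distrib[symmetric] by (intro sum.cong) (auto simp: xe distrib_left)
          then show ?thesis
            unfolding len_Suc up[OF True] sum_x using dda[OF True] ye[OF True] by (simp add: y_def)
        next
          case False
          then obtain j where j: "i = Suc j" using r by (cases i) (auto simp: deg_0)
          then obtain r' where r': "r = ?n (Suc j) + r'" "r' < ?n j"
            using False r len_Suc[of j] by (metis add_less_cancel_left le_Suc_ex not_less)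
          have "(\<Sum>c<?n (Suc j). \<mu> j r' c * y c) = 0"
          proof -
            have b': "(\<lambda>c. - b c) \<in> strand (s (Suc (Suc j))) W" using b unfolding j by (auto simp: strand_def)
            have "\<forall>c<?n (Suc j). y c = (\<Sum>k<?n (Suc (Suc j)). \<mu> (Suc j) c k * - b k)"
              using ye unfolding j by (simp add: sum_negf)
            then have "\<exists>w \<in> strand (s (Suc (Suc j))) W. \<forall>c<?n (Suc j). y c = (\<Sum>k<?n (Suc (Suc j)). \<mu> (Suc j) c k * w k)"
              using b' by (intro bexI[of _ "\<lambda>c. - b c"])
            then show ?thesis using D(4)[OF y[unfolded j]] r'(2) by simp
          qed
          then show ?thesis unfolding len_Suc r' j low by (simp add: y_def j)
        qed
      qed
    qed
  qed
qed

section \<open>Regularity\<close>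

text \<open>Any squarefree resolution bounds the regularity, since a minimal one has no other degrees.\<close>

lemma reg_quot_le:
  fixes \<mu> :: "nat \<Rightarrow> nat \<Rightarrow> nat \<Rightarrow> 'k::field" and \<Gamma> :: "'n::finite set set"
  assumes "sqfree_resolution \<Gamma> s \<mu>"
    and "\<And>i A. A \<in> set (s i) \<Longrightarrow> ereal (real (card A) - real i) \<le> b"
  shows "reg_quot (nonface_ideal \<Gamma> :: ('n, 'k) mpoly set) \<le> b"
proof (cases "(nonface_ideal \<Gamma> :: ('n, 'k) mpoly set) = UNIV")
  case False
  have "ereal (real j - real i) \<le> b"
    if "minimal_graded_free_resolution (nonface_ideal \<Gamma> :: ('n, 'k) mpoly set) a d" "j \<in> set (a i)" for i j a d
  proof -
    have "j \<in> set (map card (s i))"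
      using minimal_resolution_degrees_subset[OF that(1) graded_free_resolution_sqfree[OF assms(1)], of i] that(2) by blast
    then show ?thesis using assms(2) by auto
  qed
  then show ?thesis unfolding reg_quot_def using False by (auto intro!: Sup_least)
qed (simp add: reg_quot_def)

lemma reg_quot_ge:
  fixes \<mu> :: "nat \<Rightarrow> nat \<Rightarrow> nat \<Rightarrow> 'k::field" and \<Gamma> :: "'n::finite set set"
  assumes \<Gamma>: "upset \<Gamma>" "{} \<notin> \<Gamma>" and res: "minimal_sqfree_resolution \<Gamma> s \<mu>" and A: "A \<in> set (s i)"
  shows "ereal (real (card A) - real i) \<le> reg_quot (nonface_ideal \<Gamma> :: ('n, 'k) mpoly set)"
proof -
  have "(nonface_ideal \<Gamma> :: ('n, 'k) mpoly set) \<noteq> UNIV" using \<Gamma> nonface_ideal_eq_UNIV_iff by blast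
  moreover have "card A \<in> set (map card (s i))" using A by simp
  then have "ereal (real (card A) - real i) \<le> Sup {ereal (real j - real i) | i j.
      \<exists>a d. minimal_graded_free_resolution (nonface_ideal \<Gamma> :: ('n, 'k) mpoly set) a d \<and> j \<in> set (a i)}"
    using minimal_graded_free_resolution_sqfree[OF res] by (intro Sup_upper) blast
  ultimately show ?thesis by (simp add: reg_quot_def)
qed

lemma reg_quot_colon:
  assumes \<Gamma>: "upset \<Gamma>"
  shows "reg_quot (colon (nonface_ideal \<Gamma>) (sqfree_monomial S :: ('n::finite, 'k::field) mpoly))
    \<le> reg_quot (nonface_ideal \<Gamma> :: ('n, 'k) mpoly set)"
proof (cases "{} \<in> \<Gamma>")
  case True
  then have "{} \<in> {B. B \<union> S \<in> \<Gamma>}" using upsetD[OF \<Gamma>] by auto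
  then have "colon (nonface_ideal \<Gamma>) (sqfree_monomial S :: ('n, 'k) mpoly) = UNIV"
    unfolding colon_nonface_ideal nonface_ideal_eq_UNIV_iff[OF upset_colon[OF \<Gamma>]] .
  then show ?thesis by (simp add: reg_quot_def)
next
  case False
  obtain s and \<mu> :: "nat \<Rightarrow> nat \<Rightarrow> nat \<Rightarrow> 'k" where res: "minimal_sqfree_resolution \<Gamma> s \<mu>"
    using minimal_sqfree_resolution_exists[OF \<Gamma> False] by blast
  show ?thesis
    unfolding colon_nonface_ideal
  proof (rule reg_quot_le)
    show "sqfree_resolution {B. B \<union> S \<in> \<Gamma>} (\<lambda>i. map (\<lambda>A. A - S) (s i)) \<mu>"
      using res by (intro dehomogenized_resolution) (simp add: minimal_sqfree_resolution_def)
    fix i A assume "A \<in> set (map (\<lambda>A. A - S) (s i))"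
    then obtain B where B: "B \<in> set (s i)" "A = B - S" by auto
    have "card A \<le> card B" using B by (auto intro: card_mono)
    then have "ereal (real (card A) - real i) \<le> ereal (real (card B) - real i)" by simp
    also have "\<dots> \<le> reg_quot (nonface_ideal \<Gamma> :: ('n, 'k) mpoly set)" by (rule reg_quot_ge[OF \<Gamma> False res B(1)])
    finally show "ereal (real (card A) - real i) \<le> reg_quot (nonface_ideal \<Gamma> :: ('n, 'k) mpoly set)" .
  qed
qed

text \<open>The degrees of the cone in position \<open>i\<close> are those of the old resolution in position \<open>i\<close>, and in position \<open>i - 1\<close>
  those enlarged by \<open>S\<close>.\<close>

lemma reg_quot_adjoin:
  assumes \<Gamma>: "upset \<Gamma>"
  shows "reg_quot (adjoin (nonface_ideal \<Gamma>) (sqfree_monomial S :: ('n::finite, 'k::field) mpoly))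
    \<le> reg_quot (nonface_ideal \<Gamma> :: ('n, 'k) mpoly set) + ereal (real (card S)) - 1"
proof (cases "{} \<in> \<Gamma> \<union> {B. S \<subseteq> B}")
  case True
  then have "adjoin (nonface_ideal \<Gamma>) (sqfree_monomial S :: ('n, 'k) mpoly) = UNIV"
    unfolding adjoin_nonface_ideal[OF \<Gamma>] nonface_ideal_eq_UNIV_iff[OF upset_adjoin[OF \<Gamma>]] .
  then show ?thesis by (simp add: reg_quot_def)
next
  case False
  let ?r = "reg_quot (nonface_ideal \<Gamma> :: ('n, 'k) mpoly set)"
  have F: "{} \<notin> \<Gamma>" "S \<noteq> {}" using False by auto
  then have k: "card S \<ge> 1" by (simp add: Suc_le_eq card_gt_0_iff)
  obtain s and \<mu> :: "nat \<Rightarrow> nat \<Rightarrow> nat \<Rightarrow> 'k" where res: "minimal_sqfree_resolution \<Gamma> s \<mu>"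
    using minimal_sqfree_resolution_exists[OF \<Gamma> F(1)] by blast
  have shift: "ereal (x + real (card S) - 1) \<le> ?r + ereal (real (card S)) - 1" if "ereal x \<le> ?r" for x
    using that by (cases ?r) (auto simp: one_ereal_def)
  show ?thesis
    unfolding adjoin_nonface_ideal[OF \<Gamma>]
  proof (rule reg_quot_le)
    show "sqfree_resolution (\<Gamma> \<union> {B. S \<subseteq> B}) (cone_degrees S s) (cone_scalars s \<mu>)"
      using res by (intro cone_resolution) (simp add: minimal_sqfree_resolution_def)
    have old: "ereal (real (card A) - real i) \<le> ?r + ereal (real (card S)) - 1" if "A \<in> set (s i)" for A i
    proof -
      have "ereal (real (card A) - real i) \<le> ereal ((real (card A) - real i) + real (card S) - 1)"
        using k by simp
      also have "\<dots> \<le> ?r + ereal (real (card S)) - 1" by (rule shift[OF reg_quot_ge[OF \<Gamma> F(1) res that]])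
      finally show ?thesis .
    qed
    fix i A assume A: "A \<in> set (cone_degrees S s i)"
    show "ereal (real (card A) - real i) \<le> ?r + ereal (real (card S)) - 1"
    proof (cases "A \<in> set (s i)")
      case True then show ?thesis by (rule old)
    next
      case False
      then obtain j B where j: "i = Suc j" and B: "B \<in> set (s j)" "A = B \<union> S"
        using A by (auto simp: cone_degrees_def split: nat.splits)
      have "card A \<le> card B + card S" unfolding B(2) by (rule card_Un_le)
      then have "ereal (real (card A) - real i) \<le> ereal ((real (card B) - real j) + real (card S) - 1)"
        using j by simp
      also have "\<dots> \<le> ?r + ereal (real (card S)) - 1" by (rule shift[OF reg_quot_ge[OF \<Gamma> F(1) res B(1)]])
      finally show ?thesis .
    qed
  qed
qed

text \<open>Adjoining variables one at a time; the intermediate ideals are again squarefree monomial ideals, so the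
  induction has to carry their description.\<close>

lemma depth_quot_variables:
  assumes \<Gamma>: "upset \<Gamma>"
  shows "\<exists>\<Gamma>'. upset \<Gamma>' \<and> ideal_of (Var ` S \<union> nonface_ideal \<Gamma>) = (nonface_ideal \<Gamma>' :: ('n::finite, 'k::field) mpoly set) \<and>
    depth_quot (nonface_ideal \<Gamma> :: ('n, 'k) mpoly set) \<le> depth_quot (nonface_ideal \<Gamma>' :: ('n, 'k) mpoly set) + ereal (real (card S))"
proof (induction S rule: finite_induct[OF finite])
  case 1
  have "ideal_of (nonface_ideal \<Gamma>) = (nonface_ideal \<Gamma> :: ('n, 'k) mpoly set)"
    using ideal_nonface_ideal[OF \<Gamma>] by simp
  then show ?case using \<Gamma> by (intro exI[of _ \<Gamma>]) (simp flip: zero_ereal_def)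
next
  case (2 x S)
  then obtain \<Gamma>' where \<Gamma>': "upset \<Gamma>'" "ideal_of (Var ` S \<union> nonface_ideal \<Gamma>) = (nonface_ideal \<Gamma>' :: ('n, 'k) mpoly set)"
    "depth_quot (nonface_ideal \<Gamma> :: ('n, 'k) mpoly set) \<le> depth_quot (nonface_ideal \<Gamma>' :: ('n, 'k) mpoly set) + ereal (real (card S))"
    by blast
  let ?\<Delta> = "\<Gamma>' \<union> {B. {x} \<subseteq> B}"
  have eq: "adjoin (nonface_ideal \<Gamma>') (Var x) = (nonface_ideal ?\<Delta> :: ('n, 'k) mpoly set)"
    unfolding Var_eq_sqfree_monomial by (rule adjoin_nonface_ideal[OF \<Gamma>'(1)])
  have "ideal_of (Var ` insert x S \<union> nonface_ideal \<Gamma>) = (nonface_ideal ?\<Delta> :: ('n, 'k) mpoly set)"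
    unfolding eq[symmetric] \<Gamma>'(2)[symmetric] adjoin_span by simp
  moreover have "depth_quot (nonface_ideal \<Gamma>' :: ('n, 'k) mpoly set) \<le> depth_quot (nonface_ideal ?\<Delta> :: ('n, 'k) mpoly set) + 1"
    using depth_quot_adjoin[OF \<Gamma>'(1), of "{x}", where ?'k = 'k] adjoin_nonface_ideal[OF \<Gamma>'(1), of "{x}", where ?'b = 'k]
    by (simp add: ereal_minus_le_iff add.commute)
  then have "depth_quot (nonface_ideal \<Gamma> :: ('n, 'k) mpoly set)
      \<le> (depth_quot (nonface_ideal ?\<Delta> :: ('n, 'k) mpoly set) + 1) + ereal (real (card S))"
    using \<Gamma>'(3) by (meson add_right_mono order_trans)
  then have "depth_quot (nonface_ideal \<Gamma> :: ('n, 'k) mpoly set)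
      \<le> depth_quot (nonface_ideal ?\<Delta> :: ('n, 'k) mpoly set) + ereal (real (card (insert x S)))"
    using 2 by (simp add: add.assoc one_ereal_def)
  ultimately show ?case using upset_adjoin[OF \<Gamma>'(1)] by blast
qed

theorem proposition2p8:
  shows
    "let c1 = (\<forall>(I :: ('n::finite, 'k::field) mpoly set) S. sqfree_monomial_ideal I \<longrightarrow>
           depth_quot (ideal_of (insert (sqfree_monomial S) I)) \<ge> depth_quot I - 1);
         c2 = (\<forall>(I :: ('n, 'k) mpoly set) S. sqfree_monomial_ideal I \<longrightarrow>
           depth_quot I \<le> depth_quot (colon I (sqfree_monomial S)));
         c3 = (\<forall>(I :: ('n, 'k) mpoly set) S. sqfree_monomial_ideal I \<longrightarrow>
           depth_quot (ideal_of (Var ` S \<union> I)) \<ge> depth_quot I - ereal (real (card S)));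
         c4 = (\<forall>(I :: ('n, 'k) mpoly set) S. sqfree_monomial_ideal I \<longrightarrow>
           reg_quot I \<ge> reg_quot (colon I (sqfree_monomial S)));
         c5 = (\<forall>(I :: ('n, 'k) mpoly set) S. sqfree_monomial_ideal I \<longrightarrow>
           reg_quot (ideal_of (insert (sqfree_monomial S) I))
             \<le> reg_quot I + ereal (real (card S)) - 1)
     in ((c1 \<longleftrightarrow> c2) \<and> (c2 \<longleftrightarrow> c3) \<and> (c3 \<longleftrightarrow> c4) \<and> (c4 \<longleftrightarrow> c5)) \<and>
        (c1 \<and> c2 \<and> c3 \<and> c4 \<and> c5)"
proof -
  have "depth_quot I - 1 \<le> depth_quot (ideal_of (insert (sqfree_monomial S) I))"
    and "depth_quot I \<le> depth_quot (colon I (sqfree_monomial S))"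
    and "depth_quot I - ereal (real (card S)) \<le> depth_quot (ideal_of (Var ` S \<union> I))"
    and "reg_quot (colon I (sqfree_monomial S)) \<le> reg_quot I"
    and "reg_quot (ideal_of (insert (sqfree_monomial S) I)) \<le> reg_quot I + ereal (real (card S)) - 1"
    if sq: "sqfree_monomial_ideal I" for I :: "('n, 'k) mpoly set" and S :: "'n set"
  proof -
    obtain \<Gamma> where \<Gamma>: "upset \<Gamma>" "I = nonface_ideal \<Gamma>" using sq sqfree_monomial_ideal_iff by blast
    show "depth_quot I - 1 \<le> depth_quot (ideal_of (insert (sqfree_monomial S) I))"
      unfolding \<Gamma>(2) by (rule depth_quot_adjoin[OF \<Gamma>(1), unfolded adjoin_def])
    show "depth_quot I \<le> depth_quot (colon I (sqfree_monomial S))"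
      unfolding \<Gamma>(2) by (rule depth_quot_colon[OF \<Gamma>(1)])
    show "depth_quot I - ereal (real (card S)) \<le> depth_quot (ideal_of (Var ` S \<union> I))"
      unfolding \<Gamma>(2) using depth_quot_variables[OF \<Gamma>(1), of S, where ?'k = 'k]
      by (auto simp: ereal_minus_le_iff add.commute)
    show "reg_quot (colon I (sqfree_monomial S)) \<le> reg_quot I"
      unfolding \<Gamma>(2) by (rule reg_quot_colon[OF \<Gamma>(1)])
    show "reg_quot (ideal_of (insert (sqfree_monomial S) I)) \<le> reg_quot I + ereal (real (card S)) - 1"
      unfolding \<Gamma>(2) by (rule reg_quot_adjoin[OF \<Gamma>(1), unfolded adjoin_def])
  qed
  then show ?thesis unfolding Let_def by blast
qed

end
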